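(* On a contact manifold $(M,H)$ let a contact projective structure be given. Choose a contact one-form $\theta$, and let $T$ denote its Reeb vector field. There exists a unique affine connection $\nabla$ on $M$, with torsion tensor $\tau$, having among its unparameterized geodesics the given contact geodesics and satisfying: (1) $\nabla\theta=0$; (2) $\nabla d\theta=0$; (3) $i(T)\tau=0$, i.e. $\tau(T,X)=0$ for every vector field $X$; (4) the trace of the torsion of $\nabla$ vanishes, i.e. for every vector field $Y$ the trace of the endomorphism $X\mapsto\tau(Y,X)$ of $TM$ is zero.
   Context: All objects are smooth. A contact manifold $(M,H)$ is a manifold of dimension $2n-1$ ($n\ge 2$) with a maximally non-integrable codimension one distribution $H\subset TM$; it is assumed co-oriented (an orientation of $(TM/H)^*$ is fixed). A contact one-form is a non-vanishing one-form $\theta$ annihilating $H$; then $\theta\wedge(d\theta)^{n-1}\neq 0$. Its Reeb vector field $T$ is determined by $\theta(T)=1$, $i(T)d\theta=0$. A path is a smoothly immersed one-dimensional submanifold; a contact path is a path everywhere tangent to $H$. A contact path geometry on $(M,H)$ is a $(4n-5)$-parameter family of contact paths such that for every $x\in M$ and every one-dimensional subspace $L\subset H_x$ there is a unique path of the family passing through $x$ and tangent to $L$. A contact projective structure is a contact path geometry whose paths are among the unparameterized geodesics of some affine connection on $M$; its paths are called its contact geodesics. Affine connections are allowed to have torsion; $\tau(X,Y)=\nabla_XY-\nabla_YX-[X,Y]$. *)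

theory Defs
  imports "HOL-Analysis.Analysis"
begin

section \<open>Smooth maps between open subsets of Euclidean spaces\<close>

(* Only ever used for open S and finite-dimensional domains, where it is the usual notion. *)

primrec Ck_on :: "nat \<Rightarrow> 'a::real_normed_vector set \<Rightarrow> ('a \<Rightarrow> 'b::real_normed_vector) \<Rightarrow> bool" where
  "Ck_on 0 S f \<longleftrightarrow> continuous_on S f"
| "Ck_on (Suc k) S f \<longleftrightarrow>
     (\<forall>x\<in>S. f differentiable (at x)) \<and> (\<forall>v. Ck_on k S (\<lambda>x. frechet_derivative f (at x) v))"

definition smooth_on :: "'a::real_normed_vector set \<Rightarrow> ('a \<Rightarrow> 'b::real_normed_vector) \<Rightarrow> bool" where
  "smooth_on S f \<longleftrightarrow> (\<forall>k. Ck_on k S f)"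


section \<open>Smooth manifolds\<close>

(* The underlying set of the manifold is the whole type 'm, whose topology is that of the
   type class; a chart is its domain together with the coordinate map (only the values on the
   domain matter). *)

type_synonym ('m, 'a) chart = "'m set \<times> ('m \<Rightarrow> 'a)"

abbreviation cdom :: "('m, 'a) chart \<Rightarrow> 'm set" where "cdom \<equiv> fst"
abbreviation cmap :: "('m, 'a) chart \<Rightarrow> 'm \<Rightarrow> 'a" where "cmap \<equiv> snd"
abbreviation ccod :: "('m, 'a) chart \<Rightarrow> 'a set" where "ccod c \<equiv> cmap c ` cdom c"
abbreviation cinv :: "('m, 'a) chart \<Rightarrow> 'a \<Rightarrow> 'm" where "cinv c \<equiv> inv_into (cdom c) (cmap c)"

definition is_chart :: "('m::topological_space, 'a::euclidean_space) chart \<Rightarrow> bool" where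
  "is_chart c \<longleftrightarrow> open (cdom c) \<and> open (ccod c) \<and> homeomorphism (cdom c) (ccod c) (cmap c) (cinv c)"

definition smooth_atlas :: "('m::topological_space, 'a::euclidean_space) chart set \<Rightarrow> bool" where
  "smooth_atlas A \<longleftrightarrow>
     (\<forall>c\<in>A. is_chart c) \<and> (\<Union>c\<in>A. cdom c) = UNIV \<and>
     (\<forall>c\<in>A. \<forall>d\<in>A. smooth_on (cmap c ` (cdom c \<inter> cdom d)) (cmap d \<circ> cinv c))"

definition smooth_fun :: "('m::topological_space, 'a::euclidean_space) chart set \<Rightarrow> ('m \<Rightarrow> real) \<Rightarrow> bool" where
  "smooth_fun A f \<longleftrightarrow> (\<forall>c\<in>A. smooth_on (ccod c) (f \<circ> cinv c))"

definition smooth_into ::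
    "('m::topological_space, 'a::euclidean_space) chart set \<Rightarrow> 's::euclidean_space set \<Rightarrow> ('s \<Rightarrow> 'm) \<Rightarrow> bool" where
  "smooth_into A S g \<longleftrightarrow>
     continuous_on S g \<and> (\<forall>c\<in>A. smooth_on {s\<in>S. g s \<in> cdom c} (cmap c \<circ> g))"


section \<open>Tangent vectors, vector fields, one-forms\<close>

(* Every point x has a preferred chart, and the tangent space at x is identified with the model
   space 'a by means of it.  So a tangent vector at x is an element of 'a, a vector field is
   a function 'm => 'a, a one-form a function 'm => 'a => real, an endomorphism of the
   tangent space at x a linear map 'a => 'a.  The preferred chart varies discontinuously with x;
   smoothness is therefore never expressed by the raw functions, but by their components in
   the charts of the atlas, which are obtained with the two maps
     to_coords A c x      : tangent space at x -> R^m, components in the chart c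
     from_coords A c p    : R^m -> tangent space at the point with coordinates p in the chart c. *)

definition chart_at :: "('m, 'a) chart set \<Rightarrow> 'm \<Rightarrow> ('m, 'a) chart" where
  "chart_at A x = (SOME c. c \<in> A \<and> x \<in> cdom c)"

abbreviation pt :: "('m, 'a) chart set \<Rightarrow> 'm \<Rightarrow> 'a" where
  "pt A x \<equiv> cmap (chart_at A x) x"

definition to_coords ::
    "('m, 'a::euclidean_space) chart set \<Rightarrow> ('m, 'a) chart \<Rightarrow> 'm \<Rightarrow> 'a \<Rightarrow> 'a" where
  "to_coords A c x v = frechet_derivative (cmap c \<circ> cinv (chart_at A x)) (at (pt A x)) v"

definition from_coords ::
    "('m, 'a::euclidean_space) chart set \<Rightarrow> ('m, 'a) chart \<Rightarrow> 'a \<Rightarrow> 'a \<Rightarrow> 'a" where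
  "from_coords A c p v = frechet_derivative (cmap (chart_at A (cinv c p)) \<circ> cinv c) (at p) v"

definition vf_rep ::
    "('m, 'a::euclidean_space) chart set \<Rightarrow> ('m, 'a) chart \<Rightarrow> ('m \<Rightarrow> 'a) \<Rightarrow> 'a \<Rightarrow> 'a" where
  "vf_rep A c X p = to_coords A c (cinv c p) (X (cinv c p))"

definition form_rep ::
    "('m, 'a::euclidean_space) chart set \<Rightarrow> ('m, 'a) chart \<Rightarrow> ('m \<Rightarrow> 'a \<Rightarrow> real) \<Rightarrow> 'a \<Rightarrow> 'a \<Rightarrow> real" where
  "form_rep A c \<alpha> p v = \<alpha> (cinv c p) (from_coords A c p v)"

definition vector_fields :: "('m::topological_space, 'a::euclidean_space) chart set \<Rightarrow> ('m \<Rightarrow> 'a) set" where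
  "vector_fields A = {X. \<forall>c\<in>A. smooth_on (ccod c) (vf_rep A c X)}"

definition one_form_on ::
    "('m::topological_space, 'a::euclidean_space) chart set \<Rightarrow> 'm set \<Rightarrow> ('m \<Rightarrow> 'a \<Rightarrow> real) \<Rightarrow> bool" where
  "one_form_on A U \<alpha> \<longleftrightarrow>
     (\<forall>x\<in>U. linear (\<alpha> x)) \<and>
     (\<forall>c\<in>A. \<forall>v. smooth_on (cmap c ` (cdom c \<inter> U)) (\<lambda>p. form_rep A c \<alpha> p v))"

definition vf_apply ::
    "('m, 'a::euclidean_space) chart set \<Rightarrow> ('m \<Rightarrow> 'a) \<Rightarrow> ('m \<Rightarrow> real) \<Rightarrow> 'm \<Rightarrow> real" where
  "vf_apply A X f x = frechet_derivative (f \<circ> cinv (chart_at A x)) (at (pt A x)) (X x)"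

(* In any chart, [X,Y]^k = X^i d_i Y^k - Y^i d_i X^k; evaluated in the preferred chart at x. *)

definition lie_bracket ::
    "('m, 'a::euclidean_space) chart set \<Rightarrow> ('m \<Rightarrow> 'a) \<Rightarrow> ('m \<Rightarrow> 'a) \<Rightarrow> 'm \<Rightarrow> 'a" where
  "lie_bracket A X Y x =
     frechet_derivative (vf_rep A (chart_at A x) Y) (at (pt A x)) (X x) -
     frechet_derivative (vf_rep A (chart_at A x) X) (at (pt A x)) (Y x)"

(* In any chart, (d alpha)(u,v) = u^i v^j (d_i alpha_j - d_j alpha_i); evaluated in the preferred
   chart at x.  This is the normalization d alpha(X,Y) = X(alpha Y) - Y(alpha X) - alpha [X,Y]. *)

definition ext_deriv ::
    "('m, 'a::euclidean_space) chart set \<Rightarrow> ('m \<Rightarrow> 'a \<Rightarrow> real) \<Rightarrow> 'm \<Rightarrow> 'a \<Rightarrow> 'a \<Rightarrow> real" where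
  "ext_deriv A \<alpha> x u v =
     frechet_derivative (\<lambda>p. form_rep A (chart_at A x) \<alpha> p v) (at (pt A x)) u -
     frechet_derivative (\<lambda>p. form_rep A (chart_at A x) \<alpha> p u) (at (pt A x)) v"


section \<open>Affine connections\<close>

(* nabla X Y is the covariant derivative of Y along X.  The extensional function space makes
   equality of connections mean equality on smooth vector fields. *)

definition affine_connection ::
    "('m::topological_space, 'a::euclidean_space) chart set \<Rightarrow> (('m \<Rightarrow> 'a) \<Rightarrow> ('m \<Rightarrow> 'a) \<Rightarrow> 'm \<Rightarrow> 'a) \<Rightarrow> bool" where
  "affine_connection A nabla \<longleftrightarrow>
     nabla \<in> vector_fields A \<rightarrow>\<^sub>E (vector_fields A \<rightarrow>\<^sub>E vector_fields A) \<and>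
     (\<forall>X\<in>vector_fields A. \<forall>Y\<in>vector_fields A. \<forall>Z\<in>vector_fields A.
        nabla (\<lambda>x. X x + Y x) Z = (\<lambda>x. nabla X Z x + nabla Y Z x) \<and>
        nabla X (\<lambda>x. Y x + Z x) = (\<lambda>x. nabla X Y x + nabla X Z x)) \<and>
     (\<forall>f X Y. smooth_fun A f \<and> X \<in> vector_fields A \<and> Y \<in> vector_fields A \<longrightarrow>
        nabla (\<lambda>x. f x *\<^sub>R X x) Y = (\<lambda>x. f x *\<^sub>R nabla X Y x) \<and>
        nabla X (\<lambda>x. f x *\<^sub>R Y x) = (\<lambda>x. vf_apply A X f x *\<^sub>R Y x + f x *\<^sub>R nabla X Y x))"

definition cov_deriv1 ::
    "('m, 'a::euclidean_space) chart set \<Rightarrow> (('m \<Rightarrow> 'a) \<Rightarrow> ('m \<Rightarrow> 'a) \<Rightarrow> 'm \<Rightarrow> 'a) \<Rightarrow>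
     ('m \<Rightarrow> 'a \<Rightarrow> real) \<Rightarrow> ('m \<Rightarrow> 'a) \<Rightarrow> ('m \<Rightarrow> 'a) \<Rightarrow> 'm \<Rightarrow> real" where
  "cov_deriv1 A nabla \<alpha> X Y x = vf_apply A X (\<lambda>y. \<alpha> y (Y y)) x - \<alpha> x (nabla X Y x)"

definition cov_deriv2 ::
    "('m, 'a::euclidean_space) chart set \<Rightarrow> (('m \<Rightarrow> 'a) \<Rightarrow> ('m \<Rightarrow> 'a) \<Rightarrow> 'm \<Rightarrow> 'a) \<Rightarrow>
     ('m \<Rightarrow> 'a \<Rightarrow> 'a \<Rightarrow> real) \<Rightarrow> ('m \<Rightarrow> 'a) \<Rightarrow> ('m \<Rightarrow> 'a) \<Rightarrow> ('m \<Rightarrow> 'a) \<Rightarrow> 'm \<Rightarrow> real" where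
  "cov_deriv2 A nabla \<beta> X Y Z x =
     vf_apply A X (\<lambda>y. \<beta> y (Y y) (Z y)) x - \<beta> x (nabla X Y x) (Z x) - \<beta> x (Y x) (nabla X Z x)"

definition torsion ::
    "('m, 'a::euclidean_space) chart set \<Rightarrow> (('m \<Rightarrow> 'a) \<Rightarrow> ('m \<Rightarrow> 'a) \<Rightarrow> 'm \<Rightarrow> 'a) \<Rightarrow>
     ('m \<Rightarrow> 'a) \<Rightarrow> ('m \<Rightarrow> 'a) \<Rightarrow> 'm \<Rightarrow> 'a" where
  "torsion A nabla X Y x = nabla X Y x - nabla Y X x - lie_bracket A X Y x"

(* The endomorphism of the tangent space at x induced by a map Phi on vector fields that is
   linear over smooth functions. *)

definition endo_at ::
    "('m::topological_space, 'a::euclidean_space) chart set \<Rightarrow> (('m \<Rightarrow> 'a) \<Rightarrow> 'm \<Rightarrow> 'a) \<Rightarrow> 'm \<Rightarrow> 'a \<Rightarrow> 'a" where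
  "endo_at A \<Phi> x = (THE L. linear L \<and> (\<forall>X\<in>vector_fields A. L (X x) = \<Phi> X x))"

definition endo_trace :: "('a::euclidean_space \<Rightarrow> 'a) \<Rightarrow> real" where
  "endo_trace L = (\<Sum>b\<in>Basis. L b \<bullet> b)"


section \<open>Paths and geodesics\<close>

definition velocity :: "('m, 'a::euclidean_space) chart set \<Rightarrow> (real \<Rightarrow> 'm) \<Rightarrow> real \<Rightarrow> 'a" where
  "velocity A \<gamma> t = vector_derivative (cmap (chart_at A (\<gamma> t)) \<circ> \<gamma>) (at t)"

definition immersed_curve ::
    "('m::topological_space, 'a::euclidean_space) chart set \<Rightarrow> real set \<Rightarrow> (real \<Rightarrow> 'm) \<Rightarrow> bool" where
  "immersed_curve A I \<gamma> \<longleftrightarrow>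
     open I \<and> connected I \<and> I \<noteq> {} \<and> smooth_into A I \<gamma> \<and> (\<forall>t\<in>I. velocity A \<gamma> t \<noteq> 0)"

(* An unparameterized immersed path is represented by the set of its tangent lines (x, L): this
   does not depend on the parameterization, and it keeps apart the branches of a path that
   crosses itself.  A closed path is the image of an immersed curve defined on all of R.
   "P passes through x and is tangent to L" is (x, L) : P. *)

definition tangent_lines ::
    "('m, 'a::euclidean_space) chart set \<Rightarrow> real set \<Rightarrow> (real \<Rightarrow> 'm) \<Rightarrow> ('m \<times> 'a set) set" where
  "tangent_lines A I \<gamma> = (\<lambda>t. (\<gamma> t, span {velocity A \<gamma> t})) ` I"

definition is_path ::
    "('m::topological_space, 'a::euclidean_space) chart set \<Rightarrow> ('m \<times> 'a set) set \<Rightarrow> bool" where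
  "is_path A P \<longleftrightarrow> (\<exists>I \<gamma>. immersed_curve A I \<gamma> \<and> P = tangent_lines A I \<gamma>)"

(* The covariant derivative of the velocity along an immersed curve is, near each parameter t,
   the value of nabla X X at points of the curve, for any vector field X extending the velocity
   near t (such X exist because the curve is immersed, and the choice of X is immaterial).
   A curve is a geodesic up to reparameterization iff this derivative is proportional to the
   velocity. *)

definition unparam_geodesic ::
    "('m::topological_space, 'a::euclidean_space) chart set \<Rightarrow> (('m \<Rightarrow> 'a) \<Rightarrow> ('m \<Rightarrow> 'a) \<Rightarrow> 'm \<Rightarrow> 'a) \<Rightarrow>
     ('m \<times> 'a set) set \<Rightarrow> bool" where
  "unparam_geodesic A nabla P \<longleftrightarrow>
     (\<exists>I \<gamma>. immersed_curve A I \<gamma> \<and> P = tangent_lines A I \<gamma> \<and>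
        (\<forall>t\<in>I. \<exists>X\<in>vector_fields A.
           (\<forall>\<^sub>F s in nhds t. X (\<gamma> s) = velocity A \<gamma> s) \<and>
           nabla X X (\<gamma> t) \<in> span {velocity A \<gamma> t}))"


section \<open>Contact structures\<close>

(* U is an open set in all uses. *)

definition contact_form_on ::
    "('m::topological_space, 'a::euclidean_space) chart set \<Rightarrow> ('m \<Rightarrow> 'a set) \<Rightarrow> 'm set \<Rightarrow>
     ('m \<Rightarrow> 'a \<Rightarrow> real) \<Rightarrow> bool" where
  "contact_form_on A H U \<alpha> \<longleftrightarrow>
     one_form_on A U \<alpha> \<and> (\<forall>x\<in>U. (\<exists>v. \<alpha> x v \<noteq> 0) \<and> (\<forall>v\<in>H x. \<alpha> x v = 0))"

definition hyperplane_distribution ::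
    "('m::topological_space, 'a::euclidean_space) chart set \<Rightarrow> ('m \<Rightarrow> 'a set) \<Rightarrow> bool" where
  "hyperplane_distribution A H \<longleftrightarrow>
     (\<forall>x. subspace (H x) \<and> dim (H x) = DIM('a) - 1 \<and>
        (\<exists>U \<alpha>. open U \<and> x \<in> U \<and> contact_form_on A H U \<alpha>))"

(* For a local defining form alpha, d alpha(X,Y) = - alpha [X,Y] on sections of H, so this says
   that the Levi form H x H -> TM/H induced by the Lie bracket is nondegenerate. *)

definition maximally_nonintegrable ::
    "('m::topological_space, 'a::euclidean_space) chart set \<Rightarrow> ('m \<Rightarrow> 'a set) \<Rightarrow> bool" where
  "maximally_nonintegrable A H \<longleftrightarrow>
     (\<forall>U \<alpha>. open U \<and> contact_form_on A H U \<alpha> \<longrightarrow>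
        (\<forall>x\<in>U. \<forall>u\<in>H x. (\<forall>v\<in>H x. ext_deriv A \<alpha> x u v = 0) \<longrightarrow> u = 0))"

(* An orientation of the line bundle (TM/H)^*, whose fibre at x consists of the covectors
   annihilating H x: a choice of open ray in each fibre, locally generated by a smooth section. *)

definition coorientation ::
    "('m::topological_space, 'a::euclidean_space) chart set \<Rightarrow> ('m \<Rightarrow> 'a set) \<Rightarrow>
     ('m \<Rightarrow> ('a \<Rightarrow> real) set) \<Rightarrow> bool" where
  "coorientation A H \<omega> \<longleftrightarrow>
     (\<forall>x. \<exists>U \<alpha>. open U \<and> x \<in> U \<and> contact_form_on A H U \<alpha> \<and>
        (\<forall>y\<in>U. \<omega> y = {\<lambda>v. r * \<alpha> y v | r. 0 < r}))"

definition contact_manifold ::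
    "('m::topological_space, 'a::euclidean_space) chart set \<Rightarrow> ('m \<Rightarrow> 'a set) \<Rightarrow>
     ('m \<Rightarrow> ('a \<Rightarrow> real) set) \<Rightarrow> bool" where
  "contact_manifold A H \<omega> \<longleftrightarrow>
     smooth_atlas A \<and> hyperplane_distribution A H \<and> maximally_nonintegrable A H \<and> coorientation A H \<omega>"

definition reeb ::
    "('m, 'a::euclidean_space) chart set \<Rightarrow> ('m \<Rightarrow> 'a \<Rightarrow> real) \<Rightarrow> 'm \<Rightarrow> 'a" where
  "reeb A \<theta> x = (THE v. \<theta> x v = 1 \<and> (\<forall>w. ext_deriv A \<theta> x v w = 0))"


section \<open>Contact path geometries and contact projective structures\<close>

(* For d = DIM('b): g (b, s), with b in an open subset B of R^d and s in an interval J, is a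
   smooth family of curves lying on paths of F.  In a chart c, with G = cmap c o g and Gs its
   s-derivative, the last condition says that (b, s) |-> (G, line of Gs), a map into the
   (d+1)-parameter variety of contact elements, is an immersion, i.e. that the d parameters
   are independent. *)

definition local_path_family ::
    "('m::topological_space, 'a::euclidean_space) chart set \<Rightarrow> ('m \<times> 'a set) set set \<Rightarrow>
     'b::euclidean_space set \<Rightarrow> real set \<Rightarrow> ('b \<times> real \<Rightarrow> 'm) \<Rightarrow> bool" where
  "local_path_family A F B J g \<longleftrightarrow>
     open B \<and> smooth_into A (B \<times> J) g \<and>
     (\<forall>b\<in>B. immersed_curve A J (\<lambda>s. g (b, s)) \<and> (\<exists>P\<in>F. tangent_lines A J (\<lambda>s. g (b, s)) \<subseteq> P)) \<and>
     (\<exists>c\<in>A. g ` (B \<times> J) \<subseteq> cdom c \<and>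
        (let G = cmap c \<circ> g; Gs = (\<lambda>z. frechet_derivative G (at z) (0, 1)) in
           \<forall>z\<in>B \<times> J. \<forall>w. frechet_derivative G (at z) w = 0 \<and>
              frechet_derivative Gs (at z) w \<in> span {Gs z} \<longrightarrow> w = 0))"

(* F is a DIM('b)-parameter family of paths: near each of its contact elements it is smoothly
   and effectively parameterized by an open subset of 'b. *)

definition contact_path_geometry ::
    "'b::euclidean_space itself \<Rightarrow> ('m::topological_space, 'a::euclidean_space) chart set \<Rightarrow>
     ('m \<Rightarrow> 'a set) \<Rightarrow> ('m \<times> 'a set) set set \<Rightarrow> bool" where
  "contact_path_geometry _ A H F \<longleftrightarrow>
     (\<forall>P\<in>F. is_path A P \<and> (\<forall>(x, L)\<in>P. L \<subseteq> H x)) \<and>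
     (\<forall>x L. subspace L \<and> dim L = 1 \<and> L \<subseteq> H x \<longrightarrow>
        (\<exists>!P. P \<in> F \<and> (x, L) \<in> P) \<and>
        (\<exists>(B :: 'b set) J g. local_path_family A F B J g \<and>
           (\<exists>b\<in>B. (x, L) \<in> tangent_lines A J (\<lambda>s. g (b, s)))))"

definition contact_projective_structure ::
    "'b::euclidean_space itself \<Rightarrow> ('m::topological_space, 'a::euclidean_space) chart set \<Rightarrow>
     ('m \<Rightarrow> 'a set) \<Rightarrow> ('m \<times> 'a set) set set \<Rightarrow> bool" where
  "contact_projective_structure tb A H F \<longleftrightarrow>
     contact_path_geometry tb A H F \<and>
     (\<exists>nabla. affine_connection A nabla \<and> (\<forall>P\<in>F. unparam_geodesic A nabla P))"

end

theory Submission
  imports Defs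
begin

text \<open>
  Let \<open>\<Omega> = d\<theta>\<close>, let \<open>T\<close> be the Reeb field and \<open>pr\<close> the projection onto \<open>H\<close> along \<open>T\<close>. The form
  \<open>B = \<Omega> + \<theta> \<otimes> \<theta>\<close> is nondegenerate, so function-linear functionals on vector fields are
  represented by vector fields.

  Existence. Let \<open>D\<close> be a connection with the given contact geodesics. Condition (3) and \<open>\<nabla>T = 0\<close> force
  \<open>\<nabla>\<^bsub>T\<^esub> Y = [T, Y]\<close>, which is compatible with (1) and (2) because \<open>i(T)d\<theta> = 0\<close> and \<open>dd\<theta> = 0\<close>. On
  \<open>H\<close> one takes \<open>pr D\<^bsub>X\<^esub> Y\<close>, corrected by a tensor that is skew in \<open>X, Y\<close>, so that the geodesics do not
  change, and that is determined by \<open>D \<Omega>\<close> in the manner of the Koszul formula. Adding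
  \<open>\<alpha>(Y) pr X + \<Omega>(X, Y) \<alpha>\<^sup>\<sharp>\<close> preserves (1)-(3) and the contact geodesics, and a suitable \<open>\<alpha>\<close>
  achieves (4).

  Uniqueness. The difference \<open>q\<close> of two solutions lives on \<open>H\<close>, is skew for \<open>\<Omega>\<close> in its second
  argument, and satisfies \<open>q(u, u) \<in> span u\<close>. By polarisation
  \<open>q(u, v) + q(v, u) = \<alpha>(u) v + \<alpha>(v) u\<close>; the trace condition gives \<open>\<alpha> = 0\<close>, so \<open>\<Omega>(q(u, v), w)\<close> is skew
  in \<open>u, v\<close> and symmetric in \<open>v, w\<close>, hence zero. That \<open>q\<close> is radial on \<open>H\<close> needs care: the same
  path may be traversed differently by the parametrisations that witness the two geodesic
  conditions, and they are compared only at accumulation points of their coincidences.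
\<close>

section \<open>Calculus of smooth maps\<close>

text \<open>That \<open>T\<close> is parallel follows from (1) and (2): differentiating
  \<open>i(T) d\<theta> = 0\<close> and \<open>\<theta>(T) = 1\<close> gives
  \<open>\<Omega>(\<nabla>_X T, .) = 0\<close> and \<open>\<theta>(\<nabla>_X T) = 0\<close>, and
  nondegeneracy does the rest. The trace condition is the right normalisation because compatibility
  with \<Omega> makes each \<open>q(u, .)\<close> trace-free, so the torsion trace sees exactly the
  freedom \<alpha> that unparameterised paths leave open; up to sign it multiplies \<alpha> by the
  dimension. Two features of the setting shape the proof. Connections act on global fields, and
  tangent spaces are identified with the model space by charts that jump from point to point; so
  local computations pass through cutoffs and frames, and smoothness and traces are read off in one
  fixed chart. Further, a path is a set of tangent lines, so two parameterisations of it come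
  without a known change of parameter; only coincidences of tangent lines are available, and a
  cardinality argument takes the place of an inverse function.\<close>

abbreviation fderiv :: "('a::real_normed_vector \<Rightarrow> 'b::real_normed_vector) \<Rightarrow> 'a \<Rightarrow> 'a \<Rightarrow> 'b" where
  "fderiv f p \<equiv> frechet_derivative f (at p)"

lemma fderiv_eqI: "(f has_derivative f') (at x) \<Longrightarrow> fderiv f x = f'"
  using frechet_derivative_at by metis

lemma has_fderiv: "f differentiable (at x) \<Longrightarrow> (f has_derivative fderiv f x) (at x)"
  by (simp add: frechet_derivative_works[symmetric])

lemma fderiv_cong:
  assumes "open S" "x \<in> S" "\<And>y. y \<in> S \<Longrightarrow> f y = g y"
  shows "fderiv f x = fderiv g x"
proof -
  \<comment> \<open>\<open>frechet_derivative\<close> is a choice from this predicate, so equivalent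
    predicates give equal values, also where neither function is differentiable.\<close>
  have "(f has_derivative f') (at x) = (g has_derivative f') (at x)" for f'
    using assms has_derivative_transform_within_open[of f f' x UNIV S g]
      has_derivative_transform_within_open[of g f' x UNIV S f] by auto
  then show ?thesis by (simp add: frechet_derivative_def)
qed

lemma differentiable_cong_open:
  assumes "open S" "x \<in> S" "\<And>y. y \<in> S \<Longrightarrow> f y = g y" "f differentiable (at x)"
  shows "g differentiable (at x)"
  using assms has_derivative_transform_within_open[of f _ x UNIV S g] unfolding differentiable_def by auto

lemma Ck_on_cong:
  assumes "open S" "\<And>x. x \<in> S \<Longrightarrow> f x = g x" "Ck_on k S f"
  shows "Ck_on k S g"
  using assms(2,3)
proof (induction k arbitrary: f g)
  case 0
  then show ?case using continuous_on_cong by (metis Ck_on.simps(1))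
next
  case (Suc k)
  have "fderiv f x v = fderiv g x v" if "x \<in> S" for x v
    using fderiv_cong[OF assms(1) that Suc.prems(1)] by simp
  moreover have "g differentiable (at x)" if "x \<in> S" for x
    using differentiable_cong_open[OF assms(1) that Suc.prems(1)] Suc.prems(2) that by simp
  ultimately show ?case
    using Suc.prems(2) Suc.IH[of "\<lambda>x. fderiv f x v" "\<lambda>x. fderiv g x v" for v] by simp
qed

lemma Ck_on_subset: "Ck_on k S f \<Longrightarrow> T \<subseteq> S \<Longrightarrow> Ck_on k T f"
  by (induction k arbitrary: f) (auto intro: continuous_on_subset)

lemma Ck_on_local:
  "(\<And>x. x \<in> S \<Longrightarrow> \<exists>U. open U \<and> x \<in> U \<and> Ck_on k U f) \<Longrightarrow> Ck_on k S f"
proof (induction k arbitrary: f)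
  case 0
  have "isCont f x" if "x \<in> S" for x
    using 0[OF that] by (auto simp: continuous_on_eq_continuous_at)
  then show ?case by (simp add: continuous_at_imp_continuous_on)
next
  case (Suc k)
  have "f differentiable (at x)" if "x \<in> S" for x
    using Suc.prems[OF that] by auto
  moreover have "Ck_on k S (\<lambda>x. fderiv f x v)" for v
    by (rule Suc.IH) (use Suc.prems in force)
  ultimately show ?case by simp
qed

lemma Ck_on_SucD: "Ck_on (Suc k) S f \<Longrightarrow> Ck_on k S f"
proof (induction k arbitrary: f)
  case 0
  then show ?case
    by (auto simp: continuous_at_imp_continuous_on differentiable_imp_continuous_within)
next
  case (Suc k)
  then show ?case by (metis Ck_on.simps(2))
qed

lemma Ck_on_const: "Ck_on k S (\<lambda>x. c)"
  by (induction k arbitrary: c) auto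

lemma Ck_on_bounded_linear:
  assumes "bounded_linear L" shows "Ck_on k S L"
proof (cases k)
  case 0
  then show ?thesis using assms by (simp add: linear_continuous_on)
next
  case (Suc j)
  have "(L has_derivative L) (at x)" for x
    using assms by (rule bounded_linear_imp_has_derivative)
  then have "fderiv L x = L" "L differentiable (at x)" for x
    by (auto intro!: fderiv_eqI simp: differentiable_def)
  then show ?thesis using Suc by (simp add: Ck_on_const)
qed

lemma Ck_on_bounded_linear_compose:
  assumes L: "bounded_linear L" and S: "open S" and f: "Ck_on k S f"
  shows "Ck_on k S (\<lambda>x. L (f x))"
  using f
proof (induction k arbitrary: f)
  case 0
  then show ?case using L by (simp add: bounded_linear.continuous_on)
next
  case (Suc k)
  have d: "((\<lambda>x. L (f x)) has_derivative (\<lambda>v. L (fderiv f x v))) (at x)" if "x \<in> S" for x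
    using bounded_linear.has_derivative[OF L has_fderiv] that Suc.prems by auto
  have "Ck_on k S (\<lambda>x. fderiv (\<lambda>x. L (f x)) x v)" for v
    by (rule Ck_on_cong[OF S _ Suc.IH[of "\<lambda>x. fderiv f x v"]])
       (use d Suc.prems in \<open>auto simp: fderiv_eqI[OF d]\<close>)
  then show ?case using d by (auto simp: differentiable_def)
qed

lemma Ck_on_add:
  assumes S: "open S" and "Ck_on k S f" "Ck_on k S g"
  shows "Ck_on k S (\<lambda>x. f x + g x)"
  using assms(2,3)
proof (induction k arbitrary: f g)
  case 0
  then show ?case by (simp add: continuous_on_add)
next
  case (Suc k)
  have d: "((\<lambda>x. f x + g x) has_derivative (\<lambda>v. fderiv f x v + fderiv g x v)) (at x)" if "x \<in> S" for x
    using Suc.prems that by (auto intro!: has_derivative_add has_fderiv)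
  have "Ck_on k S (\<lambda>x. fderiv (\<lambda>x. f x + g x) x v)" for v
    by (rule Ck_on_cong[OF S _ Suc.IH[of "\<lambda>x. fderiv f x v" "\<lambda>x. fderiv g x v"]])
       (use d Suc.prems in \<open>auto simp: fderiv_eqI[OF d]\<close>)
  then show ?case using d by (auto simp: differentiable_def)
qed

lemma Ck_on_bilinear:
  assumes bl: "bounded_bilinear pr" and S: "open S" and "Ck_on k S f" "Ck_on k S g"
  shows "Ck_on k S (\<lambda>x. pr (f x) (g x))"
  using assms(3,4)
proof (induction k arbitrary: f g)
  case 0
  then show ?case by (simp add: bounded_bilinear.continuous_on[OF bl])
next
  case (Suc k)
  have d: "((\<lambda>x. pr (f x) (g x)) has_derivative (\<lambda>v. pr (f x) (fderiv g x v) + pr (fderiv f x v) (g x))) (at x)"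
    if "x \<in> S" for x
    using Suc.prems that by (auto intro!: bounded_bilinear.FDERIV[OF bl] has_fderiv)
  have k: "Ck_on k S f" "Ck_on k S g" using Suc.prems Ck_on_SucD by blast+
  have "Ck_on k S (\<lambda>x. fderiv (\<lambda>x. pr (f x) (g x)) x v)" for v
    by (rule Ck_on_cong[OF S _ Ck_on_add[OF S Suc.IH[of "f" "\<lambda>x. fderiv g x v"]
           Suc.IH[of "\<lambda>x. fderiv f x v" "g"]]])
       (use d Suc.prems k in \<open>auto simp: fderiv_eqI[OF d]\<close>)
  then show ?case using d by (auto simp: differentiable_def)
qed

lemma Ck_on_sum:
  assumes S: "open S" and "\<And>i. i \<in> I \<Longrightarrow> Ck_on k S (f i)"
  shows "Ck_on k S (\<lambda>x. \<Sum>i\<in>I. f i x)"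
  using assms(2)
  by (induction I rule: infinite_finite_induct) (auto simp: Ck_on_const Ck_on_add[OF S])

lemma linear_euclidean_sum:
  fixes f :: "'a::euclidean_space \<Rightarrow> 'b::real_vector"
  assumes "linear f" shows "f v = (\<Sum>b\<in>Basis. (v \<bullet> b) *\<^sub>R f b)"
proof -
  have "f v = f (\<Sum>b\<in>Basis. (v \<bullet> b) *\<^sub>R b)" by (simp add: euclidean_representation)
  also have "\<dots> = (\<Sum>b\<in>Basis. (v \<bullet> b) *\<^sub>R f b)"
    using assms by (simp add: linear_sum linear_cmul)
  finally show ?thesis .
qed

text \<open>In the chain rule the direction \<open>fderiv g x v\<close> moves with the point,
  whereas \<open>Ck_on\<close> controls derivatives in fixed directions only. Expanding it over
  \<open>Basis\<close> reduces the induction step to products.\<close>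

lemma Ck_on_compose:
  fixes f :: "'a::euclidean_space \<Rightarrow> 'b::real_normed_vector" and g :: "'c::real_normed_vector \<Rightarrow> 'a"
  assumes S: "open S" and "Ck_on k T f" "Ck_on k S g" and T: "g ` S \<subseteq> T"
  shows "Ck_on k S (\<lambda>x. f (g x))"
  using assms(2-)
proof (induction k arbitrary: f)
  case 0
  then show ?case by (auto intro: continuous_on_compose2)
next
  case (Suc k)
  have d: "((\<lambda>x. f (g x)) has_derivative (\<lambda>v. fderiv f (g x) (fderiv g x v))) (at x)" if "x \<in> S" for x
  proof -
    have "(f has_derivative fderiv f (g x)) (at (g x))" "(g has_derivative fderiv g x) (at x)"
      using Suc.prems that by (auto intro!: has_fderiv)
    from has_derivative_compose[OF this(2,1)] show ?thesis .
  qed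
  have e: "fderiv f (g x) (fderiv g x v) = (\<Sum>b\<in>Basis. (fderiv g x v \<bullet> b) *\<^sub>R fderiv f (g x) b)"
    if "x \<in> S" for x v
    using Suc.prems that by (intro linear_euclidean_sum linear_frechet_derivative) auto
  have gk: "Ck_on k S g" using Suc.prems(2) by (rule Ck_on_SucD)
  have "Ck_on k S (\<lambda>x. \<Sum>b\<in>Basis. (fderiv g x v \<bullet> b) *\<^sub>R fderiv f (g x) b)" for v
    using Suc.prems gk
    by (intro Ck_on_sum[OF S] Ck_on_bilinear[OF bounded_bilinear_scaleR S]
        Ck_on_bounded_linear_compose[OF bounded_linear_inner_left S] Suc.IH) auto
  then have "Ck_on k S (\<lambda>x. fderiv (\<lambda>x. f (g x)) x v)" for v
    by (rule Ck_on_cong[OF S, rotated]) (use d e in \<open>auto simp: fderiv_eqI[OF d]\<close>)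
  then show ?case using d by (auto simp: differentiable_def)
qed

text \<open>The derivative of the inverse contains the inverse again, so the induction on
  \<open>k\<close> keeps \<open>f\<close> fixed and feeds its hypothesis back into the
  formula.\<close>

lemma Ck_on_inverse:
  fixes f :: "'a::real_normed_vector \<Rightarrow> real"
  assumes S: "open S" and f: "Ck_on k S f" and nz: "\<And>x. x \<in> S \<Longrightarrow> f x \<noteq> 0"
  shows "Ck_on k S (\<lambda>x. inverse (f x))"
  using f
proof (induction k)
  case 0
  then show ?case using nz by (auto intro: continuous_on_inverse)
next
  case (Suc k)
  have fk: "Ck_on k S f" using Suc.prems by (rule Ck_on_SucD)
  have d: "((\<lambda>x. inverse (f x)) has_derivative (\<lambda>v. (inverse (f x) * fderiv f x v) * (- inverse (f x)))) (at x)"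
    if "x \<in> S" for x
  proof -
    have "(f has_derivative fderiv f x) (at x)" using Suc.prems that by (auto intro!: has_fderiv)
    from Deriv.has_derivative_inverse[OF nz[OF that] this] show ?thesis
      by (simp add: algebra_simps)
  qed
  have "Ck_on k S (\<lambda>x. (inverse (f x) * fderiv f x v) * (- inverse (f x)))" for v
    using Suc.prems Suc.IH[OF fk]
    by (intro Ck_on_bilinear[OF bounded_bilinear_mult S] 
        Ck_on_bounded_linear_compose[OF bounded_linear_minus[OF bounded_linear_ident] S]) auto
  then have "Ck_on k S (\<lambda>x. fderiv (\<lambda>x. inverse (f x)) x v)" for v
    by (rule Ck_on_cong[OF S, rotated]) (use d in \<open>auto simp: fderiv_eqI[OF d]\<close>)
  then show ?case using d by (auto simp: differentiable_def)
qed

section \<open>Closure properties of smooth maps\<close>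

lemma smooth_on_cong:
  assumes "open S" "\<And>x. x \<in> S \<Longrightarrow> f x = g x" "smooth_on S f"
  shows "smooth_on S g"
  unfolding smooth_on_def
proof
  fix k show "Ck_on k S g"
    using Ck_on_cong[OF assms(1,2), where k = k] assms(3) by (simp add: smooth_on_def)
qed

lemma smooth_on_subset: "smooth_on S f \<Longrightarrow> T \<subseteq> S \<Longrightarrow> smooth_on T f"
  unfolding smooth_on_def by (intro allI Ck_on_subset[of _ S f T]) simp_all

lemma smooth_on_local:
  assumes "\<And>x. x \<in> S \<Longrightarrow> \<exists>U. open U \<and> x \<in> U \<and> smooth_on U f"
  shows "smooth_on S f"
  unfolding smooth_on_def
proof (intro allI Ck_on_local)
  fix k x assume "x \<in> S"
  then show "\<exists>U. open U \<and> x \<in> U \<and> Ck_on k U f"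
    using assms unfolding smooth_on_def by meson
qed

lemma smooth_on_const [simp]: "smooth_on S (\<lambda>x. c)"
  by (simp add: smooth_on_def Ck_on_const)

lemma smooth_on_bounded_linear: "bounded_linear L \<Longrightarrow> smooth_on S L"
  by (simp add: smooth_on_def Ck_on_bounded_linear)

lemma smooth_on_bounded_linear_compose:
  "bounded_linear L \<Longrightarrow> open S \<Longrightarrow> smooth_on S f \<Longrightarrow> smooth_on S (\<lambda>x. L (f x))"
  by (simp add: smooth_on_def Ck_on_bounded_linear_compose)

lemma smooth_on_add: "open S \<Longrightarrow> smooth_on S f \<Longrightarrow> smooth_on S g \<Longrightarrow> smooth_on S (\<lambda>x. f x + g x)"
  by (simp add: smooth_on_def Ck_on_add)

lemma smooth_on_minus: "open S \<Longrightarrow> smooth_on S f \<Longrightarrow> smooth_on S (\<lambda>x. - f x)"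
  by (rule smooth_on_bounded_linear_compose[OF bounded_linear_minus[OF bounded_linear_ident]])

lemma smooth_on_diff: "open S \<Longrightarrow> smooth_on S f \<Longrightarrow> smooth_on S g \<Longrightarrow> smooth_on S (\<lambda>x. f x - g x)"
  using smooth_on_add[OF _ _ smooth_on_minus, of S f g] by simp

lemma smooth_on_bilinear:
  "bounded_bilinear pr \<Longrightarrow> open S \<Longrightarrow> smooth_on S f \<Longrightarrow> smooth_on S g \<Longrightarrow> smooth_on S (\<lambda>x. pr (f x) (g x))"
  by (simp add: smooth_on_def Ck_on_bilinear)

lemmas smooth_on_scaleR = smooth_on_bilinear[OF bounded_bilinear_scaleR]
lemmas smooth_on_inner = smooth_on_bilinear[OF bounded_bilinear_inner]

lemma smooth_on_mult:
  fixes f g :: "'a::real_normed_vector \<Rightarrow> real"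
  shows "open S \<Longrightarrow> smooth_on S f \<Longrightarrow> smooth_on S g \<Longrightarrow> smooth_on S (\<lambda>x. f x * g x)"
  by (rule smooth_on_bilinear[OF bounded_bilinear_mult])

lemma smooth_on_sum:
  "open S \<Longrightarrow> (\<And>i. i \<in> I \<Longrightarrow> smooth_on S (f i)) \<Longrightarrow> smooth_on S (\<lambda>x. \<Sum>i\<in>I. f i x)"
  by (simp add: smooth_on_def Ck_on_sum)

lemma smooth_on_compose:
  fixes f :: "'a::euclidean_space \<Rightarrow> 'b::real_normed_vector"
  shows "open S \<Longrightarrow> smooth_on T f \<Longrightarrow> smooth_on S g \<Longrightarrow> g ` S \<subseteq> T \<Longrightarrow> smooth_on S (\<lambda>x. f (g x))"
  unfolding smooth_on_def by (intro allI Ck_on_compose[of _ _ T f g]) simp_all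

lemma smooth_on_inverse:
  fixes f :: "'a::real_normed_vector \<Rightarrow> real"
  shows "open S \<Longrightarrow> smooth_on S f \<Longrightarrow> (\<And>x. x \<in> S \<Longrightarrow> f x \<noteq> 0) \<Longrightarrow> smooth_on S (\<lambda>x. inverse (f x))"
  by (simp add: smooth_on_def Ck_on_inverse)

lemma smooth_on_differentiable: "smooth_on S f \<Longrightarrow> x \<in> S \<Longrightarrow> f differentiable (at x)"
  unfolding smooth_on_def by (drule spec[of _ "Suc 0"]) simp

lemma smooth_on_fderiv: "smooth_on S f \<Longrightarrow> smooth_on S (\<lambda>x. fderiv f x v)"
  unfolding smooth_on_def by (rule allI, drule_tac x = "Suc k" in spec) simp

text \<open>Jacobians and forms are smooth only in the sense that each fixed argument gives a smooth
  function of the point; in finite dimension the expansion over \<open>Basis\<close> admits a moving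
  argument.\<close>

lemma Ck_on_linear_apply:
  fixes \<alpha> :: "'p::real_normed_vector \<Rightarrow> 'a::euclidean_space \<Rightarrow> 'b::real_normed_vector"
  assumes S: "open S" and lin: "\<And>p. p \<in> S \<Longrightarrow> linear (\<alpha> p)"
    and sm: "\<And>v. Ck_on k S (\<lambda>p. \<alpha> p v)" and X: "Ck_on k S X"
  shows "Ck_on k S (\<lambda>p. \<alpha> p (X p))"
proof -
  have "Ck_on k S (\<lambda>p. \<Sum>b\<in>Basis. (X p \<bullet> b) *\<^sub>R \<alpha> p b)"
    by (intro Ck_on_sum S Ck_on_bilinear[OF bounded_bilinear_scaleR] sm
        Ck_on_bilinear[OF bounded_bilinear_inner] X Ck_on_const)
  then show ?thesis
    by (rule Ck_on_cong[OF S, rotated]) (rule linear_euclidean_sum[symmetric], erule lin)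
qed

lemma smooth_on_linear_apply:
  fixes \<alpha> :: "'p::real_normed_vector \<Rightarrow> 'a::euclidean_space \<Rightarrow> 'b::real_normed_vector"
  assumes S: "open S" and lin: "\<And>p. p \<in> S \<Longrightarrow> linear (\<alpha> p)"
    and sm: "\<And>v. smooth_on S (\<lambda>p. \<alpha> p v)" and X: "smooth_on S X"
  shows "smooth_on S (\<lambda>p. \<alpha> p (X p))"
  using assms by (simp add: smooth_on_def Ck_on_linear_apply)

lemma smooth_on_fderiv_apply:
  fixes f :: "'a::euclidean_space \<Rightarrow> 'b::real_normed_vector"
  assumes S: "open S" and f: "smooth_on S f" and X: "smooth_on S X"
  shows "smooth_on S (\<lambda>p. fderiv f p (X p))"
  using S f X by (auto intro!: smooth_on_linear_apply[where \<alpha> = "fderiv f"] smooth_on_fderiv linear_frechet_derivative smooth_on_differentiable[OF f])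

lemma has_derivative_linear_apply:
  fixes \<alpha> :: "'p::real_normed_vector \<Rightarrow> 'a::euclidean_space \<Rightarrow> 'b::real_normed_vector"
  assumes S: "open S" "p \<in> S" and lin: "\<And>p. p \<in> S \<Longrightarrow> linear (\<alpha> p)"
    and d: "\<And>v. (\<lambda>p. \<alpha> p v) differentiable (at p)" and X: "X differentiable (at p)"
  shows "((\<lambda>p. \<alpha> p (X p)) has_derivative
      (\<lambda>h. fderiv (\<lambda>q. \<alpha> q (X p)) p h + \<alpha> p (fderiv X p h))) (at p)"
proof -
  have X': "(X has_derivative fderiv X p) (at p)" using X by (rule has_fderiv)
  have "((\<lambda>p. \<Sum>b\<in>Basis. (X p \<bullet> b) *\<^sub>R \<alpha> p b) has_derivative
      (\<lambda>h. \<Sum>b\<in>Basis. (X p \<bullet> b) *\<^sub>R fderiv (\<lambda>p. \<alpha> p b) p h + (fderiv X p h \<bullet> b) *\<^sub>R \<alpha> p b)) (at p)"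
    by (intro has_derivative_sum has_derivative_scaleR has_derivative_inner_left has_fderiv d X')
  then have 1: "((\<lambda>p. \<alpha> p (X p)) has_derivative
      (\<lambda>h. \<Sum>b\<in>Basis. (X p \<bullet> b) *\<^sub>R fderiv (\<lambda>p. \<alpha> p b) p h + (fderiv X p h \<bullet> b) *\<^sub>R \<alpha> p b)) (at p)"
    by (rule has_derivative_transform_within_open[OF _ S]) (rule linear_euclidean_sum[symmetric], erule lin)
  have "((\<lambda>q. \<Sum>b\<in>Basis. (X p \<bullet> b) *\<^sub>R \<alpha> q b) has_derivative
      (\<lambda>h. \<Sum>b\<in>Basis. (X p \<bullet> b) *\<^sub>R fderiv (\<lambda>p. \<alpha> p b) p h)) (at p)"
    by (intro has_derivative_sum has_derivative_scaleR_right has_fderiv d)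
  then have "((\<lambda>q. \<alpha> q (X p)) has_derivative
      (\<lambda>h. \<Sum>b\<in>Basis. (X p \<bullet> b) *\<^sub>R fderiv (\<lambda>p. \<alpha> p b) p h)) (at p)"
    by (rule has_derivative_transform_within_open[OF _ S]) (rule linear_euclidean_sum[symmetric], erule lin)
  from fderiv_eqI[OF this] have 2: "fderiv (\<lambda>q. \<alpha> q (X p)) p h = (\<Sum>b\<in>Basis. (X p \<bullet> b) *\<^sub>R fderiv (\<lambda>p. \<alpha> p b) p h)" for h
    by simp
  have 3: "\<alpha> p (fderiv X p h) = (\<Sum>b\<in>Basis. (fderiv X p h \<bullet> b) *\<^sub>R \<alpha> p b)" for h
    using linear_euclidean_sum[OF lin[OF S(2)]] .
  show ?thesis using 1 by (simp add: 2 3 sum.distrib)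
qed

lemma has_derivative_bilinear_apply:
  fixes \<beta> :: "'p::real_normed_vector \<Rightarrow> 'a::euclidean_space \<Rightarrow> 'c::euclidean_space \<Rightarrow> 'b::real_normed_vector"
  assumes S: "open S" "p \<in> S" and lin1: "\<And>p v. p \<in> S \<Longrightarrow> linear (\<lambda>u. \<beta> p u v)"
    and lin2: "\<And>p u. p \<in> S \<Longrightarrow> linear (\<beta> p u)"
    and d: "\<And>u v. (\<lambda>p. \<beta> p u v) differentiable (at p)"
    and X: "X differentiable (at p)" and Y: "Y differentiable (at p)"
  shows "((\<lambda>p. \<beta> p (X p) (Y p)) has_derivative
      (\<lambda>h. fderiv (\<lambda>q. \<beta> q (X p) (Y p)) p h + \<beta> p (fderiv X p h) (Y p) + \<beta> p (X p) (fderiv Y p h))) (at p)"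
proof -
  have 1: "((\<lambda>p. \<beta> p (X p) v) has_derivative
      (\<lambda>h. fderiv (\<lambda>q. \<beta> q (X p) v) p h + \<beta> p (fderiv X p h) v)) (at p)" for v
    using has_derivative_linear_apply[OF S, of "\<lambda>p u. \<beta> p u v" X] lin1 d X by simp
  then have "(\<lambda>p. \<beta> p (X p) v) differentiable (at p)" for v
    by (auto simp: differentiable_def)
  with has_derivative_linear_apply[OF S, of "\<lambda>p v. \<beta> p (X p) v" Y] lin2 Y
  have "((\<lambda>p. \<beta> p (X p) (Y p)) has_derivative
      (\<lambda>h. fderiv (\<lambda>q. \<beta> q (X q) (Y p)) p h + \<beta> p (X p) (fderiv Y p h))) (at p)" by blast
  then show ?thesis using fderiv_eqI[OF 1[of "Y p"]] by simp
qed

text \<open>An o(1) factor times an O(|y - x|) factor is o(|y - x|), so continuity of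
  \<open>f\<close> is enough. In \<open>smooth_on_linear_solve\<close> that factor is a component of
  the increment of the unknown solution, whose differentiability is still to be proved.\<close>

lemma has_derivative_scaleR_zero:
  fixes f :: "'a::real_normed_vector \<Rightarrow> real" and g :: "'a \<Rightarrow> 'b::real_normed_vector"
  assumes f: "isCont f x" "f x = 0" and g: "(g has_derivative g') (at x)" "g x = 0"
  shows "((\<lambda>p. f p *\<^sub>R g p) has_derivative (\<lambda>h. 0)) (at x)"
proof -
  have bl: "bounded_linear g'" using g(1) by (rule has_derivative_bounded_linear)
  then obtain K where K: "\<And>h. norm (g' h) \<le> norm h * K" using bounded_linear.bounded by blast
  have e: "((\<lambda>y. norm (g y - g x - g' (y - x)) / norm (y - x)) \<longlongrightarrow> 0) (at x)"
    using g(1) by (simp add: has_derivative_iff_norm)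
  have f0: "((\<lambda>y. \<bar>f y\<bar>) \<longlongrightarrow> 0) (at x)" using f unfolding isCont_def by (metis tendsto_rabs_zero)
  have lim: "((\<lambda>y. \<bar>f y\<bar> * (K + norm (g y - g x - g' (y - x)) / norm (y - x))) \<longlongrightarrow> 0 * (K + 0)) (at x)"
    by (intro tendsto_mult f0 tendsto_add tendsto_const e)
  have le: "norm (f y *\<^sub>R g y) / norm (y - x) \<le> \<bar>f y\<bar> * (K + norm (g y - g x - g' (y - x)) / norm (y - x))"
    if "y \<noteq> x" for y
  proof -
    have "norm (g y) \<le> norm (g' (y - x)) + norm (g y - g x - g' (y - x))"
      using norm_triangle_ineq[of "g' (y - x)" "g y - g x - g' (y - x)"] g(2) by simp
    also have "\<dots> \<le> norm (y - x) * K + norm (g y - g x - g' (y - x))" using K by simp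
    finally have "norm (g y) / norm (y - x) \<le> K + norm (g y - g x - g' (y - x)) / norm (y - x)"
      using that by (simp add: field_simps)
    then have "\<bar>f y\<bar> * (norm (g y) / norm (y - x)) \<le> \<bar>f y\<bar> * (K + norm (g y - g x - g' (y - x)) / norm (y - x))"
      by (intro mult_left_mono) auto
    then show ?thesis by simp
  qed
  have "((\<lambda>y. norm (f y *\<^sub>R g y) / norm (y - x)) \<longlongrightarrow> 0) (at x)"
  proof (rule tendsto_sandwich[OF _ _ tendsto_const])
    show "\<forall>\<^sub>F y in at x. 0 \<le> norm (f y *\<^sub>R g y) / norm (y - x)" by simp
    show "\<forall>\<^sub>F y in at x. norm (f y *\<^sub>R g y) / norm (y - x) \<le> \<bar>f y\<bar> * (K + norm (g y - g x - g' (y - x)) / norm (y - x))"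
      using le by (simp add: eventually_at_filter)
  qed (use lim in simp)
  then show ?thesis using f(2) by (simp add: has_derivative_iff_norm)
qed

text \<open>Avoids determinants. An injective \<open>M p\<close> is bounded below, which makes
  \<open>w\<close> continuous; continuity yields the first derivative; and differentiating
  \<open>M p (w p) = b p\<close> shows that \<open>fderiv w p v\<close> solves a system with the
  same \<open>M\<close>, so the induction on the order runs with \<open>b\<close> and
  \<open>w\<close> general.\<close>

lemma smooth_on_linear_solve:
  fixes M :: "'p::real_normed_vector \<Rightarrow> 'a::euclidean_space \<Rightarrow> 'a"
  assumes S: "open S" and lin: "\<And>p. p \<in> S \<Longrightarrow> linear (M p)"
    and inj: "\<And>p v. p \<in> S \<Longrightarrow> M p v = 0 \<Longrightarrow> v = 0"
    and sm: "\<And>v. smooth_on S (\<lambda>p. M p v)"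
    and b: "smooth_on S b" and w: "\<And>p. p \<in> S \<Longrightarrow> M p (w p) = b p"
  shows "smooth_on S w"
proof -
  have Mdiff: "M p (u - v) = M p u - M p v" if "p \<in> S" for p u v
    using lin[OF that] by (rule linear_diff)
  have main: "isCont w p \<and> (b differentiable (at p) \<longrightarrow> w differentiable (at p))"
    if p: "p \<in> S" and bc: "isCont b p" and w: "\<And>p. p \<in> S \<Longrightarrow> M p (w p) = b p" for p b w
  proof -
    have Mp: "linear (M p)" "inj (M p)"
      using lin[OF p] inj[OF p] by (auto simp: linear_injective_0)
    obtain N where N: "linear N" "\<And>v. N (M p v) = v"
      using linear_injective_left_inverse[OF Mp] by (metis comp_apply id_apply)
    obtain B where B: "B > 0" "\<And>v. B * norm v \<le> norm (M p v)"
      using linear_inj_bounded_below_pos[OF Mp] by blast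
    \<comment> \<open>Bounds the operator norm of \<open>M q - M p\<close> by its finitely many
      columns, the only data known to be continuous.\<close>
    define \<epsilon> where "\<epsilon> q = (\<Sum>c\<in>Basis. norm (M q c - M p c))" for q
    have Md: "(\<lambda>q. M q v) differentiable (at p)" for v using smooth_on_differentiable[OF sm p] .
    have "isCont (\<lambda>q. M q v) p" for v using Md differentiable_imp_continuous_within by blast
    then have Mt: "((\<lambda>q. M q v) \<longlongrightarrow> M p v) (at p)" for v by (simp add: isCont_def)
    have "(\<epsilon> \<longlongrightarrow> (\<Sum>c\<in>Basis. norm (M p c - M p c))) (at p)"
      unfolding \<epsilon>_def by (intro tendsto_intros Mt)
    then have \<epsilon>0: "(\<epsilon> \<longlongrightarrow> 0) (at p)" by simp
    have \<epsilon>: "norm (M q v - M p v) \<le> \<epsilon> q * norm v" if "q \<in> S" for q v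
    proof -
      have "M q v - M p v = (\<Sum>c\<in>Basis. (v \<bullet> c) *\<^sub>R (M q c - M p c))"
        using linear_euclidean_sum[OF lin[OF that], of v] linear_euclidean_sum[OF lin[OF p], of v]
        by (simp add: sum_subtractf scaleR_diff_right)
      also have "norm \<dots> \<le> (\<Sum>c\<in>Basis. norm v * norm (M q c - M p c))"
        by (rule sum_norm_le) (simp add: Basis_le_norm mult_right_mono)
      finally show ?thesis by (simp add: \<epsilon>_def sum_distrib_left mult.commute)
    qed
    define r where "r q = b q - M q (w p)" for q
    have r0: "r p = 0" using w p by (simp add: r_def)
    have Mc: "isCont (\<lambda>q. M q (w p)) p" using Mt by (simp add: isCont_def)
    have "isCont r p" unfolding r_def by (intro continuous_intros bc Mc)
    then have rt: "(r \<longlongrightarrow> 0) (at p)" using r0 by (simp add: isCont_def)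
    have Mr: "M q (w q - w p) = r q" if "q \<in> S" for q
      using w[OF that] Mdiff[OF that] by (simp add: r_def)
    \<comment> \<open>Near \<open>p\<close> the perturbation consumes at most half of the lower
      bound \<open>B\<close>, which leaves the constant \<open>2 / B\<close>.\<close>
    have bound: "\<forall>\<^sub>F q in at p. norm (w q - w p) \<le> (2 / B) * norm (r q)"
    proof -
      have "\<forall>\<^sub>F q in at p. \<epsilon> q < B / 2" using \<epsilon>0 B(1) by (intro order_tendstoD) auto
      moreover have "\<forall>\<^sub>F q in at p. q \<in> S" using S p by (intro eventually_at_in_open') auto
      ultimately show ?thesis
      proof eventually_elim
        case (elim q)
        have "B * norm (w q - w p) \<le> norm (M p (w q - w p))" by (rule B)
        also have "\<dots> \<le> norm (M q (w q - w p)) + norm (M q (w q - w p) - M p (w q - w p))"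
          by (metis norm_triangle_sub norm_minus_commute)
        also have "\<dots> \<le> norm (r q) + \<epsilon> q * norm (w q - w p)" using \<epsilon>[of q "w q - w p"] Mr[of q] elim by simp
        also have "\<dots> \<le> norm (r q) + B / 2 * norm (w q - w p)"
          using elim by (intro add_left_mono mult_right_mono) auto
        finally show ?case using B(1) by (simp add: field_simps)
      qed
    qed
    have "((\<lambda>q. (2 / B) * norm (r q)) \<longlongrightarrow> (2 / B) * norm (0::'a)) (at p)" by (intro tendsto_intros rt)
    then have "((\<lambda>q. w q - w p) \<longlongrightarrow> 0) (at p)"
      by (intro Lim_null_comparison[OF bound]) simp
    then have wc: "isCont w p" by (simp add: isCont_def LIM_zero_iff)
    have "w differentiable (at p)" if bd: "b differentiable (at p)"
    proof -
      have rd: "r differentiable (at p)" unfolding r_def by (intro differentiable_diff bd Md)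
      \<comment> \<open>The cross term \<open>(M q - M p) (w q - w p)\<close>. Both factors vanish
        at \<open>p\<close>, so its derivative there is zero, and
        \<open>w q = w p + N (r q - s q)\<close> can be differentiated.\<close>
      define s where "s q = (\<Sum>c\<in>Basis. ((w q - w p) \<bullet> c) *\<^sub>R (M q c - M p c))" for q
      have "(s has_derivative (\<lambda>h. \<Sum>c\<in>(Basis::'a set). 0)) (at p)"
        unfolding s_def
      proof (intro has_derivative_sum has_derivative_scaleR_zero)
        fix c :: 'a assume "c \<in> Basis"
        show "isCont (\<lambda>q. (w q - w p) \<bullet> c) p" using wc by (intro continuous_intros) 
        show "((\<lambda>q. M q c - M p c) has_derivative fderiv (\<lambda>q. M q c) p) (at p)"
          using has_derivative_diff[OF has_fderiv[OF Md] has_derivative_const] by simp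
      qed auto
      then have sd: "(s has_derivative (\<lambda>h. 0)) (at p)" by simp
      have "((\<lambda>q. w p + N (r q - s q)) has_derivative (\<lambda>h. 0 + N (fderiv r p h - 0))) (at p)"
        by (intro has_derivative_add has_derivative_const has_derivative_diff sd has_fderiv rd
            bounded_linear.has_derivative[OF linear_conv_bounded_linear[THEN iffD1, OF N(1)]])
      moreover have "w p + N (r q - s q) = w q" if "q \<in> S" for q
      proof -
        have "s q = M q (w q - w p) - M p (w q - w p)"
          using linear_euclidean_sum[OF lin[OF that], of "w q - w p"] linear_euclidean_sum[OF lin[OF p], of "w q - w p"]
          by (simp add: s_def sum_subtractf scaleR_diff_right)
        then have "r q - s q = M p (w q - w p)" using Mr[OF that] by simp
        then show ?thesis using N(2) by simp
      qed
      ultimately have "(w has_derivative (\<lambda>h. 0 + N (fderiv r p h - 0))) (at p)"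
        by (rule has_derivative_transform_within_open[OF _ S p])
      then show ?thesis by (auto simp: differentiable_def)
    qed
    then show ?thesis using wc by blast
  qed
  have "Ck_on k S w" if "Ck_on k S b" "\<And>p. p \<in> S \<Longrightarrow> M p (w p) = b p" for k w b
    using that
  proof (induction k arbitrary: w b)
    case 0
    then have "isCont w p" if "p \<in> S" for p
      using main[OF that _ 0(2)] S that by (simp add: continuous_on_eq_continuous_at)
    then show ?case by (simp add: continuous_at_imp_continuous_on)
  next
    case (Suc k)
    have bd: "b differentiable (at p)" if "p \<in> S" for p using Suc.prems that by auto
    have wd: "w differentiable (at p)" if "p \<in> S" for p
      using main[OF that differentiable_imp_continuous_within[OF bd[OF that]] Suc.prems(2)] bd[OF that] by blast
    have wk: "Ck_on k S w" by (rule Suc.IH[OF Ck_on_SucD[OF Suc.prems(1)] Suc.prems(2)])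
    have Md: "(\<lambda>q. M q u) differentiable (at p)" if "p \<in> S" for p u
      using smooth_on_differentiable[OF sm that] .
    have "Ck_on k S (\<lambda>p. fderiv w p v)" for v
    proof (rule Suc.IH)
      \<comment> \<open>Needed for \<open>Ck_on_linear_apply\<close>: the differentiated matrix is
        applied to the moving vector \<open>w p\<close>.\<close>
      have "linear (\<lambda>u. fderiv (\<lambda>q. M q u) p v)" if "p \<in> S" for p
      proof (rule linearI)
        fix u u' :: 'a and r :: real
        have "((\<lambda>q. M q u + M q u') has_derivative (\<lambda>h. fderiv (\<lambda>q. M q u) p h + fderiv (\<lambda>q. M q u') p h)) (at p)"
          by (intro has_derivative_add has_fderiv Md that)
        note fderiv_eqI[OF this]
        moreover have "fderiv (\<lambda>q. M q (u + u')) p = fderiv (\<lambda>q. M q u + M q u') p"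
          by (rule fderiv_cong[OF S that]) (simp add: lin linear_add)
        ultimately show "fderiv (\<lambda>q. M q (u + u')) p v = fderiv (\<lambda>q. M q u) p v + fderiv (\<lambda>q. M q u') p v"
          by simp
        have "((\<lambda>q. r *\<^sub>R M q u) has_derivative (\<lambda>h. r *\<^sub>R fderiv (\<lambda>q. M q u) p h)) (at p)"
          by (intro has_derivative_scaleR_right has_fderiv Md that)
        note fderiv_eqI[OF this]
        moreover have "fderiv (\<lambda>q. M q (r *\<^sub>R u)) p = fderiv (\<lambda>q. r *\<^sub>R M q u) p"
          by (rule fderiv_cong[OF S that]) (simp add: lin linear_cmul)
        ultimately show "fderiv (\<lambda>q. M q (r *\<^sub>R u)) p v = r *\<^sub>R fderiv (\<lambda>q. M q u) p v"
          by simp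
      qed
      moreover have "Ck_on k S (\<lambda>p. fderiv (\<lambda>q. M q u) p v)" for u
        using smooth_on_fderiv[OF sm] by (simp add: smooth_on_def)
      ultimately have "Ck_on k S (\<lambda>p. fderiv (\<lambda>q. M q (w p)) p v)"
        by (intro Ck_on_linear_apply[OF S _ _ wk, of "\<lambda>p u. fderiv (\<lambda>q. M q u) p v"])
      then have "Ck_on k S (\<lambda>p. fderiv b p v + - fderiv (\<lambda>q. M q (w p)) p v)"
        using Suc.prems(1) by (intro Ck_on_add S
          Ck_on_bounded_linear_compose[OF bounded_linear_minus[OF bounded_linear_ident]]) auto
      then show "Ck_on k S (\<lambda>p. fderiv b p v - fderiv (\<lambda>q. M q (w p)) p v)" by simp
      fix p assume p: "p \<in> S"
      have "((\<lambda>q. M q (w q)) has_derivative (\<lambda>h. fderiv (\<lambda>q. M q (w p)) p h + M p (fderiv w p h))) (at p)"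
        by (rule has_derivative_linear_apply[OF S p lin Md[OF p] wd[OF p]])
      note fderiv_eqI[OF this]
      moreover have "fderiv (\<lambda>q. M q (w q)) p = fderiv b p"
        by (rule fderiv_cong[OF S p]) (rule Suc.prems(2))
      ultimately have "fderiv b p v = fderiv (\<lambda>q. M q (w p)) p v + M p (fderiv w p v)"
        by simp
      then show "M p (fderiv w p v) = fderiv b p v - fderiv (\<lambda>q. M q (w p)) p v" by simp
    qed
    then show ?case using wd by simp
  qed
  from this[OF _ w] show ?thesis using b by (simp add: smooth_on_def)
qed

text \<open>Both iterated derivatives are values of the same double difference quotient
  at nearby points, by the mean value theorem.\<close>

lemma double_difference_mvt:
  fixes f :: "'a::real_normed_vector \<Rightarrow> real"
  assumes f: "smooth_on S f" and t: "t > 0"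
    and box: "\<And>a b. 0 \<le> a \<Longrightarrow> a \<le> t \<Longrightarrow> 0 \<le> b \<Longrightarrow> b \<le> t \<Longrightarrow> x + a *\<^sub>R u + b *\<^sub>R v \<in> S"
  shows "\<exists>a b. 0 < a \<and> a < t \<and> 0 < b \<and> b < t \<and>
    f (x + t *\<^sub>R u + t *\<^sub>R v) - f (x + t *\<^sub>R u) - f (x + t *\<^sub>R v) + f x
      = t * t * fderiv (\<lambda>q. fderiv f q u) (x + a *\<^sub>R u + b *\<^sub>R v) v"
proof -
  have line: "((\<lambda>s. g (y + s *\<^sub>R w)) has_real_derivative fderiv g (y + s *\<^sub>R w) w) (at s)"
    if "smooth_on S g" "y + s *\<^sub>R w \<in> S" for g :: "'a \<Rightarrow> real" and y s w
  proof -
    have g: "(g has_derivative fderiv g (y + s *\<^sub>R w)) (at (y + s *\<^sub>R w))"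
      using that by (intro has_fderiv smooth_on_differentiable)
    have "((\<lambda>s. y + s *\<^sub>R w) has_derivative (\<lambda>h. h *\<^sub>R w)) (at s)"
      by (auto intro!: derivative_eq_intros)
    from has_derivative_compose[OF this g]
    have "((\<lambda>s. g (y + s *\<^sub>R w)) has_derivative (\<lambda>h. fderiv g (y + s *\<^sub>R w) (h *\<^sub>R w))) (at s)" .
    moreover have "fderiv g (y + s *\<^sub>R w) (h *\<^sub>R w) = fderiv g (y + s *\<^sub>R w) w * h" for h
      using has_derivative_linear[OF g] by (simp add: linear_cmul)
    ultimately show ?thesis by (simp add: has_field_derivative_def)
  qed
  define \<phi> where "\<phi> s = f (x + t *\<^sub>R v + s *\<^sub>R u) - f (x + s *\<^sub>R u)" for s
  have "(\<phi> has_real_derivative (fderiv f (x + t *\<^sub>R v + s *\<^sub>R u) u - fderiv f (x + s *\<^sub>R u) u)) (at s)"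
    if "0 \<le> s" "s \<le> t" for s
    unfolding \<phi>_def using box[of s t] box[of s 0] that t
    by (intro DERIV_diff line f) (auto simp: algebra_simps)
  from MVT2[OF t this] obtain a where a: "0 < a" "a < t"
    and 1: "\<phi> t - \<phi> 0 = t * (fderiv f (x + t *\<^sub>R v + a *\<^sub>R u) u - fderiv f (x + a *\<^sub>R u) u)" by auto
  have "((\<lambda>b. fderiv f (x + a *\<^sub>R u + b *\<^sub>R v) u) has_real_derivative
      fderiv (\<lambda>q. fderiv f q u) (x + a *\<^sub>R u + b *\<^sub>R v) v) (at b)" if "0 \<le> b" "b \<le> t" for b
    using box[of a b] that a by (intro line smooth_on_fderiv f) auto
  from MVT2[OF t this] obtain b where b: "0 < b" "b < t"
    and 2: "fderiv f (x + a *\<^sub>R u + t *\<^sub>R v) u - fderiv f (x + a *\<^sub>R u) u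
      = t * fderiv (\<lambda>q. fderiv f q u) (x + a *\<^sub>R u + b *\<^sub>R v) v" by auto
  show ?thesis using a b 1 2 unfolding \<phi>_def
    by (intro exI[of _ a] exI[of _ b]) (simp add: algebra_simps)
qed

lemma symmetric_second_fderiv_real:
  fixes f :: "'a::real_normed_vector \<Rightarrow> real"
  assumes S: "open S" and f: "smooth_on S f" and x: "x \<in> S"
  shows "fderiv (\<lambda>q. fderiv f q u) x v = fderiv (\<lambda>q. fderiv f q v) x u"
proof -
  obtain r where r: "r > 0" "ball x r \<subseteq> S" using S x openE by blast
  define C where "C = norm u + norm v + 1"
  have C: "C > 0" by (simp add: C_def add_nonneg_pos)
  \<comment> \<open>The denominators start at 2, so that \<open>t n * C < r\<close> holds already
    for \<open>n = 0\<close>.\<close>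
  define t where "t n = r / C / (Suc (Suc n))" for n :: nat
  have t: "t n > 0" for n using r C by (simp add: t_def)
  have bnd: "norm (a *\<^sub>R u + b *\<^sub>R v) \<le> t n * C" if "0 \<le> a" "a \<le> t n" "0 \<le> b" "b \<le> t n" for a b n
  proof -
    have "norm (a *\<^sub>R u + b *\<^sub>R v) \<le> a * norm u + b * norm v"
      using norm_triangle_ineq[of "a *\<^sub>R u" "b *\<^sub>R v"] that by simp
    also have "\<dots> \<le> t n * norm u + t n * norm v + t n * 1"
      using that t[of n] mult_right_mono[of a "t n" "norm u"] mult_right_mono[of b "t n" "norm v"] by simp
    finally show ?thesis by (simp add: C_def algebra_simps)
  qed
  have tC: "t n * C < r" for n
  proof -
    have "t n * C = r / real (Suc (Suc n))" using C by (simp add: t_def)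
    also have "\<dots> < r / 1" using r(1) by (intro divide_strict_left_mono) auto
    finally show ?thesis by simp
  qed
  have box: "x + a *\<^sub>R u + b *\<^sub>R v \<in> S" "x + b *\<^sub>R v + a *\<^sub>R u \<in> S"
    if "0 \<le> a" "a \<le> t n" "0 \<le> b" "b \<le> t n" for a b n
  proof -
    have "dist (x + (a *\<^sub>R u + b *\<^sub>R v)) x < r"
      using bnd[OF that] tC[of n] by (simp add: dist_norm)
    then show "x + a *\<^sub>R u + b *\<^sub>R v \<in> S" using r(2) by (auto simp: add.assoc dist_commute)
    then show "x + b *\<^sub>R v + a *\<^sub>R u \<in> S" by (simp add: algebra_simps)
  qed
  \<comment> \<open>The double difference is symmetric in \<open>u\<close> and \<open>v\<close>, so
    each order of differentiation attains the same value at its own point near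
    \<open>x\<close>.\<close>
  have "\<exists>p q. norm (p - x) \<le> t n * C \<and> norm (q - x) \<le> t n * C \<and>
     fderiv (\<lambda>q. fderiv f q u) p v = fderiv (\<lambda>q. fderiv f q v) q u" for n
  proof -
    obtain a b where 1: "0 < a" "a < t n" "0 < b" "b < t n"
      "f (x + t n *\<^sub>R u + t n *\<^sub>R v) - f (x + t n *\<^sub>R u) - f (x + t n *\<^sub>R v) + f x
      = t n * t n * fderiv (\<lambda>q. fderiv f q u) (x + a *\<^sub>R u + b *\<^sub>R v) v"
      using double_difference_mvt[OF f t[of n], of x u v] box by blast
    obtain a' b' where 2: "0 < a'" "a' < t n" "0 < b'" "b' < t n"
      "f (x + t n *\<^sub>R v + t n *\<^sub>R u) - f (x + t n *\<^sub>R v) - f (x + t n *\<^sub>R u) + f x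
      = t n * t n * fderiv (\<lambda>q. fderiv f q v) (x + a' *\<^sub>R v + b' *\<^sub>R u) u"
      using double_difference_mvt[OF f t[of n], of x v u] box by blast
    have "t n * t n * fderiv (\<lambda>q. fderiv f q u) (x + a *\<^sub>R u + b *\<^sub>R v) v =
      t n * t n * fderiv (\<lambda>q. fderiv f q v) (x + a' *\<^sub>R v + b' *\<^sub>R u) u"
      unfolding 1(5)[symmetric] 2(5)[symmetric] by (simp add: algebra_simps)
    then have "fderiv (\<lambda>q. fderiv f q u) (x + a *\<^sub>R u + b *\<^sub>R v) v = fderiv (\<lambda>q. fderiv f q v) (x + a' *\<^sub>R v + b' *\<^sub>R u) u"
      using t[of n] by simp
    moreover have "norm (x + a *\<^sub>R u + b *\<^sub>R v - x) \<le> t n * C" "norm (x + a' *\<^sub>R v + b' *\<^sub>R u - x) \<le> t n * C"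
      using bnd[of a n b] bnd[of b' n a'] 1 2 by (simp_all add: algebra_simps)
    ultimately show ?thesis by blast
  qed
  then obtain P Q where PQ: "\<And>n. norm (P n - x) \<le> t n * C" "\<And>n. norm (Q n - x) \<le> t n * C"
      "\<And>n. fderiv (\<lambda>q. fderiv f q u) (P n) v = fderiv (\<lambda>q. fderiv f q v) (Q n) u"
    by metis
  have "(\<lambda>n. r / C * inverse (real (Suc (Suc n))) * C) \<longlonglongrightarrow> r / C * 0 * C"
    by (intro tendsto_intros LIMSEQ_Suc[OF LIMSEQ_inverse_real_of_nat])
  then have t0: "(\<lambda>n. t n * C) \<longlonglongrightarrow> 0" by (simp add: t_def divide_inverse)
  have lim: "P \<longlonglongrightarrow> x" if "\<And>n. norm (P n - x) \<le> t n * C" for P :: "nat \<Rightarrow> 'a"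
  proof -
    have "(\<lambda>n. P n - x) \<longlonglongrightarrow> 0" using that by (intro Lim_null_comparison[OF _ t0]) simp
    then show ?thesis by (simp add: LIM_zero_iff)
  qed
  have ct: "isCont (\<lambda>y. fderiv (\<lambda>q. fderiv f q u) y v) x" for u v
    using smooth_on_differentiable[OF smooth_on_fderiv[OF smooth_on_fderiv[OF f]] x]
    by (rule differentiable_imp_continuous_within)
  have "(\<lambda>n. fderiv (\<lambda>q. fderiv f q u) (P n) v) \<longlonglongrightarrow> fderiv (\<lambda>q. fderiv f q u) x v"
    by (rule isCont_tendsto_compose[OF ct lim[OF PQ(1)]])
  moreover have "(\<lambda>n. fderiv (\<lambda>q. fderiv f q v) (Q n) u) \<longlonglongrightarrow> fderiv (\<lambda>q. fderiv f q v) x u"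
    by (rule isCont_tendsto_compose[OF ct lim[OF PQ(2)]])
  ultimately show ?thesis using PQ(3) LIMSEQ_unique by simp
qed

lemma fderiv_inner:
  assumes "f differentiable (at x)" shows "fderiv (\<lambda>q. f q \<bullet> b) x v = fderiv f x v \<bullet> b"
  using fderiv_eqI[OF has_derivative_inner_left[OF has_fderiv[OF assms]]] by simp

lemma symmetric_second_fderiv:
  fixes f :: "'a::real_normed_vector \<Rightarrow> 'b::euclidean_space"
  assumes S: "open S" and f: "smooth_on S f" and x: "x \<in> S"
  shows "fderiv (\<lambda>q. fderiv f q u) x v = fderiv (\<lambda>q. fderiv f q v) x u"
proof (rule euclidean_eqI)
  fix b :: 'b
  have 1: "fderiv (\<lambda>q. fderiv f q u) x v \<bullet> b = fderiv (\<lambda>q. fderiv (\<lambda>q. f q \<bullet> b) q u) x v" for u v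
  proof -
    have "fderiv (\<lambda>q. fderiv f q u) x v \<bullet> b = fderiv (\<lambda>q. fderiv f q u \<bullet> b) x v"
      by (rule fderiv_inner[symmetric, OF smooth_on_differentiable[OF smooth_on_fderiv[OF f] x]])
    also have "fderiv (\<lambda>q. fderiv f q u \<bullet> b) x = fderiv (\<lambda>q. fderiv (\<lambda>q. f q \<bullet> b) q u) x"
      by (rule fderiv_cong[OF S x]) (simp add: fderiv_inner smooth_on_differentiable[OF f])
    finally show ?thesis .
  qed
  have "smooth_on S (\<lambda>q. f q \<bullet> b)" by (intro smooth_on_inner S f smooth_on_const)
  from symmetric_second_fderiv_real[OF S this x]
  show "fderiv (\<lambda>q. fderiv f q u) x v \<bullet> b = fderiv (\<lambda>q. fderiv f q v) x u \<bullet> b" by (simp add: 1)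
qed

text \<open>The powers of \<open>inverse t\<close> make the family closed under differentiation up
  to linear combinations, so the smoothness of all members is a single induction.\<close>

definition flat_exp :: "nat \<Rightarrow> real \<Rightarrow> real" where
  "flat_exp k t = (if t > 0 then inverse t ^ k * exp (- inverse t) else 0)"

lemma flat_exp_tendsto_0: "(flat_exp k \<longlongrightarrow> 0) (at 0)"
proof -
  have "((\<lambda>t. (inverse t) ^ k / exp (inverse t)) \<longlongrightarrow> 0) (at_right (0::real))"
    by (rule filterlim_compose[OF tendsto_power_div_exp_0 filterlim_inverse_at_top_right])
  moreover have "\<forall>\<^sub>F t in at_right (0::real). (inverse t) ^ k / exp (inverse t) = flat_exp k t"
    by (auto simp: eventually_at_filter flat_exp_def exp_minus divide_inverse)
  ultimately have "(flat_exp k \<longlongrightarrow> 0) (at_right 0)" by (rule Lim_transform_eventually)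
  moreover have "(flat_exp k \<longlongrightarrow> 0) (at_left 0)"
    by (rule tendsto_eventually) (auto simp: eventually_at_filter flat_exp_def)
  ultimately show ?thesis by (simp add: filterlim_split_at)
qed

lemma flat_exp_derivative:
  "(flat_exp k has_real_derivative flat_exp (k + 2) t - real k * flat_exp (k + 1) t) (at t)"
proof -
  consider "t > 0" | "t < 0" | "t = 0" by linarith
  then show ?thesis
  proof cases
    case 1
    have "((\<lambda>t. inverse t ^ k) has_real_derivative - (real k * inverse t ^ (k + 1))) (at t)"
    proof (cases k)
      case (Suc j)
      have "((\<lambda>t. inverse t ^ Suc j) has_real_derivative real (Suc j) * (- (inverse t * 1 * inverse t) * inverse t ^ j)) (at t)"
        using DERIV_power_Suc[OF DERIV_inverse'[OF DERIV_ident], of t j UNIV] 1 by simp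
      then show ?thesis using Suc by (simp add: algebra_simps)
    qed simp
    moreover have "((\<lambda>t. exp (- inverse t)) has_real_derivative exp (- inverse t) * inverse t ^ 2) (at t)"
      using 1 by (auto intro!: derivative_eq_intros simp: power2_eq_square)
    ultimately have "((\<lambda>t. inverse t ^ k * exp (- inverse t)) has_real_derivative
        - (real k * inverse t ^ (k + 1)) * exp (- inverse t) + exp (- inverse t) * inverse t ^ 2 * inverse t ^ k) (at t)"
      by (rule DERIV_mult)
    then have "((\<lambda>t. inverse t ^ k * exp (- inverse t)) has_real_derivative
        flat_exp (k + 2) t - real k * flat_exp (k + 1) t) (at t)"
      using 1 by (simp add: flat_exp_def power_add power2_eq_square algebra_simps)
    then show ?thesis
      by (rule has_field_derivative_transform_within_open[of _ _ _ "{0<..}"]) (use 1 in \<open>auto simp: flat_exp_def\<close>)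
  next
    case 2
    have "((\<lambda>t::real. 0) has_real_derivative flat_exp (k + 2) t - real k * flat_exp (k + 1) t) (at t)"
      using 2 by (simp add: flat_exp_def)
    then show ?thesis
      by (rule has_field_derivative_transform_within_open[of _ _ _ "{..<0}"]) (use 2 in \<open>auto simp: flat_exp_def\<close>)
  next
    case 3
    \<comment> \<open>At 0 the difference quotient is the next member of the family, which tends to
      0.\<close>
    have "(flat_exp k (0 + h) - flat_exp k 0) / h = flat_exp (k + 1) h" for h
      by (simp add: flat_exp_def divide_inverse)
    then have "(flat_exp k has_real_derivative 0) (at 0)"
      using flat_exp_tendsto_0[of "k + 1"] unfolding DERIV_def by (simp add: LIM_offset_zero_iff)
    then show ?thesis using 3 by (simp add: flat_exp_def)
  qed
qed

lemma smooth_on_flat_exp: "smooth_on UNIV (flat_exp k)"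
proof -
  have "Ck_on j UNIV (flat_exp k)" for j k
  proof (induction j arbitrary: k)
    case 0
    show ?case using flat_exp_derivative by (auto intro!: DERIV_isCont continuous_at_imp_continuous_on)
  next
    case (Suc j)
    have d: "(flat_exp k has_derivative (*) (flat_exp (k + 2) t - real k * flat_exp (k + 1) t)) (at t)" for t
      using flat_exp_derivative has_field_derivative_imp_has_derivative by blast
    have "Ck_on j UNIV (\<lambda>t. flat_exp (k + 2) t * v + flat_exp (k + 1) t * (- real k * v))" for v
      by (intro Ck_on_add Ck_on_bilinear[OF bounded_bilinear_mult] Suc.IH Ck_on_const open_UNIV)
    moreover have "(\<lambda>t. fderiv (flat_exp k) t v) = (\<lambda>t. flat_exp (k + 2) t * v + flat_exp (k + 1) t * (- real k * v))" for v
      by (simp add: fderiv_eqI[OF d] algebra_simps)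
    ultimately show ?case using d by (auto simp: differentiable_def)
  qed
  then show ?thesis by (simp add: smooth_on_def)
qed

text \<open>The squared distance is used because the norm is not smooth at the centre. Dividing by
  the central value gives the cutoffs value 1 at their base point.\<close>

definition bump :: "'a::euclidean_space \<Rightarrow> real \<Rightarrow> 'a \<Rightarrow> real" where
  "bump p0 r p = flat_exp 0 (r\<^sup>2 - (p - p0) \<bullet> (p - p0)) / flat_exp 0 (r\<^sup>2)"

lemma smooth_on_bump: "open S \<Longrightarrow> smooth_on S (bump p0 r)"
proof -
  assume S: "open S"
  have i: "smooth_on S (\<lambda>p. p - p0)"
    by (intro smooth_on_diff S smooth_on_bounded_linear bounded_linear_ident smooth_on_const)
  have "smooth_on S (\<lambda>p. r\<^sup>2 - (p - p0) \<bullet> (p - p0))"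
    by (intro smooth_on_diff[OF S] smooth_on_inner S i smooth_on_const)
  then have "smooth_on S (\<lambda>p. flat_exp 0 (r\<^sup>2 - (p - p0) \<bullet> (p - p0)))"
    by (rule smooth_on_compose[OF S smooth_on_flat_exp]) auto
  then have "smooth_on S (\<lambda>p. flat_exp 0 (r\<^sup>2 - (p - p0) \<bullet> (p - p0)) * inverse (flat_exp 0 (r\<^sup>2)))"
    by (intro smooth_on_mult S smooth_on_const)
  then show ?thesis by (simp add: bump_def[abs_def] divide_inverse)
qed

lemma bump_center: "r > 0 \<Longrightarrow> bump p0 r p0 = 1"
  by (simp add: bump_def flat_exp_def)

lemma bump_zero: "dist p p0 \<ge> r \<Longrightarrow> r > 0 \<Longrightarrow> bump p0 r p = 0"
proof -
  assume "dist p p0 \<ge> r" "r > 0"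
  then have "r\<^sup>2 \<le> (norm (p - p0))\<^sup>2" by (simp add: dist_norm power_mono)
  then show ?thesis by (simp add: bump_def flat_exp_def power2_norm_eq_inner)
qed

section \<open>Vector fields and differential forms in charts\<close>

locale smooth_manifold =
  fixes A :: "('m::t2_space, 'a::euclidean_space) chart set"
  assumes atlas: "smooth_atlas A"
begin

abbreviation VF where "VF \<equiv> vector_fields A"
abbreviation SF where "SF \<equiv> smooth_fun A"

lemma is_chart: "c \<in> A \<Longrightarrow> is_chart c"
  using atlas by (simp add: smooth_atlas_def)

lemma open_cdom: "c \<in> A \<Longrightarrow> open (cdom c)" and open_ccod: "c \<in> A \<Longrightarrow> open (ccod c)"
  using is_chart by (auto simp: is_chart_def)

lemma cinv_cmap [simp]: "c \<in> A \<Longrightarrow> x \<in> cdom c \<Longrightarrow> cinv c (cmap c x) = x"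
  and cmap_cinv [simp]: "c \<in> A \<Longrightarrow> p \<in> ccod c \<Longrightarrow> cmap c (cinv c p) = p"
  and cinv_cdom [simp]: "c \<in> A \<Longrightarrow> p \<in> ccod c \<Longrightarrow> cinv c p \<in> cdom c"
  and continuous_cmap: "c \<in> A \<Longrightarrow> continuous_on (cdom c) (cmap c)"
  and continuous_cinv: "c \<in> A \<Longrightarrow> continuous_on (ccod c) (cinv c)"
  using is_chart[of c] unfolding is_chart_def homeomorphism_def
  by (auto simp: inv_into_into f_inv_into_f)

lemma cmap_ccod [simp]: "x \<in> cdom c \<Longrightarrow> cmap c x \<in> ccod c"
  by simp

lemma chart_at: "chart_at A x \<in> A" "x \<in> cdom (chart_at A x)"
proof -
  have "\<exists>c. c \<in> A \<and> x \<in> cdom c" using atlas unfolding smooth_atlas_def by blast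
  then have "chart_at A x \<in> A \<and> x \<in> cdom (chart_at A x)" unfolding chart_at_def by (rule someI_ex)
  then show "chart_at A x \<in> A" "x \<in> cdom (chart_at A x)" by auto
qed

lemma open_cmap_preimage:
  assumes "c \<in> A" "open U" shows "open {y \<in> cdom c. cmap c y \<in> U}"
  using continuous_open_preimage[OF continuous_cmap[OF assms(1)] open_cdom[OF assms(1)] assms(2)]
  by (simp add: vimage_def Int_def)

lemma open_cinv_preimage:
  assumes "c \<in> A" "open U" shows "open {p \<in> ccod c. cinv c p \<in> U}"
  using continuous_open_preimage[OF continuous_cinv[OF assms(1)] open_ccod[OF assms(1)] assms(2)]
  by (simp add: vimage_def Int_def)

definition overlap where "overlap c d = {p \<in> ccod c. cinv c p \<in> cdom d}"

lemma open_overlap: "c \<in> A \<Longrightarrow> d \<in> A \<Longrightarrow> open (overlap c d)"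
  unfolding overlap_def by (intro open_cinv_preimage open_cdom)

abbreviation jac where "jac c d \<equiv> fderiv (cmap d \<circ> cinv c)"

lemma smooth_transition:
  assumes "c \<in> A" "d \<in> A" shows "smooth_on (overlap c d) (cmap d \<circ> cinv c)"
proof -
  have "overlap c d = cmap c ` (cdom c \<inter> cdom d)"
    using assms by (force simp: overlap_def)
  then show ?thesis using atlas assms by (simp add: smooth_atlas_def)
qed

lemma transition_has_derivative:
  "c \<in> A \<Longrightarrow> d \<in> A \<Longrightarrow> p \<in> overlap c d \<Longrightarrow> ((cmap d \<circ> cinv c) has_derivative jac c d p) (at p)"
  using has_fderiv smooth_on_differentiable smooth_transition by blast

lemma linear_jac: "c \<in> A \<Longrightarrow> d \<in> A \<Longrightarrow> p \<in> overlap c d \<Longrightarrow> linear (jac c d p)"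
  using transition_has_derivative has_derivative_linear by blast

lemma jac_id:
  assumes c: "c \<in> A" and p: "p \<in> ccod c" shows "jac c c p v = v"
proof -
  have "fderiv (cmap c \<circ> cinv c) p = fderiv (\<lambda>q. q) p"
    by (rule fderiv_cong[OF open_ccod[OF c] p]) (simp add: c)
  then show ?thesis by simp
qed

lemma jac_chain:
  assumes A: "c \<in> A" "d \<in> A" "e \<in> A" and p: "p \<in> ccod c" "cinv c p \<in> cdom d" "cinv c p \<in> cdom e"
  shows "jac d e (cmap d (cinv c p)) (jac c d p v) = jac c e p v"
proof -
  have "((cmap e \<circ> cinv d) has_derivative jac d e (cmap d (cinv c p))) (at (cmap d (cinv c p)))"
    by (rule transition_has_derivative) (use A p in \<open>auto simp: overlap_def\<close>)
  then have "((cmap e \<circ> cinv d) has_derivative jac d e (cmap d (cinv c p))) (at ((cmap d \<circ> cinv c) p))"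
    by simp
  moreover have "((cmap d \<circ> cinv c) has_derivative jac c d p) (at p)"
    by (rule transition_has_derivative) (use A p in \<open>auto simp: overlap_def\<close>)
  ultimately have "((\<lambda>q. (cmap e \<circ> cinv d) ((cmap d \<circ> cinv c) q)) has_derivative
      (\<lambda>v. jac d e (cmap d (cinv c p)) (jac c d p v))) (at p)"
    by (rule has_derivative_compose[rotated])
  from fderiv_eqI[OF this]
  have "jac d e (cmap d (cinv c p)) (jac c d p v) = fderiv (\<lambda>q. (cmap e \<circ> cinv d) ((cmap d \<circ> cinv c) q)) p v"
    by simp
  also have "fderiv (\<lambda>q. (cmap e \<circ> cinv d) ((cmap d \<circ> cinv c) q)) p = jac c e p"
    by (rule fderiv_cong[OF open_overlap[OF A(1,2)]]) (use A p in \<open>auto simp: overlap_def\<close>)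
  finally show ?thesis .
qed

lemma pt_overlap: "c \<in> A \<Longrightarrow> x \<in> cdom c \<Longrightarrow> pt A x \<in> overlap (chart_at A x) c"
  using chart_at[of x] by (simp add: overlap_def)

lemma linear_to_coords:
  assumes "c \<in> A" "x \<in> cdom c" shows "linear (to_coords A c x)"
  using linear_jac[OF chart_at(1) assms(1) pt_overlap[OF assms]] unfolding to_coords_def by (simp add: eta_contract_eq)

lemma linear_from_coords:
  assumes c: "c \<in> A" and p: "p \<in> ccod c" shows "linear (from_coords A c p)"
proof -
  have "linear (jac c (chart_at A (cinv c p)) p)"
    by (rule linear_jac[OF c chart_at(1)]) (use chart_at p in \<open>auto simp: overlap_def\<close>)
  then show ?thesis unfolding from_coords_def by (simp add: eta_contract_eq)
qed

lemma to_coords_from_coords: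
  assumes c: "c \<in> A" and p: "p \<in> ccod c" shows "to_coords A c (cinv c p) (from_coords A c p v) = v"
  unfolding to_coords_def from_coords_def
  using jac_chain[OF c chart_at(1) c p chart_at(2), of v] jac_id[OF c p] c p by simp

lemma from_coords_to_coords:
  assumes c: "c \<in> A" and x: "x \<in> cdom c" shows "from_coords A c (cmap c x) (to_coords A c x v) = v"
  unfolding to_coords_def from_coords_def
  using jac_chain[OF chart_at(1) c chart_at(1) _ _ chart_at(2), of "pt A x" x v] jac_id[of "chart_at A x" "pt A x" v]
    c x chart_at[of x] by simp

lemma to_coords_chart_at [simp]: "to_coords A (chart_at A x) x v = v"
  unfolding to_coords_def using chart_at[of x] by (intro jac_id) auto

lemma from_coords_chart_at [simp]: "from_coords A (chart_at A x) (pt A x) v = v"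
  using from_coords_to_coords[OF chart_at(1) chart_at(2), of x v] by simp

lemma to_coords_change:
  assumes "c \<in> A" "d \<in> A" "x \<in> cdom c" "x \<in> cdom d"
  shows "to_coords A d x v = jac c d (cmap c x) (to_coords A c x v)"
  unfolding to_coords_def using jac_chain[OF chart_at(1) assms(1,2), of "pt A x" x v] chart_at[of x] assms by simp

lemma vf_rep_change:
  assumes "c \<in> A" "d \<in> A" "p \<in> overlap c d"
  shows "vf_rep A d X (cmap d (cinv c p)) = jac c d p (vf_rep A c X p)"
  using to_coords_change[OF assms(1,2), of "cinv c p"] assms by (simp add: vf_rep_def overlap_def)

lemma vf_rep_cmap: "c \<in> A \<Longrightarrow> x \<in> cdom c \<Longrightarrow> vf_rep A c X (cmap c x) = to_coords A c x (X x)"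
  by (simp add: vf_rep_def)

lemma vf_rep_pt [simp]: "vf_rep A (chart_at A x) X (pt A x) = X x"
  using vf_rep_cmap[OF chart_at] by simp

lemma from_coords_vf_rep:
  "c \<in> A \<Longrightarrow> x \<in> cdom c \<Longrightarrow> from_coords A c (cmap c x) (vf_rep A c X (cmap c x)) = X x"
  by (simp add: vf_rep_cmap from_coords_to_coords)

lemma smooth_transition_jac:
  assumes "c \<in> A" "d \<in> A" shows "smooth_on (overlap c d) (\<lambda>p. jac c d p v)"
  by (rule smooth_on_fderiv[OF smooth_transition[OF assms]])

text \<open>\<open>smooth_fun\<close> refers to all charts of the atlas; near each point one chart
  suffices, because the transition maps to the others are smooth.\<close>

lemma smooth_funI:
  assumes "\<And>x. \<exists>c\<in>A. x \<in> cdom c \<and> (\<exists>U. open U \<and> cmap c x \<in> U \<and> U \<subseteq> ccod c \<and> smooth_on U (f \<circ> cinv c))"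
  shows "SF f"
  unfolding smooth_fun_def
proof (intro ballI smooth_on_local)
  fix d q assume d: "d \<in> A" and q: "q \<in> ccod d"
  obtain c U where c: "c \<in> A" "cinv d q \<in> cdom c" and U: "open U" "cmap c (cinv d q) \<in> U" "U \<subseteq> ccod c"
    and s: "smooth_on U (f \<circ> cinv c)" using assms by blast
  define V where "V = {q \<in> ccod d. cinv d q \<in> {y \<in> cdom c. cmap c y \<in> U}}"
  have oV: "open V" unfolding V_def by (intro open_cinv_preimage d open_cmap_preimage c U)
  have "smooth_on V (\<lambda>q. (f \<circ> cinv c) ((cmap c \<circ> cinv d) q))"
  proof (rule smooth_on_compose[OF oV s])
    show "smooth_on V (cmap c \<circ> cinv d)"
      by (rule smooth_on_subset[OF smooth_transition[OF d c(1)]]) (auto simp: V_def overlap_def)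
  qed (auto simp: V_def)
  then have "smooth_on V (f \<circ> cinv d)"
    by (rule smooth_on_cong[OF oV, rotated]) (auto simp: V_def c)
  then show "\<exists>U. open U \<and> q \<in> U \<and> smooth_on U (f \<circ> cinv d)"
    using oV q c U by (intro exI[of _ V]) (simp add: V_def)
qed

lemma vector_fieldI:
  assumes "\<And>x. \<exists>c\<in>A. x \<in> cdom c \<and> (\<exists>U. open U \<and> cmap c x \<in> U \<and> U \<subseteq> ccod c \<and> smooth_on U (vf_rep A c X))"
  shows "X \<in> VF"
  unfolding vector_fields_def
proof (intro CollectI ballI smooth_on_local)
  fix d q assume d: "d \<in> A" and q: "q \<in> ccod d"
  obtain c U where c: "c \<in> A" "cinv d q \<in> cdom c" and U: "open U" "cmap c (cinv d q) \<in> U" "U \<subseteq> ccod c"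
    and s: "smooth_on U (vf_rep A c X)" using assms by blast
  define V where "V = {q \<in> ccod d. cinv d q \<in> {y \<in> cdom c. cmap c y \<in> U}}"
  have oV: "open V" unfolding V_def by (intro open_cinv_preimage d open_cmap_preimage c U)
  have tr: "smooth_on V (cmap c \<circ> cinv d)"
    by (rule smooth_on_subset[OF smooth_transition[OF d c(1)]]) (auto simp: V_def overlap_def)
  have im: "(cmap c \<circ> cinv d) ` V \<subseteq> U" "(cmap c \<circ> cinv d) ` V \<subseteq> overlap c d"
    using c d by (auto simp: V_def overlap_def)
  have "smooth_on V (\<lambda>q. jac c d ((cmap c \<circ> cinv d) q) (vf_rep A c X ((cmap c \<circ> cinv d) q)))"
  proof (rule smooth_on_linear_apply[OF oV, where \<alpha> = "\<lambda>q. jac c d ((cmap c \<circ> cinv d) q)"])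
    show "smooth_on V (\<lambda>q. jac c d ((cmap c \<circ> cinv d) q) v)" for v
      by (rule smooth_on_compose[OF oV smooth_transition_jac[OF c(1) d] tr im(2)])
    show "smooth_on V (\<lambda>q. vf_rep A c X ((cmap c \<circ> cinv d) q))"
      by (rule smooth_on_compose[OF oV s tr im(1)])
    show "linear (jac c d ((cmap c \<circ> cinv d) q))" if "q \<in> V" for q
      using im(2) that by (intro linear_jac c d) auto
  qed
  then have "smooth_on V (vf_rep A d X)"
  proof (rule smooth_on_cong[OF oV, rotated])
    fix q assume q: "q \<in> V"
    then have "(cmap c \<circ> cinv d) q \<in> overlap c d" "q \<in> ccod d" "cinv d q \<in> cdom c"
      using im(2) by (auto simp: V_def)
    then show "jac c d ((cmap c \<circ> cinv d) q) (vf_rep A c X ((cmap c \<circ> cinv d) q)) = vf_rep A d X q"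
      using vf_rep_change[OF c(1) d, of "cmap c (cinv d q)" X] c d by simp
  qed
  then show "\<exists>U. open U \<and> q \<in> U \<and> smooth_on U (vf_rep A d X)"
    using oV q c U by (intro exI[of _ V]) (simp add: V_def)
qed

section \<open>The algebra of smooth functions and the module of vector fields\<close>

lemma SF_smooth: "SF f \<Longrightarrow> c \<in> A \<Longrightarrow> smooth_on (ccod c) (\<lambda>p. f (cinv c p))"
  by (simp add: smooth_fun_def comp_def)

lemma VF_smooth: "X \<in> VF \<Longrightarrow> c \<in> A \<Longrightarrow> smooth_on (ccod c) (vf_rep A c X)"
  by (simp add: vector_fields_def)

lemma SF_differentiable: "SF f \<Longrightarrow> c \<in> A \<Longrightarrow> p \<in> ccod c \<Longrightarrow> (\<lambda>p. f (cinv c p)) differentiable (at p)"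
  using smooth_on_differentiable[OF SF_smooth] .

lemma VF_differentiable: "X \<in> VF \<Longrightarrow> c \<in> A \<Longrightarrow> p \<in> ccod c \<Longrightarrow> vf_rep A c X differentiable (at p)"
  using smooth_on_differentiable[OF VF_smooth] .

lemma SF_const [simp]: "SF (\<lambda>x. r)"
  by (simp add: smooth_fun_def comp_def)

lemma SF_add: "SF f \<Longrightarrow> SF g \<Longrightarrow> SF (\<lambda>x. f x + g x)"
  unfolding smooth_fun_def[of A "\<lambda>x. f x + g x"] comp_def by (intro ballI smooth_on_add open_ccod SF_smooth)

lemma SF_diff: "SF f \<Longrightarrow> SF g \<Longrightarrow> SF (\<lambda>x. f x - g x)"
  unfolding smooth_fun_def[of A "\<lambda>x. f x - g x"] comp_def by (intro ballI smooth_on_diff open_ccod SF_smooth)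

lemma SF_minus: "SF f \<Longrightarrow> SF (\<lambda>x. - f x)"
  unfolding smooth_fun_def[of A "\<lambda>x. - f x"] comp_def by (intro ballI smooth_on_minus open_ccod SF_smooth)

lemma SF_mult: "SF f \<Longrightarrow> SF g \<Longrightarrow> SF (\<lambda>x. f x * g x)"
  unfolding smooth_fun_def[of A "\<lambda>x. f x * g x"] comp_def by (intro ballI smooth_on_mult open_ccod SF_smooth)

lemma vf_rep_add: "c \<in> A \<Longrightarrow> p \<in> ccod c \<Longrightarrow> vf_rep A c (\<lambda>x. X x + Y x) p = vf_rep A c X p + vf_rep A c Y p"
  and vf_rep_scale: "c \<in> A \<Longrightarrow> p \<in> ccod c \<Longrightarrow> vf_rep A c (\<lambda>x. f x *\<^sub>R X x) p = f (cinv c p) *\<^sub>R vf_rep A c X p"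
  using linear_to_coords[of c "cinv c p"] by (simp_all add: vf_rep_def linear_add linear_cmul)

lemma VF_add:
  assumes X: "X \<in> VF" and Y: "Y \<in> VF" shows "(\<lambda>x. X x + Y x) \<in> VF"
  unfolding vector_fields_def
proof (intro CollectI ballI)
  fix c assume c: "c \<in> A"
  show "smooth_on (ccod c) (vf_rep A c (\<lambda>x. X x + Y x))"
    by (rule smooth_on_cong[OF open_ccod[OF c] _ smooth_on_add[OF open_ccod[OF c] VF_smooth[OF X c] VF_smooth[OF Y c]]])
       (simp add: vf_rep_add c)
qed

lemma VF_scale:
  assumes f: "SF f" and X: "X \<in> VF" shows "(\<lambda>x. f x *\<^sub>R X x) \<in> VF"
  unfolding vector_fields_def
proof (intro CollectI ballI)
  fix c assume c: "c \<in> A"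
  show "smooth_on (ccod c) (vf_rep A c (\<lambda>x. f x *\<^sub>R X x))"
    by (rule smooth_on_cong[OF open_ccod[OF c] _ smooth_on_scaleR[OF open_ccod[OF c] SF_smooth[OF f c] VF_smooth[OF X c]]])
       (simp add: vf_rep_scale c)
qed

lemma VF_0 [simp]: "(\<lambda>x. 0) \<in> VF"
proof -
  have "vf_rep A c (\<lambda>x. 0) p = 0" if "c \<in> A" "p \<in> ccod c" for c p
    using linear_to_coords[of c "cinv c p"] that by (simp add: vf_rep_def linear_0)
  then have "smooth_on (ccod c) (vf_rep A c (\<lambda>x. 0))" if "c \<in> A" for c
    by (intro smooth_on_cong[OF open_ccod[OF that] _ smooth_on_const[of _ 0]]) (simp add: that)
  then show ?thesis unfolding vector_fields_def by simp
qed

lemma VF_minus: "X \<in> VF \<Longrightarrow> (\<lambda>x. - X x) \<in> VF"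
  using VF_scale[of "\<lambda>x. - 1" X] by simp

lemma VF_diff: "X \<in> VF \<Longrightarrow> Y \<in> VF \<Longrightarrow> (\<lambda>x. X x - Y x) \<in> VF"
  using VF_add[OF _ VF_minus, of X Y] by simp

lemma VF_sum: "(\<And>i. i \<in> I \<Longrightarrow> X i \<in> VF) \<Longrightarrow> (\<lambda>x. \<Sum>i\<in>I. X i x) \<in> VF"
proof (induction I rule: infinite_finite_induct)
  case (insert i I)
  then show ?case using VF_add[of "X i" "\<lambda>x. \<Sum>i\<in>I. X i x"] by simp
qed auto

section \<open>Directional derivatives and Lie brackets\<close>

lemma vf_apply_chart:
  assumes f: "SF f" and c: "c \<in> A" "x \<in> cdom c"
  shows "vf_apply A X f x = fderiv (\<lambda>p. f (cinv c p)) (cmap c x) (to_coords A c x (X x))"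
proof -
  let ?c = "chart_at A x"
  have "((\<lambda>p. f (cinv c p)) has_derivative fderiv (\<lambda>p. f (cinv c p)) (cmap c x)) (at ((cmap c \<circ> cinv ?c) (pt A x)))"
    using has_fderiv[OF SF_differentiable[OF f c(1) cmap_ccod[OF c(2)]]] chart_at[of x] by simp
  from has_derivative_compose[OF transition_has_derivative[OF chart_at(1) c(1) pt_overlap[OF c]] this]
  have "((\<lambda>p. f (cinv c ((cmap c \<circ> cinv ?c) p))) has_derivative
     (\<lambda>v. fderiv (\<lambda>p. f (cinv c p)) (cmap c x) (to_coords A c x v))) (at (pt A x))"
    by (simp add: to_coords_def)
  from fderiv_eqI[OF this]
  have "fderiv (\<lambda>p. f (cinv c p)) (cmap c x) (to_coords A c x (X x))
     = fderiv (\<lambda>p. f (cinv c ((cmap c \<circ> cinv ?c) p))) (pt A x) (X x)" by simp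
  also have "fderiv (\<lambda>p. f (cinv c ((cmap c \<circ> cinv ?c) p))) (pt A x) = fderiv (f \<circ> cinv ?c) (pt A x)"
    by (rule fderiv_cong[OF open_overlap[OF chart_at(1) c(1)] pt_overlap[OF c]]) (simp add: overlap_def c)
  finally show ?thesis by (simp add: vf_apply_def)
qed

lemma vf_apply_pt: "vf_apply A X f x = fderiv (\<lambda>p. f (cinv (chart_at A x) p)) (pt A x) (X x)"
  by (simp add: vf_apply_def comp_def)

lemma SF_vf_apply:
  assumes X: "X \<in> VF" and f: "SF f" shows "SF (vf_apply A X f)"
  unfolding smooth_fun_def
proof
  fix c assume c: "c \<in> A"
  have "smooth_on (ccod c) (\<lambda>p. fderiv (\<lambda>p. f (cinv c p)) p (vf_rep A c X p))"
    by (rule smooth_on_fderiv_apply[OF open_ccod[OF c] SF_smooth[OF f c] VF_smooth[OF X c]])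
  then show "smooth_on (ccod c) (vf_apply A X f \<circ> cinv c)"
    by (rule smooth_on_cong[OF open_ccod[OF c], rotated])
       (simp add: vf_apply_chart[OF f c] c vf_rep_def)
qed

lemma
  assumes f: "SF f"
  shows vf_apply_vf_add: "vf_apply A (\<lambda>x. X x + Y x) f x = vf_apply A X f x + vf_apply A Y f x"
    and vf_apply_vf_diff: "vf_apply A (\<lambda>x. X x - Y x) f x = vf_apply A X f x - vf_apply A Y f x"
    and vf_apply_vf_scale: "vf_apply A (\<lambda>x. g x *\<^sub>R X x) f x = g x * vf_apply A X f x"
    and vf_apply_vf_0: "Z x = 0 \<Longrightarrow> vf_apply A Z f x = 0"
proof -
  have "linear (fderiv (\<lambda>p. f (cinv (chart_at A x) p)) (pt A x))"
    by (intro linear_frechet_derivative SF_differentiable f chart_at cmap_ccod)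
  then show "vf_apply A (\<lambda>x. X x + Y x) f x = vf_apply A X f x + vf_apply A Y f x"
    "vf_apply A (\<lambda>x. X x - Y x) f x = vf_apply A X f x - vf_apply A Y f x"
    "vf_apply A (\<lambda>x. g x *\<^sub>R X x) f x = g x * vf_apply A X f x"
    "Z x = 0 \<Longrightarrow> vf_apply A Z f x = 0"
    by (simp_all add: vf_apply_pt linear_add linear_cmul linear_0 linear_diff)
qed

lemma vf_apply_const [simp]: "vf_apply A X (\<lambda>x. r) x = 0"
  by (simp add: vf_apply_pt)

lemma
  assumes f: "SF f" and g: "SF g"
  shows vf_apply_add: "vf_apply A X (\<lambda>x. f x + g x) x = vf_apply A X f x + vf_apply A X g x"
    and vf_apply_diff: "vf_apply A X (\<lambda>x. f x - g x) x = vf_apply A X f x - vf_apply A X g x"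
    and vf_apply_mult: "vf_apply A X (\<lambda>x. f x * g x) x = f x * vf_apply A X g x + vf_apply A X f x * g x"
proof -
  let ?c = "chart_at A x" let ?p = "pt A x"
  have d: "((\<lambda>p. f (cinv ?c p)) has_derivative fderiv (\<lambda>p. f (cinv ?c p)) ?p) (at ?p)"
    "((\<lambda>p. g (cinv ?c p)) has_derivative fderiv (\<lambda>p. g (cinv ?c p)) ?p) (at ?p)"
    by (intro has_fderiv SF_differentiable f g chart_at cmap_ccod)+
  have x: "cinv ?c ?p = x" using chart_at[of x] by simp
  show "vf_apply A X (\<lambda>x. f x + g x) x = vf_apply A X f x + vf_apply A X g x"
    unfolding vf_apply_pt using fderiv_eqI[OF has_derivative_add[OF d]] by simp
  show "vf_apply A X (\<lambda>x. f x - g x) x = vf_apply A X f x - vf_apply A X g x"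
    unfolding vf_apply_pt using fderiv_eqI[OF has_derivative_diff[OF d]] by simp
  show "vf_apply A X (\<lambda>x. f x * g x) x = f x * vf_apply A X g x + vf_apply A X f x * g x"
    unfolding vf_apply_pt using fderiv_eqI[OF has_derivative_mult[OF d]] x by simp
qed

text \<open>A change of chart adds to each of the two terms a second derivative of the transition
  map in the directions \<open>X x\<close> and \<open>Y x\<close>; by symmetry the additions cancel.
  Smoothness of the bracket rests on this, since the chart in its definition jumps with the
  point.\<close>

lemma lie_bracket_chart:
  assumes X: "X \<in> VF" and Y: "Y \<in> VF" and c: "c \<in> A" "x \<in> cdom c"
  shows "to_coords A c x (lie_bracket A X Y x) =
    fderiv (vf_rep A c Y) (cmap c x) (vf_rep A c X (cmap c x)) -
    fderiv (vf_rep A c X) (cmap c x) (vf_rep A c Y (cmap c x))"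
proof -
  let ?c = "chart_at A x" let ?p = "pt A x" let ?t = "cmap c \<circ> cinv ?c"
  note ov = open_overlap[OF chart_at(1) c(1)] pt_overlap[OF c]
  have tp: "?t ?p = cmap c x" using chart_at[of x] by simp
  \<comment> \<open>The derivative of \<open>vf_rep_change\<close>; its first summand is the second
    derivative of the transition map.\<close>
  have main: "fderiv (vf_rep A c Z) (cmap c x) (jac ?c c ?p u)
      = fderiv (\<lambda>q. jac ?c c q (Z x)) ?p u + jac ?c c ?p (fderiv (vf_rep A ?c Z) ?p u)"
    if Z: "Z \<in> VF" for Z u
  proof -
    have "(vf_rep A c Z has_derivative fderiv (vf_rep A c Z) (cmap c x)) (at (?t ?p))"
      using has_fderiv[OF VF_differentiable[OF Z c(1) cmap_ccod[OF c(2)]]] tp by simp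
    from has_derivative_compose[OF transition_has_derivative[OF chart_at(1) c(1) pt_overlap[OF c]] this]
    have "((\<lambda>q. vf_rep A c Z (?t q)) has_derivative (\<lambda>u. fderiv (vf_rep A c Z) (cmap c x) (jac ?c c ?p u))) (at ?p)" .
    from fderiv_eqI[OF this]
    have "fderiv (vf_rep A c Z) (cmap c x) (jac ?c c ?p u) = fderiv (\<lambda>q. vf_rep A c Z (?t q)) ?p u" by simp
    also have "fderiv (\<lambda>q. vf_rep A c Z (?t q)) ?p = fderiv (\<lambda>q. jac ?c c q (vf_rep A ?c Z q)) ?p"
      by (rule fderiv_cong[OF ov]) (simp add: vf_rep_change[OF chart_at(1) c(1)])
    also have "fderiv (\<lambda>q. jac ?c c q (vf_rep A ?c Z q)) ?p =
       (\<lambda>u. fderiv (\<lambda>q. jac ?c c q (vf_rep A ?c Z ?p)) ?p u + jac ?c c ?p (fderiv (vf_rep A ?c Z) ?p u))"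
    proof (rule fderiv_eqI[OF has_derivative_linear_apply[OF ov]])
      show "\<And>v. (\<lambda>p. jac ?c c p v) differentiable at ?p"
        using smooth_on_differentiable[OF smooth_transition_jac[OF chart_at(1) c(1)] ov(2)] .
      show "vf_rep A ?c Z differentiable at ?p"
        by (intro VF_differentiable Z chart_at cmap_ccod)
    qed (rule linear_jac[OF chart_at(1) c(1)])
    finally show ?thesis by (simp only: vf_rep_pt)
  qed
  have rep: "vf_rep A c Z (cmap c x) = jac ?c c ?p (Z x)" for Z
    using c by (simp add: vf_rep_def to_coords_def)
  have "jac ?c c ?p (lie_bracket A X Y x) = jac ?c c ?p (fderiv (vf_rep A ?c Y) ?p (X x))
      - jac ?c c ?p (fderiv (vf_rep A ?c X) ?p (Y x))"
    unfolding lie_bracket_def by (rule linear_diff[OF linear_jac[OF chart_at(1) c(1) ov(2)]])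
  then show ?thesis
    using symmetric_second_fderiv[OF ov(1) smooth_transition[OF chart_at(1) c(1)] ov(2), of "Y x" "X x"]
    by (simp add: rep main X Y to_coords_def)
qed

lemma VF_lie_bracket:
  assumes X: "X \<in> VF" and Y: "Y \<in> VF" shows "lie_bracket A X Y \<in> VF"
  unfolding vector_fields_def
proof (intro CollectI ballI)
  fix c assume c: "c \<in> A"
  have "smooth_on (ccod c) (\<lambda>p. fderiv (vf_rep A c Y) p (vf_rep A c X p) - fderiv (vf_rep A c X) p (vf_rep A c Y p))"
    by (intro smooth_on_diff open_ccod c smooth_on_fderiv_apply VF_smooth X Y)
  then show "smooth_on (ccod c) (vf_rep A c (lie_bracket A X Y))"
    by (rule smooth_on_cong[OF open_ccod[OF c], rotated])
       (use lie_bracket_chart[OF X Y c] c in \<open>simp add: vf_rep_def\<close>)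
qed

lemma lie_bracket_swap: "lie_bracket A Y X x = - lie_bracket A X Y x"
  by (simp add: lie_bracket_def)

lemma
  assumes X: "X \<in> VF" and Y: "Y \<in> VF"
  shows lie_bracket_add: "Z \<in> VF \<Longrightarrow> lie_bracket A X (\<lambda>x. Y x + Z x) x = lie_bracket A X Y x + lie_bracket A X Z x"
    and lie_bracket_scale: "SF f \<Longrightarrow>
      lie_bracket A X (\<lambda>x. f x *\<^sub>R Y x) x = vf_apply A X f x *\<^sub>R Y x + f x *\<^sub>R lie_bracket A X Y x"
proof -
  let ?c = "chart_at A x" let ?p = "pt A x"
  have p: "open (ccod ?c)" "?p \<in> ccod ?c" "cinv ?c ?p = x" using open_ccod chart_at[of x] by auto
  have d: "(vf_rep A ?c Z has_derivative fderiv (vf_rep A ?c Z) ?p) (at ?p)" if "Z \<in> VF" for Z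
    by (intro has_fderiv VF_differentiable that chart_at cmap_ccod)
  have lX: "linear (fderiv (vf_rep A ?c X) ?p)" using has_derivative_linear[OF d[OF X]] .
  {
    assume Z: "Z \<in> VF"
    have "fderiv (vf_rep A ?c (\<lambda>x. Y x + Z x)) ?p = fderiv (\<lambda>q. vf_rep A ?c Y q + vf_rep A ?c Z q) ?p"
      by (rule fderiv_cong[OF p(1,2)]) (rule vf_rep_add[OF chart_at(1)])
    then show "lie_bracket A X (\<lambda>x. Y x + Z x) x = lie_bracket A X Y x + lie_bracket A X Z x"
      using fderiv_eqI[OF has_derivative_add[OF d[OF Y] d[OF Z]]] lX
      by (simp add: lie_bracket_def linear_add)
  }
  {
    assume f: "SF f"
    have df: "((\<lambda>p. f (cinv ?c p)) has_derivative fderiv (\<lambda>p. f (cinv ?c p)) ?p) (at ?p)"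
      by (intro has_fderiv SF_differentiable f chart_at cmap_ccod)
    have "fderiv (vf_rep A ?c (\<lambda>x. f x *\<^sub>R Y x)) ?p = fderiv (\<lambda>q. f (cinv ?c q) *\<^sub>R vf_rep A ?c Y q) ?p"
      by (rule fderiv_cong[OF p(1,2)]) (rule vf_rep_scale[OF chart_at(1)])
    then show "lie_bracket A X (\<lambda>x. f x *\<^sub>R Y x) x = vf_apply A X f x *\<^sub>R Y x + f x *\<^sub>R lie_bracket A X Y x"
      using fderiv_eqI[OF has_derivative_scaleR[OF df d[OF Y]]] lX p(3)
      by (simp add: lie_bracket_def linear_cmul vf_apply_pt algebra_simps)
  }
qed

lemma form_rep_vf_rep:
  "c \<in> A \<Longrightarrow> p \<in> ccod c \<Longrightarrow> form_rep A c \<alpha> p (vf_rep A c X p) = \<alpha> (cinv c p) (X (cinv c p))"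
  using from_coords_vf_rep[of c "cinv c p" X] by (simp add: form_rep_def)

end

section \<open>One-forms and the exterior derivative\<close>

locale manifold_form = smooth_manifold A for A :: "('m::t2_space, 'a::euclidean_space) chart set" +
  fixes \<alpha> :: "'m \<Rightarrow> 'a \<Rightarrow> real"
  assumes one_form: "one_form_on A UNIV \<alpha>"
begin

lemma linear_form: "linear (\<alpha> x)"
  using one_form by (simp add: one_form_on_def)

lemma smooth_form_rep: "c \<in> A \<Longrightarrow> smooth_on (ccod c) (\<lambda>p. form_rep A c \<alpha> p v)"
  using one_form by (simp add: one_form_on_def)

lemma linear_form_rep: "c \<in> A \<Longrightarrow> p \<in> ccod c \<Longrightarrow> linear (form_rep A c \<alpha> p)"
  unfolding form_rep_def using linear_compose[OF linear_from_coords linear_form] by (simp add: comp_def)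

lemma form_rep_differentiable: "c \<in> A \<Longrightarrow> p \<in> ccod c \<Longrightarrow> (\<lambda>p. form_rep A c \<alpha> p v) differentiable (at p)"
  using smooth_on_differentiable[OF smooth_form_rep] .

lemma SF_form:
  assumes X: "X \<in> VF" shows "SF (\<lambda>x. \<alpha> x (X x))"
  unfolding smooth_fun_def
proof
  fix c assume c: "c \<in> A"
  have "smooth_on (ccod c) (\<lambda>p. form_rep A c \<alpha> p (vf_rep A c X p))"
    by (rule smooth_on_linear_apply[OF open_ccod[OF c] linear_form_rep[OF c] smooth_form_rep[OF c] VF_smooth[OF X c]])
  then show "smooth_on (ccod c) ((\<lambda>x. \<alpha> x (X x)) \<circ> cinv c)"
    by (rule smooth_on_cong[OF open_ccod[OF c], rotated]) (simp add: form_rep_vf_rep c)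
qed

abbreviation d\<alpha> where "d\<alpha> \<equiv> ext_deriv A \<alpha>"

text \<open>The exterior derivative in one fixed chart. Unlike \<open>ext_deriv\<close>, it can be
  differentiated with respect to the point.\<close>

definition d_rep where
  "d_rep c p u v = fderiv (\<lambda>p. form_rep A c \<alpha> p v) p u - fderiv (\<lambda>p. form_rep A c \<alpha> p u) p v"

lemma ext_deriv_eq_d_rep: "d\<alpha> x u v = d_rep (chart_at A x) (pt A x) u v"
  by (simp add: ext_deriv_def d_rep_def)

text \<open>The derivatives of the components of \<open>X\<close> and \<open>Y\<close> that appear
  in the first two terms are removed by the bracket. Since the right-hand side does not involve
  \<open>c\<close>, the exterior derivative is independent of the chart and smooth on smooth
  fields.\<close>

lemma d_rep_formula:
  assumes X: "X \<in> VF" and Y: "Y \<in> VF" and c: "c \<in> A" "x \<in> cdom c"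
  shows "d_rep c (cmap c x) (vf_rep A c X (cmap c x)) (vf_rep A c Y (cmap c x)) =
    vf_apply A X (\<lambda>x. \<alpha> x (Y x)) x - vf_apply A Y (\<lambda>x. \<alpha> x (X x)) x - \<alpha> x (lie_bracket A X Y x)"
proof -
  let ?p = "cmap c x"
  have p: "open (ccod c)" "?p \<in> ccod c" using open_ccod c by auto
  have main: "vf_apply A U (\<lambda>x. \<alpha> x (Z x)) x = fderiv (\<lambda>p. form_rep A c \<alpha> p (vf_rep A c Z ?p)) ?p (vf_rep A c U ?p)
      + form_rep A c \<alpha> ?p (fderiv (vf_rep A c Z) ?p (vf_rep A c U ?p))" if "Z \<in> VF" for U Z
  proof -
    have "vf_apply A U (\<lambda>x. \<alpha> x (Z x)) x = fderiv (\<lambda>p. \<alpha> (cinv c p) (Z (cinv c p))) ?p (vf_rep A c U ?p)"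
      using vf_apply_chart[OF SF_form[OF that] c] c by (simp add: vf_rep_cmap)
    also have "fderiv (\<lambda>p. \<alpha> (cinv c p) (Z (cinv c p))) ?p = fderiv (\<lambda>p. form_rep A c \<alpha> p (vf_rep A c Z p)) ?p"
      by (rule fderiv_cong[OF p]) (simp add: form_rep_vf_rep c)
    also have "\<dots> = (\<lambda>h. fderiv (\<lambda>p. form_rep A c \<alpha> p (vf_rep A c Z ?p)) ?p h
      + form_rep A c \<alpha> ?p (fderiv (vf_rep A c Z) ?p h))"
      by (rule fderiv_eqI[OF has_derivative_linear_apply[OF p linear_form_rep[OF c(1)]
         form_rep_differentiable[OF c(1) p(2)] VF_differentiable[OF that c(1) p(2)]]])
    finally show ?thesis .
  qed
  have "\<alpha> x (lie_bracket A X Y x) = form_rep A c \<alpha> ?p (to_coords A c x (lie_bracket A X Y x))"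
    using c by (simp add: form_rep_def from_coords_to_coords)
  also have "\<dots> = form_rep A c \<alpha> ?p (fderiv (vf_rep A c Y) ?p (vf_rep A c X ?p))
      - form_rep A c \<alpha> ?p (fderiv (vf_rep A c X) ?p (vf_rep A c Y ?p))"
    unfolding lie_bracket_chart[OF X Y c] by (rule linear_diff[OF linear_form_rep[OF c(1) p(2)]])
  finally show ?thesis by (simp add: main X Y d_rep_def)
qed

lemma ext_deriv_formula:
  assumes X: "X \<in> VF" and Y: "Y \<in> VF"
  shows "d\<alpha> x (X x) (Y x) =
    vf_apply A X (\<lambda>x. \<alpha> x (Y x)) x - vf_apply A Y (\<lambda>x. \<alpha> x (X x)) x - \<alpha> x (lie_bracket A X Y x)"
  using d_rep_formula[OF X Y chart_at] by (simp add: ext_deriv_eq_d_rep)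

lemma ext_deriv_chart:
  assumes X: "X \<in> VF" and Y: "Y \<in> VF" and c: "c \<in> A" "x \<in> cdom c"
  shows "d\<alpha> x (X x) (Y x) = d_rep c (cmap c x) (vf_rep A c X (cmap c x)) (vf_rep A c Y (cmap c x))"
  using d_rep_formula[OF X Y c] ext_deriv_formula[OF X Y] by simp

lemma SF_ext_deriv:
  assumes X: "X \<in> VF" and Y: "Y \<in> VF" shows "SF (\<lambda>x. d\<alpha> x (X x) (Y x))"
  unfolding ext_deriv_formula[OF X Y]
  by (intro SF_diff SF_vf_apply SF_form VF_lie_bracket X Y)

lemma d_rep_swap: "d_rep c p v u = - d_rep c p u v"
  by (simp add: d_rep_def)

lemma linear_d_rep:
  assumes c: "c \<in> A" and p: "p \<in> ccod c"
  shows "linear (\<lambda>v. d_rep c p u v)" "linear (\<lambda>u. d_rep c p u v)"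
proof -
  have d: "((\<lambda>p. form_rep A c \<alpha> p v) has_derivative fderiv (\<lambda>p. form_rep A c \<alpha> p v) p) (at p)" for v
    by (rule has_fderiv[OF form_rep_differentiable[OF c p]])
  show *: "linear (\<lambda>v. d_rep c p u v)" for u
  proof (rule linearI)
    fix v w :: 'a and r :: real
    have "fderiv (\<lambda>p. form_rep A c \<alpha> p (v + w)) p = fderiv (\<lambda>p. form_rep A c \<alpha> p v + form_rep A c \<alpha> p w) p"
      by (rule fderiv_cong[OF open_ccod[OF c] p]) (simp add: linear_add linear_form_rep c)
    then show "d_rep c p u (v + w) = d_rep c p u v + d_rep c p u w"
      using fderiv_eqI[OF has_derivative_add[OF d d], of v w] has_derivative_linear[OF d, of u]
      by (simp add: d_rep_def linear_add)
    have "fderiv (\<lambda>p. form_rep A c \<alpha> p (r *\<^sub>R v)) p = fderiv (\<lambda>p. r *\<^sub>R form_rep A c \<alpha> p v) p"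
      by (rule fderiv_cong[OF open_ccod[OF c] p]) (use linear_cmul[OF linear_form_rep[OF c]] in simp)
    then show "d_rep c p u (r *\<^sub>R v) = r *\<^sub>R d_rep c p u v"
      using fderiv_eqI[OF has_derivative_scaleR_right[OF d], of r v] linear_cmul[OF has_derivative_linear[OF d, of u]]
      by (simp add: d_rep_def algebra_simps)
  qed
  have "(\<lambda>u. d_rep c p u v) = (\<lambda>u. - d_rep c p v u)" using d_rep_swap by blast
  then show "linear (\<lambda>u. d_rep c p u v)" using linear_compose_neg[OF *] by simp
qed

lemma ext_deriv_swap: "d\<alpha> x v u = - d\<alpha> x u v"
  by (simp add: ext_deriv_def)

lemma ext_deriv_self [simp]: "d\<alpha> x u u = 0"
  by (simp add: ext_deriv_def)

lemma linear_ext_deriv: "linear (\<lambda>v. d\<alpha> x u v)" "linear (\<lambda>u. d\<alpha> x u v)"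
  unfolding ext_deriv_eq_d_rep by (intro linear_d_rep chart_at cmap_ccod)+

lemma smooth_d_rep: "c \<in> A \<Longrightarrow> smooth_on (ccod c) (\<lambda>p. d_rep c p u v)"
  unfolding d_rep_def by (intro smooth_on_diff open_ccod smooth_on_fderiv smooth_form_rep)

text \<open>This is \<open>dd\<alpha> = 0\<close> in coordinates: six second derivatives of
  components cancel in pairs by symmetry.\<close>

lemma d_rep_closed:
  assumes c: "c \<in> A" and p: "p \<in> ccod c"
  shows "fderiv (\<lambda>q. d_rep c q u v) p t = fderiv (\<lambda>q. d_rep c q t v) p u - fderiv (\<lambda>q. d_rep c q t u) p v"
proof -
  let ?f = "\<lambda>v q. form_rep A c \<alpha> q v"
  have d: "((\<lambda>q. fderiv (?f v) q u) has_derivative fderiv (\<lambda>q. fderiv (?f v) q u) p) (at p)" for u v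
    by (rule has_fderiv[OF smooth_on_differentiable[OF smooth_on_fderiv[OF smooth_form_rep[OF c]] p]])
  have e: "fderiv (\<lambda>q. d_rep c q u v) p t = fderiv (\<lambda>q. fderiv (?f v) q u) p t - fderiv (\<lambda>q. fderiv (?f u) q v) p t" for u v t
    using fderiv_eqI[OF has_derivative_diff[OF d d]] by (simp add: d_rep_def)
  have s: "fderiv (\<lambda>q. fderiv (?f w) q u) p v = fderiv (\<lambda>q. fderiv (?f w) q v) p u" for u v w
    by (rule symmetric_second_fderiv_real[OF open_ccod[OF c] smooth_form_rep[OF c] p])
  show ?thesis unfolding e using s[of v u t] s[of u v t] s[of t u v] by simp
qed

text \<open>By Cartan's formula the left side minus the right side is \<open>i(T) dd\<alpha> = 0\<close>.\<close>

lemma lie_derivative_ext_deriv_zero: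
  assumes T: "T \<in> VF" "\<And>x w. d\<alpha> x (T x) w = 0" and X: "X \<in> VF" and Y: "Y \<in> VF"
  shows "vf_apply A T (\<lambda>x. d\<alpha> x (X x) (Y x)) x = d\<alpha> x (lie_bracket A T X x) (Y x) + d\<alpha> x (X x) (lie_bracket A T Y x)"
proof -
  let ?c = "chart_at A x" let ?p = "pt A x"
  have c: "?c \<in> A" "x \<in> cdom ?c" and p: "open (ccod ?c)" "?p \<in> ccod ?c"
    using chart_at[of x] open_ccod by auto
  have deriv: "vf_apply A U (\<lambda>x. d\<alpha> x (Z x) (W x)) x =
     fderiv (\<lambda>q. d_rep ?c q (Z x) (W x)) ?p (U x)
     + d\<alpha> x (fderiv (vf_rep A ?c Z) ?p (U x)) (W x) + d\<alpha> x (Z x) (fderiv (vf_rep A ?c W) ?p (U x))"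
    if Z: "Z \<in> VF" and W: "W \<in> VF" for U Z W
  proof -
    have "fderiv (\<lambda>q. d\<alpha> (cinv ?c q) (Z (cinv ?c q)) (W (cinv ?c q))) ?p
        = fderiv (\<lambda>q. d_rep ?c q (vf_rep A ?c Z q) (vf_rep A ?c W q)) ?p"
      by (rule fderiv_cong[OF p]) (use ext_deriv_chart[OF Z W c(1)] c in simp)
    also have "\<dots> = (\<lambda>h. fderiv (\<lambda>q. d_rep ?c q (vf_rep A ?c Z ?p) (vf_rep A ?c W ?p)) ?p h
        + d_rep ?c ?p (fderiv (vf_rep A ?c Z) ?p h) (vf_rep A ?c W ?p)
        + d_rep ?c ?p (vf_rep A ?c Z ?p) (fderiv (vf_rep A ?c W) ?p h))"
      by (rule fderiv_eqI[OF has_derivative_bilinear_apply[OF p linear_d_rep(2,1)[OF c(1)]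
         smooth_on_differentiable[OF smooth_d_rep[OF c(1)] p(2)] VF_differentiable[OF Z c(1) p(2)]
         VF_differentiable[OF W c(1) p(2)]]])
    finally show ?thesis by (simp add: vf_apply_pt ext_deriv_eq_d_rep)
  qed
  \<comment> \<open>The function \<open>d\<alpha>(T, Z)\<close> is identically zero. Differentiating
    it trades a derivative of the coefficients for a derivative of \<open>T\<close>, which is what
    the brackets contain.\<close>
  have TZ: "fderiv (\<lambda>q. d_rep ?c q (T x) (Z x)) ?p (U x) = - d\<alpha> x (fderiv (vf_rep A ?c T) ?p (U x)) (Z x)"
    if Z: "Z \<in> VF" for U Z
    using deriv[OF T(1) Z, of U] T(2) by simp
  have br: "lie_bracket A T Z x = fderiv (vf_rep A ?c Z) ?p (T x) - fderiv (vf_rep A ?c T) ?p (Z x)" for Z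
    by (simp add: lie_bracket_def)
  show ?thesis
    unfolding deriv[OF X Y] br linear_diff[OF linear_ext_deriv(1)] linear_diff[OF linear_ext_deriv(2)]
    using d_rep_closed[OF c(1) p(2), of "X x" "Y x" "T x"] TZ[OF X, of Y] TZ[OF Y, of X]
      ext_deriv_swap[of x "X x" "fderiv (vf_rep A ?c T) ?p (Y x)"]
    by simp
qed

end

section \<open>Tensorial maps\<close>

lemma endo_trace_commute:
  fixes P Q :: "'a::euclidean_space \<Rightarrow> 'a"
  assumes P: "linear P" and Q: "linear Q"
  shows "endo_trace (\<lambda>v. P (Q v)) = endo_trace (\<lambda>v. Q (P v))"
proof -
  have *: "endo_trace (\<lambda>v. P (Q v)) = (\<Sum>b\<in>Basis. \<Sum>c\<in>Basis. (Q b \<bullet> c) * (P c \<bullet> b))" if "linear P" for P Q :: "'a \<Rightarrow> 'a"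
    unfolding endo_trace_def
    by (intro sum.cong refl, subst linear_euclidean_sum[OF that]) (simp add: inner_sum_left)
  show ?thesis
    unfolding *[OF P] *[OF Q] by (subst sum.swap) (simp add: mult.commute)
qed

text \<open>\<open>endo_trace\<close> refers to the coordinates of the preferred chart; this carries
  it over to any other chart.\<close>

lemma endo_trace_conjugate:
  fixes P Q L :: "'a::euclidean_space \<Rightarrow> 'a"
  assumes P: "linear P" and Q: "linear Q" and L: "linear L" and QP: "\<And>v. Q (P v) = v"
  shows "endo_trace (\<lambda>v. P (L (Q v))) = endo_trace L"
proof -
  have "endo_trace (\<lambda>v. P (L (Q v))) = endo_trace (\<lambda>v. L (Q (P v)))"
    using endo_trace_commute[OF P linear_compose[OF Q L]] by (simp add: comp_def)
  then show ?thesis by (simp add: QP)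
qed

lemma endo_trace_add: "endo_trace (\<lambda>v. P v + Q v) = endo_trace P + endo_trace Q"
  and endo_trace_diff: "endo_trace (\<lambda>v. P v - Q v) = endo_trace P - endo_trace Q"
  and endo_trace_scale: "endo_trace (\<lambda>v. r *\<^sub>R P v) = r * endo_trace P"
  by (simp_all add: endo_trace_def inner_add_left inner_diff_left sum.distrib sum_subtractf sum_distrib_left)

lemma endo_trace_id: "endo_trace (\<lambda>v::'a::euclidean_space. v) = DIM('a)"
  by (simp add: endo_trace_def)

lemma endo_trace_rank_one:
  fixes w :: "'a::euclidean_space"
  assumes "linear \<phi>" shows "endo_trace (\<lambda>v. \<phi> v *\<^sub>R w) = \<phi> w"
  using linear_euclidean_sum[OF assms, of w] by (simp add: endo_trace_def mult.commute)

section \<open>Cutoffs, frames, and the pointwise values of function-linear maps\<close>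

context smooth_manifold
begin

text \<open>Connections accept global fields only, so local data are multiplied by a function with
  support in a chart and extended by zero.\<close>

lemma cutoff:
  assumes c: "c \<in> A" and x: "x \<in> cdom c"
  obtains f where "SF f" "f x = 1" "\<And>y. y \<notin> cdom c \<Longrightarrow> f y = 0"
    "\<And>h. smooth_on (ccod c) (\<lambda>p. h (cinv c p)) \<Longrightarrow> SF (\<lambda>y. if y \<in> cdom c then f y * h y else 0)"
    "\<And>X. smooth_on (ccod c) (vf_rep A c X) \<Longrightarrow> (\<lambda>y. if y \<in> cdom c then f y *\<^sub>R X y else 0) \<in> VF"
proof -
  define p0 where "p0 = cmap c x"
  obtain r where r: "r > 0" "cball p0 r \<subseteq> ccod c"
    using open_contains_cball_eq[OF open_ccod[OF c]] cmap_ccod[OF x] unfolding p0_def by blast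
  define K where "K = cinv c ` cball p0 r"
  have "compact K"
    unfolding K_def by (intro compact_continuous_image continuous_on_subset[OF continuous_cinv[OF c] r(2)]) simp
  \<comment> \<open>Here the Hausdorff property enters: points outside the chart get a neighbourhood
    that misses the support, and there the extension by zero is trivially smooth.\<close>
  then have K: "open (- K)" by (simp add: compact_imp_closed open_Compl)
  define f where "f y = (if y \<in> cdom c then bump p0 r (cmap c y) else 0)" for y
  have f0: "f y = 0" if "y \<notin> K" for y
  proof (cases "y \<in> cdom c")
    case True
    have "cmap c y \<notin> cball p0 r"
    proof
      assume "cmap c y \<in> cball p0 r"
      then have "cinv c (cmap c y) \<in> K" unfolding K_def by blast
      then show False using that True c by simp
    qed
    then show ?thesis using r(1) by (simp add: f_def bump_zero dist_commute)
  qed (simp add: f_def)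
  have fs: "smooth_on (ccod c) (\<lambda>p. f (cinv c p))"
    by (rule smooth_on_cong[OF open_ccod[OF c] _ smooth_on_bump[OF open_ccod[OF c], of p0 r]])
       (simp add: f_def c)
  have off: "\<exists>d\<in>A. y \<in> cdom d \<and> (\<exists>U. open U \<and> cmap d y \<in> U \<and> U \<subseteq> ccod d \<and> (\<forall>q\<in>U. cinv d q \<notin> K))"
    if "y \<notin> cdom c" for y
  proof -
    let ?d = "chart_at A y" let ?U = "{q \<in> ccod ?d. cinv ?d q \<in> - K}"
    have "y \<notin> K" using that r(2) c unfolding K_def by auto
    then have "open ?U" "cmap ?d y \<in> ?U" "\<forall>q\<in>?U. cinv ?d q \<notin> K"
      using open_cinv_preimage[OF chart_at(1) K, of y] chart_at[of y] by auto
    moreover have "?U \<subseteq> ccod ?d" by blast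
    ultimately show ?thesis using chart_at[of y] by meson
  qed
  have SFh: "SF (\<lambda>y. if y \<in> cdom c then f y * h y else 0)" if h: "smooth_on (ccod c) (\<lambda>p. h (cinv c p))" for h
  proof (rule smooth_funI)
    fix y
    let ?g = "\<lambda>y. if y \<in> cdom c then f y * h y else 0"
    show "\<exists>d\<in>A. y \<in> cdom d \<and> (\<exists>U. open U \<and> cmap d y \<in> U \<and> U \<subseteq> ccod d \<and> smooth_on U (?g \<circ> cinv d))"
    proof (cases "y \<in> cdom c")
      case True
      have "smooth_on (ccod c) (?g \<circ> cinv c)"
        by (rule smooth_on_cong[OF open_ccod[OF c] _ smooth_on_mult[OF open_ccod[OF c] fs h]]) (simp add: c)
      then show ?thesis using True c open_ccod[OF c] cmap_ccod[OF True] by blast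
    next
      case False
      then obtain d U where d: "d \<in> A" "y \<in> cdom d" "open U" "cmap d y \<in> U" "U \<subseteq> ccod d" "\<forall>q\<in>U. cinv d q \<notin> K"
        using off by blast
      have "smooth_on U (?g \<circ> cinv d)"
        by (rule smooth_on_cong[OF d(3) _ smooth_on_const[of _ 0]]) (use d(6) f0 in auto)
      then show ?thesis using d by blast
    qed
  qed
  have VFh: "(\<lambda>y. if y \<in> cdom c then f y *\<^sub>R X y else 0) \<in> VF" if X: "smooth_on (ccod c) (vf_rep A c X)" for X
  proof (rule vector_fieldI)
    fix y
    let ?g = "\<lambda>y. if y \<in> cdom c then f y *\<^sub>R X y else 0"
    show "\<exists>d\<in>A. y \<in> cdom d \<and> (\<exists>U. open U \<and> cmap d y \<in> U \<and> U \<subseteq> ccod d \<and> smooth_on U (vf_rep A d ?g))"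
    proof (cases "y \<in> cdom c")
      case True
      have "smooth_on (ccod c) (vf_rep A c ?g)"
      proof (rule smooth_on_cong[OF open_ccod[OF c] _ smooth_on_scaleR[OF open_ccod[OF c] fs X]])
        fix p assume p: "p \<in> ccod c"
        show "f (cinv c p) *\<^sub>R vf_rep A c X p = vf_rep A c ?g p"
          using linear_cmul[OF linear_to_coords[OF c cinv_cdom[OF c p]]] cinv_cdom[OF c p] by (simp add: vf_rep_def)
      qed
      then show ?thesis using True c open_ccod[OF c] cmap_ccod[OF True] by blast
    next
      case False
      then obtain d U where d: "d \<in> A" "y \<in> cdom d" "open U" "cmap d y \<in> U" "U \<subseteq> ccod d" "\<forall>q\<in>U. cinv d q \<notin> K"
        using off by blast
      have "smooth_on U (vf_rep A d ?g)"
      proof (rule smooth_on_cong[OF d(3) _ smooth_on_const[of _ 0]])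
        fix q assume q: "q \<in> U"
        then have "q \<in> ccod d" "?g (cinv d q) = 0" using d(5,6) f0 by auto
        then show "0 = vf_rep A d ?g q"
          using linear_0[OF linear_to_coords[OF d(1) cinv_cdom[OF d(1)]]] by (simp add: vf_rep_def)
      qed
      then show ?thesis using d by blast
    qed
  qed
  have "SF (\<lambda>y. if y \<in> cdom c then f y * 1 else 0)" by (rule SFh) simp
  moreover have "(\<lambda>y. if y \<in> cdom c then f y * 1 else 0) = f" by (auto simp: f_def)
  ultimately show thesis
    using that[of f] SFh VFh bump_center[OF r(1), of p0] x by (simp add: f_def p0_def)
qed

text \<open>Both factors of the expansion carry the cutoff, so that the coefficients and the
  fields \<open>E b\<close> are globally smooth.\<close>

lemma frame:
  assumes c: "c \<in> A" and x: "x \<in> cdom c"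
  obtains f E where "SF f" "f x = 1" "\<And>v. E v \<in> VF"
    "\<And>v y. y \<in> cdom c \<Longrightarrow> E v y = f y *\<^sub>R from_coords A c (cmap c y) v"
    "\<And>X. X \<in> VF \<Longrightarrow> \<exists>g. (\<forall>b. SF (g b)) \<and>
        (\<forall>b. \<forall>y\<in>cdom c. g b y = f y * (vf_rep A c X (cmap c y) \<bullet> b)) \<and>
        X = (\<lambda>y. (1 - f y * f y) *\<^sub>R X y + (\<Sum>b\<in>Basis. g b y *\<^sub>R E b y))"
proof -
  obtain f where f: "SF f" "f x = 1" "\<And>y. y \<notin> cdom c \<Longrightarrow> f y = 0"
    and fh: "\<And>h. smooth_on (ccod c) (\<lambda>p. h (cinv c p)) \<Longrightarrow> SF (\<lambda>y. if y \<in> cdom c then f y * h y else 0)"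
    and fX: "\<And>X. smooth_on (ccod c) (vf_rep A c X) \<Longrightarrow> (\<lambda>y. if y \<in> cdom c then f y *\<^sub>R X y else 0) \<in> VF"
    using cutoff[OF c x] by blast
  define E where "E v y = (if y \<in> cdom c then f y *\<^sub>R from_coords A c (cmap c y) v else 0)" for v y
  have E: "E v \<in> VF" for v
  proof -
    have "smooth_on (ccod c) (vf_rep A c (\<lambda>y. from_coords A c (cmap c y) v))"
      by (rule smooth_on_cong[OF open_ccod[OF c] _ smooth_on_const[of _ v]])
         (simp add: vf_rep_def to_coords_from_coords c)
    from fX[OF this] show ?thesis by (simp add: E_def[abs_def])
  qed
  have dec: "\<exists>g. (\<forall>b. SF (g b)) \<and> (\<forall>b. \<forall>y\<in>cdom c. g b y = f y * (vf_rep A c X (cmap c y) \<bullet> b)) \<and>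
      X = (\<lambda>y. (1 - f y * f y) *\<^sub>R X y + (\<Sum>b\<in>Basis. g b y *\<^sub>R E b y))" if X: "X \<in> VF" for X
  proof -
    define g where "g b y = (if y \<in> cdom c then f y * (vf_rep A c X (cmap c y) \<bullet> b) else 0)" for b y
    have "SF (g b)" for b
    proof -
      have "smooth_on (ccod c) (\<lambda>p. vf_rep A c X (cmap c (cinv c p)) \<bullet> b)"
        by (rule smooth_on_cong[OF open_ccod[OF c] _ smooth_on_inner[OF open_ccod[OF c] VF_smooth[OF X c] smooth_on_const[of _ b]]])
           (simp add: c)
      from fh[OF this] show ?thesis by (simp add: g_def[abs_def])
    qed
    moreover have "X y = (1 - f y * f y) *\<^sub>R X y + (\<Sum>b\<in>Basis. g b y *\<^sub>R E b y)" for y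
    proof (cases "y \<in> cdom c")
      case True
      have "X y = from_coords A c (cmap c y) (vf_rep A c X (cmap c y))"
        using from_coords_vf_rep[OF c True] by simp
      also have "\<dots> = (\<Sum>b\<in>Basis. (vf_rep A c X (cmap c y) \<bullet> b) *\<^sub>R from_coords A c (cmap c y) b)"
        by (rule linear_euclidean_sum[OF linear_from_coords[OF c cmap_ccod[OF True]]])
      finally have "(f y * f y) *\<^sub>R X y = (f y * f y) *\<^sub>R (\<Sum>b\<in>Basis. (vf_rep A c X (cmap c y) \<bullet> b) *\<^sub>R from_coords A c (cmap c y) b)"
        by simp
      also have "\<dots> = (\<Sum>b\<in>Basis. g b y *\<^sub>R E b y)"
        using True by (simp add: g_def E_def scaleR_sum_right algebra_simps)
      finally show ?thesis by (simp add: algebra_simps)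
    qed (simp add: g_def f(3))
    ultimately show ?thesis by (intro exI[of _ g]) (auto simp: g_def)
  qed
  show thesis
    by (rule that[OF f(1,2) E _ dec]) (simp_all add: E_def)
qed

text \<open>The values lie in an arbitrary real vector space and carry no smoothness demand, so that
  one notion serves covectors, endomorphisms and traces.\<close>

definition tensorial :: "(('m \<Rightarrow> 'a) \<Rightarrow> 'm \<Rightarrow> 'b::real_vector) \<Rightarrow> bool" where
  "tensorial \<Phi> \<longleftrightarrow>
     (\<forall>X\<in>VF. \<forall>Y\<in>VF. \<forall>x. \<Phi> (\<lambda>x. X x + Y x) x = \<Phi> X x + \<Phi> Y x) \<and>
     (\<forall>f X x. SF f \<longrightarrow> X \<in> VF \<longrightarrow> \<Phi> (\<lambda>x. f x *\<^sub>R X x) x = f x *\<^sub>R \<Phi> X x)"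

lemma tensorialI:
  assumes "\<And>X Y x. X \<in> VF \<Longrightarrow> Y \<in> VF \<Longrightarrow> \<Phi> (\<lambda>x. X x + Y x) x = \<Phi> X x + \<Phi> Y x"
    "\<And>f X x. SF f \<Longrightarrow> X \<in> VF \<Longrightarrow> \<Phi> (\<lambda>x. f x *\<^sub>R X x) x = f x *\<^sub>R \<Phi> X x"
  shows "tensorial \<Phi>"
  using assms by (simp add: tensorial_def)

lemma tensorial_add: "tensorial \<Phi> \<Longrightarrow> X \<in> VF \<Longrightarrow> Y \<in> VF \<Longrightarrow> \<Phi> (\<lambda>x. X x + Y x) x = \<Phi> X x + \<Phi> Y x"
  and tensorial_scale: "tensorial \<Phi> \<Longrightarrow> SF f \<Longrightarrow> X \<in> VF \<Longrightarrow> \<Phi> (\<lambda>x. f x *\<^sub>R X x) x = f x *\<^sub>R \<Phi> X x"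
  by (simp_all add: tensorial_def)

lemma tensorial_0: "tensorial \<Phi> \<Longrightarrow> \<Phi> (\<lambda>x. 0) x = 0"
  using tensorial_scale[of \<Phi> "\<lambda>x. 0" "\<lambda>x. 0"] by simp

lemma tensorial_diff: "tensorial \<Phi> \<Longrightarrow> X \<in> VF \<Longrightarrow> Y \<in> VF \<Longrightarrow> \<Phi> (\<lambda>x. X x - Y x) x = \<Phi> X x - \<Phi> Y x"
  using tensorial_add[of \<Phi> X "\<lambda>x. (- 1) *\<^sub>R Y x" x] tensorial_scale[of \<Phi> "\<lambda>x. - 1" Y x] VF_minus[of Y] by simp

lemma tensorial_sum:
  "tensorial \<Phi> \<Longrightarrow> (\<And>i. i \<in> I \<Longrightarrow> X i \<in> VF) \<Longrightarrow> \<Phi> (\<lambda>x. \<Sum>i\<in>I. X i x) x = (\<Sum>i\<in>I. \<Phi> (X i) x)"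
proof (induction I rule: infinite_finite_induct)
  case (insert i I)
  then show ?case
    using tensorial_add[of \<Phi> "X i" "\<lambda>x. \<Sum>i\<in>I. X i x" x] VF_sum[of I X] by simp
qed (auto simp: tensorial_0)

text \<open>In the expansion of \<open>frame\<close> every coefficient vanishes at \<open>x\<close>:
  \<open>1 - f * f\<close> because \<open>f x = 1\<close>, and the \<open>g b\<close> because
  \<open>X x = 0\<close>. The remainder with \<open>1 - f * f\<close> is what turns a local
  expansion into an identity of global fields.\<close>

lemma tensorial_vanish:
  assumes \<Phi>: "tensorial \<Phi>" and X: "X \<in> VF" and 0: "X x = 0" shows "\<Phi> X x = 0"
proof -
  obtain f E where f: "SF f" "f x = 1" and E: "\<And>v. E v \<in> VF"
    and dec: "\<And>X. X \<in> VF \<Longrightarrow> \<exists>g. (\<forall>b. SF (g b)) \<and>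
        (\<forall>b. \<forall>y\<in>cdom (chart_at A x). g b y = f y * (vf_rep A (chart_at A x) X (cmap (chart_at A x) y) \<bullet> b)) \<and>
        X = (\<lambda>y. (1 - f y * f y) *\<^sub>R X y + (\<Sum>b\<in>Basis. g b y *\<^sub>R E b y))"
    by (rule frame[OF chart_at, of x]) blast
  obtain g where gS: "\<forall>b. SF (g b)"
    and g0: "\<forall>b. \<forall>y\<in>cdom (chart_at A x). g b y = f y * (vf_rep A (chart_at A x) X (cmap (chart_at A x) y) \<bullet> b)"
    and X': "X = (\<lambda>y. (1 - f y * f y) *\<^sub>R X y + (\<Sum>b\<in>Basis. g b y *\<^sub>R E b y))"
    using dec[OF X] by blast
  have g: "SF (g b)" "g b x = 0" for b
    using gS g0[rule_format, OF chart_at(2), of b] 0 by simp_all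
  have s: "SF (\<lambda>y. 1 - f y * f y)" by (intro SF_diff SF_mult SF_const f)
  have gE: "(\<lambda>y. g b y *\<^sub>R E b y) \<in> VF" for b by (rule VF_scale[OF g(1) E])
  have "\<Phi> X x = \<Phi> (\<lambda>y. (1 - f y * f y) *\<^sub>R X y + (\<Sum>b\<in>Basis. g b y *\<^sub>R E b y)) x"
    using X' by simp
  also have "\<dots> = \<Phi> (\<lambda>y. (1 - f y * f y) *\<^sub>R X y) x + (\<Sum>b\<in>Basis. \<Phi> (\<lambda>y. g b y *\<^sub>R E b y) x)"
    by (subst tensorial_add[OF \<Phi> VF_scale[OF s X] VF_sum[OF gE]], subst tensorial_sum[OF \<Phi> gE]) (rule refl)
  also have "\<dots> = 0"
    by (subst tensorial_scale[OF \<Phi> s X], subst tensorial_scale[OF \<Phi> g(1) E]) (simp add: f g)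
  finally show ?thesis .
qed

lemma tensorial_cong:
  assumes "tensorial \<Phi>" "X \<in> VF" "Y \<in> VF" "X x = Y x" shows "\<Phi> X x = \<Phi> Y x"
  using tensorial_vanish[OF assms(1) VF_diff[OF assms(2,3)], of x] tensorial_diff[OF assms(1-3)] assms(4) by simp

lemma extension_exists: "\<exists>X\<in>VF. X x = v"
proof -
  obtain f E where "f x = 1" "\<And>v. E v \<in> VF"
    "\<And>v y. y \<in> cdom (chart_at A x) \<Longrightarrow> E v y = f y *\<^sub>R from_coords A (chart_at A x) (cmap (chart_at A x) y) v"
    by (rule frame[OF chart_at, of x]) blast
  then show ?thesis using chart_at(2)[of x] by (intro bexI[of _ "E v"]) simp_all
qed

text \<open>Converts a tensorial map into a map of tangent vectors at \<open>x\<close>; by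
  \<open>tensorial_cong\<close> the choice is then immaterial.\<close>

definition extend :: "'m \<Rightarrow> 'a \<Rightarrow> 'm \<Rightarrow> 'a" where
  "extend x v = (SOME X. X \<in> VF \<and> X x = v)"

lemma extend [simp]: "extend x v \<in> VF" "extend x v x = v"
  unfolding extend_def using someI_ex[of "\<lambda>X. X \<in> VF \<and> X x = v"] extension_exists[of x v] by auto

lemma tensorial_extend: "tensorial \<Phi> \<Longrightarrow> X \<in> VF \<Longrightarrow> \<Phi> (extend x (X x)) x = \<Phi> X x"
  by (rule tensorial_cong) simp_all

lemma linear_tensorial:
  assumes \<Phi>: "tensorial \<Phi>" shows "linear (\<lambda>v. \<Phi> (extend x v) x)"
proof (rule linearI)
  fix u v :: 'a and r :: real
  have "\<Phi> (extend x (u + v)) x = \<Phi> (\<lambda>y. extend x u y + extend x v y) x"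
    by (rule tensorial_cong[OF \<Phi>]) (simp_all add: VF_add)
  then show "\<Phi> (extend x (u + v)) x = \<Phi> (extend x u) x + \<Phi> (extend x v) x"
    by (simp add: tensorial_add[OF \<Phi>])
  have "\<Phi> (extend x (r *\<^sub>R v)) x = \<Phi> (\<lambda>y. r *\<^sub>R extend x v y) x"
    by (rule tensorial_cong[OF \<Phi>]) (simp_all add: VF_scale)
  then show "\<Phi> (extend x (r *\<^sub>R v)) x = r *\<^sub>R \<Phi> (extend x v) x"
    using tensorial_scale[OF \<Phi>, of "\<lambda>y. r"] by simp
qed

text \<open>Replaces the definite description by a formula: every tangent vector is the value of a
  global field, so the values on fields determine the endomorphism.\<close>

lemma endo_at_tensorial:
  assumes \<Phi>: "tensorial \<Phi>" shows "endo_at A \<Phi> x = (\<lambda>v. \<Phi> (extend x v) x)"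
  unfolding endo_at_def
proof (rule the_equality)
  show "linear (\<lambda>v. \<Phi> (extend x v) x) \<and> (\<forall>X\<in>VF. \<Phi> (extend x (X x)) x = \<Phi> X x)"
    using linear_tensorial[OF \<Phi>] tensorial_extend[OF \<Phi>] by blast
  fix L assume "linear L \<and> (\<forall>X\<in>VF. L (X x) = \<Phi> X x)"
  then have "L (extend x v x) = \<Phi> (extend x v) x" for v using extend(1) by blast
  then show "L = (\<lambda>v. \<Phi> (extend x v) x)" by auto
qed

lemma nonzero_neighbourhood:
  assumes f: "SF f" and c: "c \<in> A" "x \<in> cdom c" and fx: "f x \<noteq> 0"
  obtains U where "open U" "cmap c x \<in> U" "U \<subseteq> ccod c" "\<And>p. p \<in> U \<Longrightarrow> f (cinv c p) \<noteq> 0"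
proof -
  have "continuous_on (ccod c) (\<lambda>p. f (cinv c p))"
    using SF_smooth[OF f c(1)] unfolding smooth_on_def by (metis Ck_on.simps(1))
  from continuous_open_preimage[OF this open_ccod[OF c(1)] open_Compl[OF closed_singleton, of 0]]
  have "open (ccod c \<inter> (\<lambda>p. f (cinv c p)) -` (- {0}))" .
  then show thesis using c fx by (intro that[of "ccod c \<inter> (\<lambda>p. f (cinv c p)) -` (- {0})"]) auto
qed

text \<open>The basis behind \<open>endo_trace\<close> jumps with the point. Near \<open>x\<close>
  the trace is therefore computed in one chart with the frame \<open>E b\<close>, and the cutoff
  hidden in \<open>E b\<close> is divided out where it is nonzero.\<close>

lemma SF_endo_trace:
  assumes \<Phi>: "tensorial \<Phi>" and V: "\<And>X. X \<in> VF \<Longrightarrow> \<Phi> X \<in> VF"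
  shows "SF (\<lambda>x. endo_trace (endo_at A \<Phi> x))"
proof (rule smooth_funI)
  fix x
  let ?c = "chart_at A x" let ?t = "\<lambda>x. endo_trace (endo_at A \<Phi> x)"
  have c: "?c \<in> A" "x \<in> cdom ?c" by (rule chart_at)+
  obtain f E where f: "SF f" "f x = 1" and E: "\<And>v. E v \<in> VF"
    "\<And>v y. y \<in> cdom ?c \<Longrightarrow> E v y = f y *\<^sub>R from_coords A ?c (cmap ?c y) v"
    by (rule frame[OF c]) blast
  obtain U where U: "open U" "cmap ?c x \<in> U" "U \<subseteq> ccod ?c" "\<And>p. p \<in> U \<Longrightarrow> f (cinv ?c p) \<noteq> 0"
    using nonzero_neighbourhood[OF f(1) c] f(2) by auto
  have eq: "inverse (f (cinv ?c p)) * (\<Sum>b\<in>Basis. vf_rep A ?c (\<Phi> (E b)) p \<bullet> b) = ?t (cinv ?c p)" if "p \<in> U" for p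
  proof -
    let ?y = "cinv ?c p" let ?L = "\<lambda>v. \<Phi> (extend ?y v) ?y"
    have p: "p \<in> ccod ?c" using U(3) that by blast
    have y: "?y \<in> cdom ?c" "cmap ?c ?y = p" using cinv_cdom[OF c(1) p] cmap_cinv[OF c(1) p] .
    have "to_coords A ?c ?y (?L (from_coords A ?c p b)) = inverse (f ?y) *\<^sub>R vf_rep A ?c (\<Phi> (E b)) p" for b
    proof -
      have "\<Phi> (E b) ?y = ?L (f ?y *\<^sub>R from_coords A ?c p b)"
        using tensorial_extend[OF \<Phi> E(1), of ?y b] E(2)[OF y(1), of b] y(2) by simp
      also have "\<dots> = f ?y *\<^sub>R ?L (from_coords A ?c p b)" by (rule linear_cmul[OF linear_tensorial[OF \<Phi>]])
      finally have "?L (from_coords A ?c p b) = inverse (f ?y) *\<^sub>R \<Phi> (E b) ?y" using U(4)[OF that] by simp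
      then show ?thesis using linear_cmul[OF linear_to_coords[OF c(1) y(1)]] by (simp add: vf_rep_def)
    qed
    then have "inverse (f ?y) * (\<Sum>b\<in>Basis. vf_rep A ?c (\<Phi> (E b)) p \<bullet> b)
        = endo_trace (\<lambda>v. to_coords A ?c ?y (?L (from_coords A ?c p v)))"
      by (simp add: endo_trace_def sum_distrib_left)
    also have "\<dots> = endo_trace ?L"
      by (rule endo_trace_conjugate[OF linear_to_coords[OF c(1) y(1)] linear_from_coords[OF c(1) p] linear_tensorial[OF \<Phi>]])
         (use from_coords_to_coords[OF c(1) y(1)] y(2) in simp)
    finally show ?thesis by (simp add: endo_at_tensorial[OF \<Phi>])
  qed
  have "smooth_on U (\<lambda>p. inverse (f (cinv ?c p)) * (\<Sum>b\<in>Basis. vf_rep A ?c (\<Phi> (E b)) p \<bullet> b))"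
    by (intro smooth_on_mult smooth_on_inverse smooth_on_sum smooth_on_inner smooth_on_const U(1,4)
        smooth_on_subset[OF SF_smooth[OF f(1) c(1)] U(3)] smooth_on_subset[OF VF_smooth[OF V[OF E(1)] c(1)] U(3)])
  then have "smooth_on U (?t \<circ> cinv ?c)"
    by (rule smooth_on_cong[OF U(1), rotated]) (simp add: eq)
  then show "\<exists>c\<in>A. x \<in> cdom c \<and> (\<exists>U. open U \<and> cmap c x \<in> U \<and> U \<subseteq> ccod c \<and> smooth_on U (?t \<circ> cinv c))"
    using c U by blast
qed

text \<open>Pointwise, an injective map between spaces of equal dimension is onto; smoothness of the
  representing field is \<open>smooth_on_linear_solve\<close> for its components. The form is a
  general bilinear one because it will be a sum of an alternating and a symmetric form.\<close>

lemma musical_isomorphism: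
  fixes B :: "'m \<Rightarrow> 'a \<Rightarrow> 'a \<Rightarrow> real"
  assumes lin: "\<And>x v. linear (\<lambda>u. B x u v)" "\<And>x u. linear (B x u)"
    and nondeg: "\<And>x u. (\<And>v. B x u v = 0) \<Longrightarrow> u = 0"
    and SB: "\<And>X Y. X \<in> VF \<Longrightarrow> Y \<in> VF \<Longrightarrow> SF (\<lambda>x. B x (X x) (Y x))"
    and \<phi>: "tensorial \<phi>" and S\<phi>: "\<And>X. X \<in> VF \<Longrightarrow> SF (\<phi> X)"
  shows "\<exists>W\<in>VF. \<forall>Z\<in>VF. \<forall>x. B x (W x) (Z x) = \<phi> Z x"
proof -
  have "\<exists>w. \<forall>v. B x w v = \<phi> (extend x v) x" for x
  proof -
    define M where "M w = (\<Sum>b\<in>Basis. B x w b *\<^sub>R b)" for w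
    have lM: "linear M"
      by (rule linearI) (simp_all add: M_def linear_add[OF lin(1)] linear_cmul[OF lin(1)] algebra_simps sum.distrib scaleR_sum_right)
    have Mb: "M w \<bullet> b = B x w b" if "b \<in> Basis" for w b
      using that by (simp add: M_def inner_sum_left inner_Basis if_distrib cong: if_cong)
    have det: "(\<forall>v. B x w v = \<psi> v)" if "\<And>b. b \<in> Basis \<Longrightarrow> B x w b = \<psi> b" "linear \<psi>" for w and \<psi> :: "'a \<Rightarrow> real"
    proof
      fix v
      have "B x w v = (\<Sum>b\<in>Basis. (v \<bullet> b) *\<^sub>R B x w b)" by (rule linear_euclidean_sum[OF lin(2)])
      also have "\<dots> = (\<Sum>b\<in>Basis. (v \<bullet> b) *\<^sub>R \<psi> b)" using that(1) by simp
      also have "\<dots> = \<psi> v" by (rule linear_euclidean_sum[OF that(2), symmetric])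
      finally show "B x w v = \<psi> v" .
    qed
    have "w = 0" if "M w = 0" for w
    proof -
      have "B x w b = 0" if "b \<in> Basis" for b using Mb[OF that, of w] \<open>M w = 0\<close> by simp
      then show ?thesis using det[of w "\<lambda>v. 0"] linear_zero nondeg by blast
    qed
    then have "inj M" unfolding linear_injective_0[OF lM] by blast
    then have "surj M" by (rule linear_inj_imp_surj[OF lM])
    then obtain w where w: "M w = (\<Sum>b\<in>Basis. \<phi> (extend x b) x *\<^sub>R b)" by (metis surjD)
    have "B x w b = \<phi> (extend x b) x" if "b \<in> Basis" for b
      using Mb[OF that, of w] w that by (simp add: inner_sum_left inner_Basis if_distrib cong: if_cong)
    then have "\<forall>v. B x w v = \<phi> (extend x v) x" by (rule det[OF _ linear_tensorial[OF \<phi>]])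
    then show ?thesis by blast
  qed
  then obtain W where W: "\<And>x v. B x (W x) v = \<phi> (extend x v) x" by metis
  have WZ: "B x (W x) (Z x) = \<phi> Z x" if "Z \<in> VF" for Z x
    using W[of x "Z x"] tensorial_extend[OF \<phi> that] by simp
  have "W \<in> VF"
  proof (rule vector_fieldI)
    fix x
    let ?c = "chart_at A x"
    have c: "?c \<in> A" "x \<in> cdom ?c" by (rule chart_at)+
    obtain f E where f: "SF f" "f x = 1" and E: "\<And>v. E v \<in> VF"
      "\<And>v y. y \<in> cdom ?c \<Longrightarrow> E v y = f y *\<^sub>R from_coords A ?c (cmap ?c y) v"
      by (rule frame[OF c]) blast
    obtain U where U: "open U" "cmap ?c x \<in> U" "U \<subseteq> ccod ?c" "\<And>p. p \<in> U \<Longrightarrow> f (cinv ?c p) \<noteq> 0"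
      using nonzero_neighbourhood[OF f(1) c] f(2) by auto
    \<comment> \<open>The Gram matrix of \<open>B\<close> in the coordinate frame; its injectivity
      is the nondegeneracy of \<open>B\<close>.\<close>
    define M where "M p w = (\<Sum>b\<in>Basis. B (cinv ?c p) (from_coords A ?c p w) (from_coords A ?c p b) *\<^sub>R b)" for p w
    define r where "r p = (\<Sum>b\<in>Basis. (inverse (f (cinv ?c p)) * \<phi> (E b) (cinv ?c p)) *\<^sub>R b)" for p
    have p: "p \<in> ccod ?c" "cinv ?c p \<in> cdom ?c" "cmap ?c (cinv ?c p) = p" if "p \<in> U" for p
      using cinv_cdom[OF c(1)] cmap_cinv[OF c(1)] U(3) that by auto
    have fc: "from_coords A ?c p v = inverse (f (cinv ?c p)) *\<^sub>R E v (cinv ?c p)" if "p \<in> U" for p v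
      using E(2)[OF p(2)[OF that], of v] U(4)[OF that] p(3)[OF that] by simp
    have "smooth_on U (vf_rep A ?c W)"
    proof (rule smooth_on_linear_solve[OF U(1), of M])
      fix q assume q: "q \<in> U"
      show "linear (M q)"
        by (rule linearI) (simp_all add: M_def linear_add[OF lin(1)] linear_cmul[OF lin(1)] algebra_simps sum.distrib scaleR_sum_right
          linear_add[OF linear_from_coords[OF c(1) p(1)[OF q]]] linear_cmul[OF linear_from_coords[OF c(1) p(1)[OF q]]])
      show "M q (vf_rep A ?c W q) = r q"
      proof -
        have "from_coords A ?c q (vf_rep A ?c W q) = W (cinv ?c q)"
          using from_coords_vf_rep[OF c(1) p(2)[OF q], of W] p(3)[OF q] by simp
        moreover have "B (cinv ?c q) (W (cinv ?c q)) (from_coords A ?c q b) = inverse (f (cinv ?c q)) * \<phi> (E b) (cinv ?c q)" for b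
          using WZ[OF E(1), of "cinv ?c q" b] linear_cmul[OF lin(2)] by (simp add: fc[OF q])
        ultimately show ?thesis by (simp add: M_def r_def)
      qed
    next
      fix q v assume q: "q \<in> U" and Mv: "M q v = 0"
      have "M q v \<bullet> b = B (cinv ?c q) (from_coords A ?c q v) (from_coords A ?c q b)" if "b \<in> Basis" for b
        using that by (simp add: M_def inner_sum_left inner_Basis if_distrib cong: if_cong)
      then have "B (cinv ?c q) (from_coords A ?c q v) (from_coords A ?c q b) = 0" if "b \<in> Basis" for b
        using that Mv by simp
      then have "B (cinv ?c q) (from_coords A ?c q v) (from_coords A ?c q u) = 0" for u
        using linear_euclidean_sum[OF linear_compose[OF linear_from_coords[OF c(1) p(1)[OF q]] lin(2)], of "cinv ?c q" "from_coords A ?c q v" u]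
        by simp
      then have "B (cinv ?c q) (from_coords A ?c q v) u = 0" for u
        using from_coords_to_coords[OF c(1) p(2)[OF q], of u] p(3)[OF q] by metis
      then have "from_coords A ?c q v = 0" using nondeg by blast
      then show "v = 0"
        using to_coords_from_coords[OF c(1) p(1)[OF q], of v] linear_0[OF linear_to_coords[OF c(1) p(2)[OF q]]] by simp
    next
      fix v
      have "smooth_on U (\<lambda>p. \<Sum>b\<in>Basis. (inverse (f (cinv ?c p)) * inverse (f (cinv ?c p)) * B (cinv ?c p) (E v (cinv ?c p)) (E b (cinv ?c p))) *\<^sub>R b)"
        by (intro smooth_on_sum smooth_on_scaleR smooth_on_mult smooth_on_inverse smooth_on_const U(1,4)
          smooth_on_subset[OF SF_smooth[OF f(1) c(1)] U(3)] smooth_on_subset[OF SF_smooth[OF SB[OF E(1) E(1)] c(1)] U(3)])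
      then show "smooth_on U (\<lambda>p. M p v)"
        by (rule smooth_on_cong[OF U(1), rotated])
           (simp add: M_def fc linear_cmul[OF lin(1)] linear_cmul[OF lin(2)] mult.assoc)
    next
      show "smooth_on U r"
        unfolding r_def[abs_def]
        by (intro smooth_on_sum smooth_on_scaleR smooth_on_mult smooth_on_inverse smooth_on_const U(1,4)
          smooth_on_subset[OF SF_smooth[OF f(1) c(1)] U(3)] smooth_on_subset[OF SF_smooth[OF S\<phi>[OF E(1)] c(1)] U(3)])
    qed
    then show "\<exists>c\<in>A. x \<in> cdom c \<and> (\<exists>U. open U \<and> cmap c x \<in> U \<and> U \<subseteq> ccod c \<and> smooth_on U (vf_rep A c W))"
      using c U by blast
  qed
  then show ?thesis using WZ by blast
qed

end

section \<open>Existence of the connection\<close>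

context smooth_manifold
begin

lemma vf_apply_minus: "SF f \<Longrightarrow> vf_apply A X (\<lambda>x. - f x) x = - vf_apply A X f x"
  using vf_apply_diff[of "\<lambda>x. 0" f X x] by simp

lemma lie_bracket_self [simp]: "lie_bracket A X X x = 0"
  by (simp add: lie_bracket_def)

text \<open>Pointwise laws without extensionality, so that connections may be given by formulas;
  \<open>affine_connection_restrict\<close> returns to the extensional object.\<close>

definition connection_laws :: "(('m \<Rightarrow> 'a) \<Rightarrow> ('m \<Rightarrow> 'a) \<Rightarrow> 'm \<Rightarrow> 'a) \<Rightarrow> bool" where
  "connection_laws D \<longleftrightarrow>
     (\<forall>X\<in>VF. \<forall>Y\<in>VF. D X Y \<in> VF) \<and>
     (\<forall>X\<in>VF. \<forall>Y\<in>VF. \<forall>Z\<in>VF. \<forall>x. D (\<lambda>x. X x + Y x) Z x = D X Z x + D Y Z x \<and>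
        D X (\<lambda>x. Y x + Z x) x = D X Y x + D X Z x) \<and>
     (\<forall>f X Y x. SF f \<longrightarrow> X \<in> VF \<longrightarrow> Y \<in> VF \<longrightarrow>
        D (\<lambda>x. f x *\<^sub>R X x) Y x = f x *\<^sub>R D X Y x \<and>
        D X (\<lambda>x. f x *\<^sub>R Y x) x = vf_apply A X f x *\<^sub>R Y x + f x *\<^sub>R D X Y x)"

lemma affine_connection_laws:
  assumes "affine_connection A D" shows "connection_laws D"
  unfolding connection_laws_def
proof (intro conjI ballI allI impI)
  have *: "D \<in> VF \<rightarrow>\<^sub>E (VF \<rightarrow>\<^sub>E VF)" using assms unfolding affine_connection_def by (rule conjunct1)
  show "D X Y \<in> VF" if "X \<in> VF" "Y \<in> VF" for X Y
    by (rule PiE_mem[OF PiE_mem[OF * that(1)] that(2)])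
qed (use assms in \<open>simp_all add: affine_connection_def\<close>)

lemma affine_connection_restrict:
  assumes "connection_laws D" shows "affine_connection A (\<lambda>X\<in>VF. \<lambda>Y\<in>VF. D X Y)"
  using assms unfolding affine_connection_def connection_laws_def
  by (auto simp: VF_add VF_scale)

lemma
  assumes D: "connection_laws D" and X: "X \<in> VF" and Y: "Y \<in> VF"
  shows VF_connection: "D X Y \<in> VF"
    and connection_add1: "Z \<in> VF \<Longrightarrow> D (\<lambda>x. X x + Y x) Z x = D X Z x + D Y Z x"
    and connection_add2: "Z \<in> VF \<Longrightarrow> D X (\<lambda>x. Y x + Z x) x = D X Y x + D X Z x"
    and connection_scale1: "SF f \<Longrightarrow> D (\<lambda>x. f x *\<^sub>R X x) Y x = f x *\<^sub>R D X Y x"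
    and connection_scale2: "SF f \<Longrightarrow> D X (\<lambda>x. f x *\<^sub>R Y x) x = vf_apply A X f x *\<^sub>R Y x + f x *\<^sub>R D X Y x"
  using assms by (simp_all add: connection_laws_def)

lemma tensorial_connection:
  assumes D: "connection_laws D" and Y: "Y \<in> VF" shows "tensorial (\<lambda>X. D X Y)"
  by (rule tensorialI) (simp_all add: connection_add1[OF D] connection_scale1[OF D] Y)

lemma connection_0: "connection_laws D \<Longrightarrow> X \<in> VF \<Longrightarrow> D X (\<lambda>x. 0) x = 0" "connection_laws D \<Longrightarrow> X \<in> VF \<Longrightarrow> D (\<lambda>x. 0) X x = 0"
  using connection_scale2[of D X "\<lambda>x. 0" "\<lambda>x. 0" x] connection_scale1[of D "\<lambda>x. 0" X "\<lambda>x. 0" x] by simp_all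

lemma torsion_swap: "torsion A D Y X x = - torsion A D X Y x"
  by (simp add: torsion_def lie_bracket_swap[of X Y])

text \<open>The derivative of \<open>f\<close> produced by \<open>D Y\<close> is the one produced by
  the bracket, so it cancels.\<close>

lemma tensorial_torsion:
  assumes D: "connection_laws D" and Y: "Y \<in> VF" shows "tensorial (torsion A D Y)"
proof (rule tensorialI)
  fix X Z x assume "X \<in> VF" "Z \<in> VF"
  then show "torsion A D Y (\<lambda>x. X x + Z x) x = torsion A D Y X x + torsion A D Y Z x"
    using Y by (simp add: torsion_def connection_add1[OF D] connection_add2[OF D] lie_bracket_add)
next
  fix f X x assume "SF f" "X \<in> VF"
  then show "torsion A D Y (\<lambda>x. f x *\<^sub>R X x) x = f x *\<^sub>R torsion A D Y X x"
    using Y by (simp add: torsion_def connection_scale1[OF D] connection_scale2[OF D] lie_bracket_scale algebra_simps)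
qed

lemma VF_torsion:
  assumes D: "connection_laws D" and X: "X \<in> VF" and Y: "Y \<in> VF" shows "torsion A D X Y \<in> VF"
  unfolding torsion_def[abs_def]
  by (rule VF_diff[OF VF_diff[OF VF_connection[OF D X Y] VF_connection[OF D Y X]] VF_lie_bracket[OF X Y]])

text \<open>Makes the torsion trace a covector field, so that \<open>sharp\<close> can represent it.
  Linearity in the first slot of the torsion comes from \<open>torsion_swap\<close>.\<close>

lemma tensorial_torsion_trace:
  assumes D: "connection_laws D" shows "tensorial (\<lambda>Y x. endo_trace (endo_at A (torsion A D Y) x))"
proof (rule tensorialI)
  fix X Y x assume X: "X \<in> VF" and Y: "Y \<in> VF"
  have "torsion A D (\<lambda>x. X x + Y x) Z x = torsion A D X Z x + torsion A D Y Z x" if "Z \<in> VF" for Z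
    using tensorial_add[OF tensorial_torsion[OF D that] X Y, of x] by (simp add: torsion_swap[of D _ Z])
  then show "endo_trace (endo_at A (torsion A D (\<lambda>x. X x + Y x)) x) =
      endo_trace (endo_at A (torsion A D X) x) + endo_trace (endo_at A (torsion A D Y) x)"
    by (simp add: endo_at_tensorial tensorial_torsion D X Y VF_add endo_trace_add)
next
  fix f X x assume f: "SF f" and X: "X \<in> VF"
  have "torsion A D (\<lambda>x. f x *\<^sub>R X x) Z x = f x *\<^sub>R torsion A D X Z x" if "Z \<in> VF" for Z
    using tensorial_scale[OF tensorial_torsion[OF D that] f X, of x] by (simp add: torsion_swap[of D _ Z])
  then show "endo_trace (endo_at A (torsion A D (\<lambda>x. f x *\<^sub>R X x)) x) = f x *\<^sub>R endo_trace (endo_at A (torsion A D X) x)"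
    by (simp add: endo_at_tensorial tensorial_torsion D f X VF_scale endo_trace_scale)
qed

end

section \<open>Contact forms, the Reeb field and the horizontal projection\<close>

locale contact_form = manifold_form A \<theta> for A :: "('m::t2_space, 'a::euclidean_space) chart set" and \<theta> +
  assumes nonzero: "\<exists>v. \<theta> x v \<noteq> 0"
    and nondegenerate: "\<theta> x u = 0 \<Longrightarrow> (\<And>v. \<theta> x v = 0 \<Longrightarrow> ext_deriv A \<theta> x u v = 0) \<Longrightarrow> u = 0"
begin

abbreviation \<Omega> where "\<Omega> \<equiv> ext_deriv A \<theta>"

definition B where "B x u v = \<Omega> x u v + \<theta> x u * \<theta> x v"

lemmas \<theta>_simps = linear_add[OF linear_form] linear_diff[OF linear_form] linear_cmul[OF linear_form]
  linear_0[OF linear_form] linear_neg[OF linear_form]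
lemmas \<Omega>_simps =
  linear_add[OF linear_ext_deriv(1)] linear_diff[OF linear_ext_deriv(1)] linear_cmul[OF linear_ext_deriv(1)]
  linear_0[OF linear_ext_deriv(1)] linear_neg[OF linear_ext_deriv(1)]
  linear_add[OF linear_ext_deriv(2)] linear_diff[OF linear_ext_deriv(2)] linear_cmul[OF linear_ext_deriv(2)]
  linear_0[OF linear_ext_deriv(2)] linear_neg[OF linear_ext_deriv(2)]

lemma linear_B: "linear (\<lambda>u. B x u v)" "linear (B x u)"
  by (rule linearI; simp add: B_def \<theta>_simps \<Omega>_simps algebra_simps)+

text \<open>Pairing \<open>u\<close> with itself leaves the square of \<open>\<theta> x u\<close>,
  since \<Omega> is alternating; so \<open>u\<close> is horizontal, and nondegeneracy on the kernel
  applies.\<close>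

lemma B_nondegenerate: assumes "\<And>v. B x u v = 0" shows "u = 0"
proof -
  have "\<theta> x u = 0" using assms[of u] by (simp add: B_def)
  then show ?thesis using assms nondegenerate[of x u] by (simp add: B_def)
qed

lemma SF_B: "X \<in> VF \<Longrightarrow> Y \<in> VF \<Longrightarrow> SF (\<lambda>x. B x (X x) (Y x))"
  unfolding B_def by (intro SF_add SF_mult SF_ext_deriv SF_form)

text \<open>The representing field stands in the first slot, which matters because \<open>B\<close>
  is not symmetric.\<close>

definition sharp where "sharp \<phi> = (SOME W. W \<in> VF \<and> (\<forall>Z\<in>VF. \<forall>x. B x (W x) (Z x) = \<phi> Z x))"

lemma
  assumes "tensorial \<phi>" "\<And>X. X \<in> VF \<Longrightarrow> SF (\<phi> X)"
  shows VF_sharp: "sharp \<phi> \<in> VF" and B_sharp: "Z \<in> VF \<Longrightarrow> B x (sharp \<phi> x) (Z x) = \<phi> Z x"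
proof -
  have "\<exists>W\<in>VF. \<forall>Z\<in>VF. \<forall>x. B x (W x) (Z x) = \<phi> Z x"
  proof (rule musical_isomorphism)
    fix x u assume "\<And>v. B x u v = 0"
    then show "u = 0" by (rule B_nondegenerate)
  qed (simp_all add: linear_B SF_B assms)
  then have "\<exists>W. W \<in> VF \<and> (\<forall>Z\<in>VF. \<forall>x. B x (W x) (Z x) = \<phi> Z x)" by blast
  then have "sharp \<phi> \<in> VF \<and> (\<forall>Z\<in>VF. \<forall>x. B x (sharp \<phi> x) (Z x) = \<phi> Z x)"
    unfolding sharp_def by (rule someI_ex)
  then show "sharp \<phi> \<in> VF" "Z \<in> VF \<Longrightarrow> B x (sharp \<phi> x) (Z x) = \<phi> Z x" by auto
qed

lemma B_cancel:
  assumes "\<And>Z. Z \<in> VF \<Longrightarrow> B x u (Z x) = B x v (Z x)" shows "u = v"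
proof -
  have "B x u w = B x v w" for w using assms[of "extend x w"] by simp
  then have "B x (u - v) w = 0" for w by (simp add: linear_diff[OF linear_B(1)])
  then show ?thesis using B_nondegenerate[of x "u - v"] by simp
qed

abbreviation T where "T \<equiv> reeb A \<theta>"

text \<open>The Reeb field is the representative \<open>W\<close> of \<theta> under
  \<open>B\<close>. Pairing \<open>W\<close> with itself gives
  \<open>\<theta>(W) = \<theta>(W)^2\<close>; the root 0 would make \<open>W\<close> a horizontal
  null vector of \<Omega> on the kernel, hence zero, and then \<theta> would vanish. Smoothness
  comes with the representation.\<close>

lemma reeb: "T \<in> VF" "\<theta> x (T x) = 1" "\<Omega> x (T x) v = 0"
proof -
  define W where "W = sharp (\<lambda>Z x. \<theta> x (Z x))"
  have t: "tensorial (\<lambda>Z x. \<theta> x (Z x))" by (rule tensorialI) (simp_all add: \<theta>_simps)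
  have W: "W \<in> VF" unfolding W_def by (rule VF_sharp[OF t SF_form])
  have BW: "B x (W x) v = \<theta> x v" for x v
    using B_sharp[OF t SF_form extend(1), of x x v] by (simp add: W_def)
  have W1: "\<theta> x (W x) = 1" for x
  proof -
    have "\<theta> x (W x) * \<theta> x (W x) = \<theta> x (W x)" using BW[of x "W x"] by (simp add: B_def)
    moreover have "\<theta> x (W x) \<noteq> 0"
    proof
      assume 0: "\<theta> x (W x) = 0"
      then have "\<Omega> x (W x) v = \<theta> x v" for v using BW[of x v] by (simp add: B_def)
      then have "W x = 0" using nondegenerate[OF 0] by simp
      then have "\<theta> x v = 0" for v using BW[of x v] linear_0[OF linear_B(1)] by simp
      then show False using nonzero by blast
    qed
    ultimately show ?thesis by simp
  qed
  have W0: "\<Omega> x (W x) v = 0" for x v using BW[of x v] W1[of x] by (simp add: B_def)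
  have "T x = W x" for x
    unfolding reeb_def
  proof (rule the_equality)
    fix v assume v: "\<theta> x v = 1 \<and> (\<forall>w. \<Omega> x v w = 0)"
    show "v = W x" by (rule B_cancel[of x]) (simp add: B_def v W1 W0)
  qed (simp add: W1 W0)
  then have "T = W" by auto
  then show "T \<in> VF" "\<theta> x (T x) = 1" "\<Omega> x (T x) v = 0" using W W1 W0 by auto
qed

lemma \<Omega>_T [simp]: "\<Omega> x (T x) v = 0" "\<Omega> x v (T x) = 0" and \<theta>_T [simp]: "\<theta> x (T x) = 1"
  using reeb ext_deriv_swap[of x v "T x"] by auto

definition pr where "pr x v = v - \<theta> x v *\<^sub>R T x"

definition hor where "hor X = (\<lambda>x. pr x (X x))"

lemma linear_pr: "linear (pr x)"
  by (rule linearI) (simp_all add: pr_def \<theta>_simps algebra_simps)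

lemma \<theta>_pr [simp]: "\<theta> x (pr x v) = 0"
  by (simp add: pr_def \<theta>_simps)

lemma \<Omega>_pr [simp]: "\<Omega> x (pr x u) v = \<Omega> x u v" "\<Omega> x u (pr x v) = \<Omega> x u v"
  by (simp_all add: pr_def \<Omega>_simps)

lemma pr_T [simp]: "pr x (T x) = 0" and pr_0 [simp]: "pr x 0 = 0"
  by (simp_all add: pr_def \<theta>_simps)

lemma pr_horizontal: "\<theta> x v = 0 \<Longrightarrow> pr x v = v"
  by (simp add: pr_def)

lemma VF_hor: "X \<in> VF \<Longrightarrow> hor X \<in> VF"
  unfolding hor_def pr_def by (intro VF_diff VF_scale SF_form reeb)

lemma hor_add: "hor (\<lambda>x. X x + Y x) = (\<lambda>x. hor X x + hor Y x)"
  and hor_scale: "hor (\<lambda>x. f x *\<^sub>R X x) = (\<lambda>x. f x *\<^sub>R hor X x)"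
  and hor_T: "hor T = (\<lambda>x. 0)"
  by (auto simp: hor_def linear_add[OF linear_pr] linear_cmul[OF linear_pr])

lemma \<theta>_hor [simp]: "\<theta> x (hor X x) = 0"
  and \<Omega>_hor [simp]: "\<Omega> x (hor X x) v = \<Omega> x (X x) v" "\<Omega> x v (hor X x) = \<Omega> x v (X x)"
  by (simp_all add: hor_def)

lemma vf_apply_hor:
  assumes f: "SF f" shows "vf_apply A (hor X) f x = vf_apply A X f x - \<theta> x (X x) * vf_apply A T f x"
  using vf_apply_vf_diff[OF f, of X "\<lambda>x. \<theta> x (X x) *\<^sub>R T x" x] vf_apply_vf_scale[OF f, of "\<lambda>x. \<theta> x (X x)" T x]
  by (simp add: hor_def pr_def)

text \<open>In Cartan's formula \<open>\<theta>(T)\<close> and \<open>\<theta>(hor Y)\<close> are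
  constant and \<open>i(T) d\<theta> = 0\<close>, so only the bracket term is left.\<close>

lemma \<theta>_lie_T_hor: "Y \<in> VF \<Longrightarrow> \<theta> x (lie_bracket A T (hor Y) x) = 0"
  using ext_deriv_formula[OF reeb(1) VF_hor, of Y x] by simp

lemma lie_T_hor:
  assumes X: "X \<in> VF"
  shows "lie_bracket A T X x = lie_bracket A T (hor X) x + vf_apply A T (\<lambda>x. \<theta> x (X x)) x *\<^sub>R T x"
proof -
  have "lie_bracket A T (\<lambda>x. hor X x + \<theta> x (X x) *\<^sub>R T x) x
      = lie_bracket A T (hor X) x + vf_apply A T (\<lambda>x. \<theta> x (X x)) x *\<^sub>R T x"
    using lie_bracket_add[OF reeb(1) VF_hor[OF X] VF_scale[OF SF_form[OF X] reeb(1)], of x]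
      lie_bracket_scale[OF reeb(1) reeb(1) SF_form[OF X], of x] by simp
  then show ?thesis by (simp add: hor_def pr_def)
qed

end

section \<open>Correction of a given connection\<close>

locale contact_connection = contact_form A \<theta> for A :: "('m::t2_space, 'a::euclidean_space) chart set" and \<theta> +
  fixes D :: "('m \<Rightarrow> 'a) \<Rightarrow> ('m \<Rightarrow> 'a) \<Rightarrow> 'm \<Rightarrow> 'a"
  assumes D: "connection_laws D"
begin

abbreviation E where "E \<equiv> cov_deriv2 A D \<Omega>"

lemma
  assumes X: "X \<in> VF" and Y: "Y \<in> VF" and Z: "Z \<in> VF"
  shows E_swap: "E X Z Y x = - E X Y Z x"
    and SF_E: "SF (E X Y Z)"
    and E_add1: "X' \<in> VF \<Longrightarrow> E (\<lambda>x. X x + X' x) Y Z x = E X Y Z x + E X' Y Z x"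
    and E_add3: "Z' \<in> VF \<Longrightarrow> E X Y (\<lambda>x. Z x + Z' x) x = E X Y Z x + E X Y Z' x"
    and E_scale1: "SF f \<Longrightarrow> E (\<lambda>x. f x *\<^sub>R X x) Y Z x = f x * E X Y Z x"
    and E_scale3: "SF f \<Longrightarrow> E X Y (\<lambda>x. f x *\<^sub>R Z x) x = f x * E X Y Z x"
proof -
  have S: "SF (\<lambda>x. \<Omega> x (Y x) (Z x))" by (rule SF_ext_deriv[OF Y Z])
  have "(\<lambda>x. \<Omega> x (Z x) (Y x)) = (\<lambda>x. - \<Omega> x (Y x) (Z x))" using ext_deriv_swap by blast
  then show "E X Z Y x = - E X Y Z x"
    using vf_apply_minus[OF S, of X x] ext_deriv_swap[of x "Z x"] ext_deriv_swap[of x "D X Z x" "Y x"]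
    by (simp add: cov_deriv2_def)
  show "SF (E X Y Z)"
    unfolding cov_deriv2_def[abs_def]
    by (intro SF_diff SF_vf_apply SF_ext_deriv VF_connection[OF D] X Y Z)
  show "E (\<lambda>x. X x + X' x) Y Z x = E X Y Z x + E X' Y Z x" if "X' \<in> VF"
    using that by (simp add: cov_deriv2_def vf_apply_vf_add[OF S] connection_add1[OF D] X Y Z \<Omega>_simps)
  show "E (\<lambda>x. f x *\<^sub>R X x) Y Z x = f x * E X Y Z x" if "SF f"
    using that by (simp add: cov_deriv2_def vf_apply_vf_scale[OF S] connection_scale1[OF D] X Y Z \<Omega>_simps algebra_simps)
  show "E X Y (\<lambda>x. Z x + Z' x) x = E X Y Z x + E X Y Z' x" if Z': "Z' \<in> VF"
    using vf_apply_add[OF S SF_ext_deriv[OF Y Z'], of X x] Z'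
    by (simp add: cov_deriv2_def connection_add2[OF D] X Y Z \<Omega>_simps)
  show "E X Y (\<lambda>x. f x *\<^sub>R Z x) x = f x * E X Y Z x" if f: "SF f"
    using vf_apply_mult[OF f S, of X x] f
    by (simp add: cov_deriv2_def connection_scale2[OF D] X Y Z \<Omega>_simps algebra_simps)
qed

lemma E_add2: "X \<in> VF \<Longrightarrow> Y \<in> VF \<Longrightarrow> Z \<in> VF \<Longrightarrow> Y' \<in> VF \<Longrightarrow> E X (\<lambda>x. Y x + Y' x) Z x = E X Y Z x + E X Y' Z x"
  using E_swap[of X Z "\<lambda>x. Y x + Y' x" x] E_swap[of X Z Y x] E_swap[of X Z Y' x] E_add3[of X Z Y Y' x]
  by (simp add: VF_add)

lemma E_scale2: "X \<in> VF \<Longrightarrow> Y \<in> VF \<Longrightarrow> Z \<in> VF \<Longrightarrow> SF f \<Longrightarrow> E X (\<lambda>x. f x *\<^sub>R Y x) Z x = f x * E X Y Z x"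
  using E_swap[of X Z "\<lambda>x. f x *\<^sub>R Y x" x] E_swap[of X Z Y x] E_scale3[of X Z Y f x]
  by (simp add: VF_scale)

text \<open>The solution, skew in the first two arguments, of
  \<open>skew X Y Z - skew X Z Y = E X Y Z\<close>, obtained by the permutation trick of the Koszul formula.\<close>

definition skew where "skew X Y Z x = (E X Y Z x + E Y Z X x - E Z X Y x) / 2"

lemma skew_swap: "X \<in> VF \<Longrightarrow> Y \<in> VF \<Longrightarrow> Z \<in> VF \<Longrightarrow> skew Y X Z x = - skew X Y Z x"
  using E_swap[of X Y Z x] E_swap[of Y Z X x] E_swap[of Z X Y x] by (simp add: skew_def field_simps)

lemma skew_diff: "X \<in> VF \<Longrightarrow> Y \<in> VF \<Longrightarrow> Z \<in> VF \<Longrightarrow> skew X Y Z x - skew X Z Y x = E X Y Z x"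
  using E_swap[of X Y Z x] E_swap[of Y Z X x] E_swap[of Z X Y x] by (simp add: skew_def field_simps)

lemma
  assumes X: "X \<in> VF" and Y: "Y \<in> VF" and Z: "Z \<in> VF"
  shows skew_add1: "X' \<in> VF \<Longrightarrow> skew (\<lambda>x. X x + X' x) Y Z x = skew X Y Z x + skew X' Y Z x"
    and skew_add2: "Y' \<in> VF \<Longrightarrow> skew X (\<lambda>x. Y x + Y' x) Z x = skew X Y Z x + skew X Y' Z x"
    and skew_add3: "Z' \<in> VF \<Longrightarrow> skew X Y (\<lambda>x. Z x + Z' x) x = skew X Y Z x + skew X Y Z' x"
    and skew_scale1: "SF f \<Longrightarrow> skew (\<lambda>x. f x *\<^sub>R X x) Y Z x = f x * skew X Y Z x"
    and skew_scale2: "SF f \<Longrightarrow> skew X (\<lambda>x. f x *\<^sub>R Y x) Z x = f x * skew X Y Z x"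
    and skew_scale3: "SF f \<Longrightarrow> skew X Y (\<lambda>x. f x *\<^sub>R Z x) x = f x * skew X Y Z x"
    and SF_skew: "SF (skew X Y Z)"
proof -
  have "SF (\<lambda>x. (E X Y Z x + E Y Z X x - E Z X Y x) * (1 / 2))"
    by (intro SF_mult SF_add SF_diff SF_E SF_const X Y Z)
  then show "SF (skew X Y Z)" by (simp add: skew_def[abs_def])
qed (simp_all add: skew_def E_add1 E_add2 E_add3 E_scale1 E_scale2 E_scale3 X Y Z field_simps)

text \<open>The skew correction on \<open>H\<close>. Projecting all three arguments makes the
  functional vanish on \<open>T\<close>, and this is what makes its representative
  horizontal.\<close>

definition N where "N X Y = sharp (\<lambda>Z. skew (hor X) (hor Y) (hor Z))"

lemma
  assumes X: "X \<in> VF" and Y: "Y \<in> VF"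
  shows VF_N: "N X Y \<in> VF"
    and \<theta>_N [simp]: "\<theta> x (N X Y x) = 0"
    and \<Omega>_N: "Z \<in> VF \<Longrightarrow> \<Omega> x (N X Y x) (Z x) = skew (hor X) (hor Y) (hor Z) x"
proof -
  have t: "tensorial (\<lambda>Z. skew (hor X) (hor Y) (hor Z))"
    by (rule tensorialI) (simp_all add: hor_add hor_scale skew_add3 skew_scale3 VF_hor X Y)
  have S: "SF (skew (hor X) (hor Y) (hor Z))" if "Z \<in> VF" for Z
    by (intro SF_skew VF_hor X Y that)
  show "N X Y \<in> VF" unfolding N_def by (rule VF_sharp[OF t S])
  have B: "B x (N X Y x) (Z x) = skew (hor X) (hor Y) (hor Z) x" if "Z \<in> VF" for Z
    unfolding N_def by (rule B_sharp[OF t S that])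
  have "skew (hor X) (hor Y) (hor T) x = 0"
    using skew_scale3[OF VF_hor[OF X] VF_hor[OF Y] VF_0 SF_const, of 0 x] by (simp add: hor_T)
  then show 0: "\<theta> x (N X Y x) = 0" using B[OF reeb(1)] by (simp add: B_def)
  show "\<Omega> x (N X Y x) (Z x) = skew (hor X) (hor Y) (hor Z) x" if "Z \<in> VF"
    using B[OF that] 0 by (simp add: B_def)
qed

lemma N_eqI:
  assumes "\<theta> x w = 0" "\<And>Z. Z \<in> VF \<Longrightarrow> \<Omega> x w (Z x) = skew (hor X) (hor Y) (hor Z) x" "X \<in> VF" "Y \<in> VF"
  shows "N X Y x = w"
  by (rule B_cancel[of x]) (simp add: B_def assms \<Omega>_N)

lemma
  assumes X: "X \<in> VF" and Y: "Y \<in> VF"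
  shows N_add1: "X' \<in> VF \<Longrightarrow> N (\<lambda>x. X x + X' x) Y x = N X Y x + N X' Y x"
    and N_add2: "Y' \<in> VF \<Longrightarrow> N X (\<lambda>x. Y x + Y' x) x = N X Y x + N X Y' x"
    and N_scale1: "SF f \<Longrightarrow> N (\<lambda>x. f x *\<^sub>R X x) Y x = f x *\<^sub>R N X Y x"
    and N_scale2: "SF f \<Longrightarrow> N X (\<lambda>x. f x *\<^sub>R Y x) x = f x *\<^sub>R N X Y x"
    and N_self: "N X X x = 0"
    and N_T1: "N T Y x = 0"
    and N_T2: "N X T x = 0"
  subgoal by (rule N_eqI) (simp_all add: \<theta>_simps \<Omega>_simps \<Omega>_N VF_add X Y hor_add skew_add1 VF_hor)
  subgoal by (rule N_eqI) (simp_all add: \<theta>_simps \<Omega>_simps \<Omega>_N VF_add X Y hor_add skew_add2 VF_hor)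
  subgoal by (rule N_eqI) (simp_all add: \<theta>_simps \<Omega>_simps \<Omega>_N VF_scale X Y hor_scale skew_scale1 VF_hor)
  subgoal by (rule N_eqI) (simp_all add: \<theta>_simps \<Omega>_simps \<Omega>_N VF_scale X Y hor_scale skew_scale2 VF_hor)
  subgoal
  proof (rule N_eqI)
    fix Z assume "Z \<in> VF"
    then show "\<Omega> x 0 (Z x) = skew (hor X) (hor X) (hor Z) x"
      using skew_swap[of "hor X" "hor X" "hor Z" x] X by (simp add: VF_hor \<Omega>_simps)
  qed (simp_all add: X \<theta>_simps)
  subgoal
  proof (rule N_eqI)
    fix Z assume "Z \<in> VF"
    then show "\<Omega> x 0 (Z x) = skew (hor T) (hor Y) (hor Z) x"
      using skew_scale1[OF VF_0 VF_hor[OF Y] VF_hor[of Z] SF_const, of 0 x] by (simp add: hor_T \<Omega>_simps)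
  qed (simp_all add: Y reeb \<theta>_simps)
  subgoal
  proof (rule N_eqI)
    fix Z assume "Z \<in> VF"
    then show "\<Omega> x 0 (Z x) = skew (hor X) (hor T) (hor Z) x"
      using skew_scale2[OF VF_hor[OF X] VF_0 VF_hor[of Z] SF_const, of 0 x] by (simp add: hor_T \<Omega>_simps)
  qed (simp_all add: X reeb \<theta>_simps)
  done

text \<open>The bracket is the forced value along \<open>T\<close>, and it is horizontal. The last
  summand is the only possible component along \<open>T\<close>, since
  \<open>\<nabla>\<theta> = 0\<close> reads
  \<open>\<theta>(\<nabla>_X Y) = X(\<theta>(Y))\<close>.\<close>

definition nab0 where
  "nab0 X Y x = pr x (D (hor X) (hor Y) x) + N X Y x + \<theta> x (X x) *\<^sub>R lie_bracket A T (hor Y) x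
     + vf_apply A X (\<lambda>x. \<theta> x (Y x)) x *\<^sub>R T x"

lemma VF_nab0: "X \<in> VF \<Longrightarrow> Y \<in> VF \<Longrightarrow> nab0 X Y \<in> VF"
proof -
  assume X: "X \<in> VF" and Y: "Y \<in> VF"
  have "(\<lambda>x. hor (D (hor X) (hor Y)) x + N X Y x + \<theta> x (X x) *\<^sub>R lie_bracket A T (hor Y) x
     + vf_apply A X (\<lambda>x. \<theta> x (Y x)) x *\<^sub>R T x) \<in> VF"
    by (intro VF_add VF_scale VF_hor VF_N VF_lie_bracket VF_connection[OF D] SF_form SF_vf_apply reeb X Y)
  then show ?thesis by (simp add: nab0_def[abs_def] hor_def)
qed

lemma connection_laws_nab0: "connection_laws nab0"
  unfolding connection_laws_def
proof (intro conjI ballI allI impI)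
  fix X Y Z x assume X: "X \<in> VF" and Y: "Y \<in> VF" and Z: "Z \<in> VF"
  note h = VF_hor[OF X] VF_hor[OF Y] VF_hor[OF Z]
  show "nab0 (\<lambda>x. X x + Y x) Z x = nab0 X Z x + nab0 Y Z x"
    by (simp add: nab0_def hor_add connection_add1[OF D h] linear_add[OF linear_pr] N_add1 X Y Z \<theta>_simps
      vf_apply_vf_add[OF SF_form[OF Z]] algebra_simps)
  have "vf_apply A X (\<lambda>x. \<theta> x (Y x + Z x)) x = vf_apply A X (\<lambda>x. \<theta> x (Y x)) x + vf_apply A X (\<lambda>x. \<theta> x (Z x)) x"
    using vf_apply_add[OF SF_form[OF Y] SF_form[OF Z], of X x] by (simp add: \<theta>_simps)
  then show "nab0 X (\<lambda>x. Y x + Z x) x = nab0 X Y x + nab0 X Z x"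
    by (simp add: nab0_def hor_add connection_add2[OF D h] linear_add[OF linear_pr] N_add2 X Y Z
      lie_bracket_add[OF reeb(1) h(2,3)] algebra_simps)
next
  fix f X Y x assume f: "SF f" and X: "X \<in> VF" and Y: "Y \<in> VF"
  note h = VF_hor[OF X] VF_hor[OF Y]
  show "nab0 (\<lambda>x. f x *\<^sub>R X x) Y x = f x *\<^sub>R nab0 X Y x"
    by (simp add: nab0_def hor_scale connection_scale1[OF D h f] linear_cmul[OF linear_pr] N_scale1 X Y f \<theta>_simps
      vf_apply_vf_scale[OF SF_form[OF Y]] algebra_simps)
  have 1: "vf_apply A X (\<lambda>x. \<theta> x (f x *\<^sub>R Y x)) x = f x * vf_apply A X (\<lambda>x. \<theta> x (Y x)) x + vf_apply A X f x * \<theta> x (Y x)"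
    using vf_apply_mult[OF f SF_form[OF Y], of X x] by (simp add: \<theta>_simps)
  have 2: "pr x (D (hor X) (\<lambda>x. f x *\<^sub>R hor Y x) x) = vf_apply A (hor X) f x *\<^sub>R hor Y x + f x *\<^sub>R pr x (D (hor X) (hor Y) x)"
    by (simp add: connection_scale2[OF D h f] linear_add[OF linear_pr] linear_cmul[OF linear_pr] pr_horizontal)
  have 3: "Y x = hor Y x + \<theta> x (Y x) *\<^sub>R T x" by (simp add: hor_def pr_def)
  have "nab0 X (\<lambda>x. f x *\<^sub>R Y x) x = vf_apply A X f x *\<^sub>R (hor Y x + \<theta> x (Y x) *\<^sub>R T x) + f x *\<^sub>R nab0 X Y x"
    unfolding nab0_def hor_scale 1 2 N_scale2[OF X Y f] lie_bracket_scale[OF reeb(1) h(2) f] vf_apply_hor[OF f]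
    by (simp add: algebra_simps)
  then show "nab0 X (\<lambda>x. f x *\<^sub>R Y x) x = vf_apply A X f x *\<^sub>R Y x + f x *\<^sub>R nab0 X Y x"
    using 3 by simp
qed (rule VF_nab0)

lemma \<theta>_nab0: "X \<in> VF \<Longrightarrow> Y \<in> VF \<Longrightarrow> \<theta> x (nab0 X Y x) = vf_apply A X (\<lambda>x. \<theta> x (Y x)) x"
  by (simp add: nab0_def \<theta>_simps \<theta>_lie_T_hor)

text \<open>Splitting \<open>X\<close> separates two mechanisms. Along \<open>hor X\<close> the two
  contributions of \<open>N\<close> add up to \<open>E\<close> by \<open>skew_diff\<close> and
  repair the failure of \<open>D\<close>; along \<open>T\<close> the identity is the invariance of
  \<open>d\<theta>\<close> under the Reeb flow.\<close>

lemma \<Omega>_nab0: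
  assumes X: "X \<in> VF" and Y: "Y \<in> VF" and Z: "Z \<in> VF"
  shows "vf_apply A X (\<lambda>x. \<Omega> x (Y x) (Z x)) x = \<Omega> x (nab0 X Y x) (Z x) + \<Omega> x (Y x) (nab0 X Z x)"
proof -
  note h = VF_hor[OF X] VF_hor[OF Y] VF_hor[OF Z]
  have 1: "\<Omega> x (nab0 X U x) (V x) = \<Omega> x (D (hor X) (hor U) x) (V x) + skew (hor X) (hor U) (hor V) x
      + \<theta> x (X x) * \<Omega> x (lie_bracket A T (hor U) x) (V x)" if "U \<in> VF" "V \<in> VF" for U V
    using that by (simp add: nab0_def \<Omega>_simps \<Omega>_N[OF X])
  have 2: "\<Omega> x (Y x) (nab0 X Z x) = - \<Omega> x (nab0 X Z x) (Y x)" by (rule ext_deriv_swap)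
  have 3: "\<Omega> x (D (hor X) (hor Z) x) (Y x) = - \<Omega> x (Y x) (D (hor X) (hor Z) x)"
    "\<Omega> x (lie_bracket A T (hor Z) x) (Y x) = - \<Omega> x (Y x) (lie_bracket A T (hor Z) x)" by (rule ext_deriv_swap)+
  have "vf_apply A T (\<lambda>x. \<Omega> x (Y x) (Z x)) x
      = \<Omega> x (lie_bracket A T (hor Y) x) (Z x) + \<Omega> x (Y x) (lie_bracket A T (hor Z) x)"
    using lie_derivative_ext_deriv_zero[OF reeb(1,3) h(2,3), of x] by simp
  moreover have "E (hor X) (hor Y) (hor Z) x = vf_apply A X (\<lambda>x. \<Omega> x (Y x) (Z x)) x
      - \<theta> x (X x) * vf_apply A T (\<lambda>x. \<Omega> x (Y x) (Z x)) x
      - \<Omega> x (D (hor X) (hor Y) x) (Z x) - \<Omega> x (Y x) (D (hor X) (hor Z) x)"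
    by (simp add: cov_deriv2_def vf_apply_hor[OF SF_ext_deriv[OF Y Z]])
  ultimately show ?thesis
    using skew_diff[OF h, of x] 1[OF Y Z] 1[OF Z Y] unfolding 2 3 by (simp add: algebra_simps)
qed

text \<open>The horizontal bracket and the derivative of \<open>\<theta>(X)\<close> recombine to the
  full bracket \<open>[T, X]\<close>, and \<open>T\<close> is parallel for
  \<open>nab0\<close>.\<close>

lemma torsion_nab0_T: assumes X: "X \<in> VF" shows "torsion A nab0 T X x = 0"
proof -
  have "nab0 T X x = lie_bracket A T X x"
    using connection_0(2)[OF D VF_hor[OF X], of x] lie_T_hor[OF X, of x]
    by (simp add: nab0_def hor_T N_T1[OF X X])
  moreover have "nab0 X T x = 0"
    using connection_0(1)[OF D VF_hor[OF X], of x] lie_bracket_scale[OF reeb(1) VF_0 SF_const, of 0 x]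
    by (simp add: nab0_def hor_T N_T2[OF X X])
  ultimately show ?thesis by (simp add: torsion_def)
qed

text \<open>A field that extends the velocity of a contact curve is horizontal along the curve only,
  not nearby. What survives at \<open>x\<close> is that \<open>\<theta>(X)\<close> and its
  derivative along \<open>X\<close> vanish there, and this suffices to replace \<open>hor X\<close>
  by \<open>X\<close> inside \<open>D\<close>.\<close>

lemma nab0_geodesic:
  assumes X: "X \<in> VF" and 0: "\<theta> x (X x) = 0" "vf_apply A X (\<lambda>x. \<theta> x (X x)) x = 0"
    and DX: "D X X x \<in> span {X x}"
  shows "nab0 X X x \<in> span {X x}"
proof -
  have "D (hor X) (hor X) x = D X (hor X) x"
    by (rule tensorial_cong[OF tensorial_connection[OF D VF_hor[OF X]] VF_hor[OF X] X])
       (simp add: hor_def pr_horizontal 0)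
  also have "D X (hor X) x = D X X x"
  proof -
    have h: "hor X = (\<lambda>x. X x + (- \<theta> x (X x)) *\<^sub>R T x)" by (auto simp: hor_def pr_def)
    show ?thesis
      using connection_add2[OF D X X VF_scale[OF SF_minus[OF SF_form[OF X]] reeb(1)], of x]
        connection_scale2[OF D X reeb(1) SF_minus[OF SF_form[OF X]], of x] vf_apply_minus[OF SF_form[OF X], of X x] 0
      unfolding h by simp
  qed
  finally have "D (hor X) (hor X) x = D X X x" .
  moreover have "\<theta> x (D X X x) = 0"
    using DX 0 by (auto simp: span_singleton \<theta>_simps)
  ultimately have "nab0 X X x = D X X x" by (simp add: nab0_def N_self[OF X X] 0 pr_horizontal)
  then show ?thesis using DX by simp
qed

text \<open>The trace of the torsion is removed without disturbing the other conditions by adding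
  the tensor \<open>\<alpha>(Y) pr X + \<Omega>(X,Y) S\<close>, where \<open>\<alpha> = \<Omega>(S,\<cdot>)\<close>, whose effect on the torsion trace
  is \<open>- DIM('a) \<alpha>\<close>.\<close>

lemma connection_exists:
  obtains nab where "connection_laws nab"
    "\<And>X x. X \<in> VF \<Longrightarrow> \<theta> x (X x) = 0 \<Longrightarrow> vf_apply A X (\<lambda>x. \<theta> x (X x)) x = 0 \<Longrightarrow>
       D X X x \<in> span {X x} \<Longrightarrow> nab X X x \<in> span {X x}"
    "\<And>X Y x. X \<in> VF \<Longrightarrow> Y \<in> VF \<Longrightarrow> cov_deriv1 A nab \<theta> X Y x = 0"
    "\<And>X Y Z x. X \<in> VF \<Longrightarrow> Y \<in> VF \<Longrightarrow> Z \<in> VF \<Longrightarrow> cov_deriv2 A nab \<Omega> X Y Z x = 0"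
    "\<And>X x. X \<in> VF \<Longrightarrow> torsion A nab T X x = 0"
    "\<And>Y x. Y \<in> VF \<Longrightarrow> endo_trace (endo_at A (torsion A nab Y) x) = 0"
proof -
  note n0 = connection_laws_nab0
  define m where "m = real DIM('a)"
  have m: "m > 0" by (simp add: m_def)
  define t where "t Y x = endo_trace (endo_at A (torsion A nab0 Y) x)" for Y x
  define \<alpha> where "\<alpha> Y x = t Y x / m" for Y x
  have tt: "tensorial t" unfolding t_def[abs_def] by (rule tensorial_torsion_trace[OF n0])
  have t\<alpha>: "tensorial \<alpha>"
    by (rule tensorialI) (simp_all add: \<alpha>_def tensorial_add[OF tt] tensorial_scale[OF tt] add_divide_distrib)
  have St: "SF (t Y)" if Y: "Y \<in> VF" for Y
    unfolding t_def[abs_def] by (rule SF_endo_trace[OF tensorial_torsion[OF n0 Y] VF_torsion[OF n0 Y]])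
  have S\<alpha>: "SF (\<alpha> Y)" if "Y \<in> VF" for Y
    unfolding \<alpha>_def[abs_def] divide_inverse by (intro SF_mult SF_const St that)
  define S where "S = sharp \<alpha>"
  have S: "S \<in> VF" unfolding S_def by (rule VF_sharp[OF t\<alpha> S\<alpha>])
  have BS: "B x (S x) (Y x) = \<alpha> Y x" if "Y \<in> VF" for x Y unfolding S_def by (rule B_sharp[OF t\<alpha> S\<alpha> that])
  \<comment> \<open>\<open>nab0\<close> already satisfies (3), so \<alpha> vanishes on
    \<open>T\<close>; hence \<open>S\<close> is horizontal and \<alpha> equals
    \<open>\<Omega>(S, .)\<close>.\<close>
  have "t T x = 0" for x
    using torsion_nab0_T[OF extend(1)]
    by (simp add: t_def endo_at_tensorial[OF tensorial_torsion[OF n0 reeb(1)]] endo_trace_def)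
  then have \<theta>S: "\<theta> x (S x) = 0" for x using BS[OF reeb(1), of x] by (simp add: B_def \<alpha>_def)
  have tS: "t Y x = m * \<Omega> x (S x) (Y x)" if "Y \<in> VF" for Y x
    using BS[OF that, of x] m by (simp add: B_def \<theta>S \<alpha>_def field_simps)
  define nab where "nab X Y x = nab0 X Y x + (\<Omega> x (S x) (Y x) *\<^sub>R hor X x + \<Omega> x (X x) (Y x) *\<^sub>R S x)" for X Y x
  have laws: "connection_laws nab"
    unfolding connection_laws_def
  proof (intro conjI ballI allI impI)
    fix X Y assume "X \<in> VF" "Y \<in> VF"
    then show "nab X Y \<in> VF"
      unfolding nab_def[abs_def] by (intro VF_add VF_nab0 VF_scale SF_ext_deriv VF_hor S)
  qed (simp_all add: nab_def connection_add1[OF n0] connection_add2[OF n0] connection_scale1[OF n0]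
        connection_scale2[OF n0] hor_add hor_scale \<Omega>_simps algebra_simps)
  have c1: "cov_deriv1 A nab \<theta> X Y x = 0" if "X \<in> VF" "Y \<in> VF" for X Y x
    using that by (simp add: cov_deriv1_def nab_def \<theta>_simps \<theta>_nab0 \<theta>S)
  \<comment> \<open>Lowered by \<Omega>, the added tensor is \<open>\<Omega>(S, Y) \<Omega>(X, Z) +
    \<Omega>(X, Y) \<Omega>(S, Z)\<close>. It is symmetric in \<open>Y\<close> and \<open>Z\<close>,
    which is the infinitesimal form of preserving \<Omega>.\<close>
  have c2: "cov_deriv2 A nab \<Omega> X Y Z x = 0" if X: "X \<in> VF" and Y: "Y \<in> VF" and Z: "Z \<in> VF" for X Y Z x
    using ext_deriv_swap[of x "X x" "Y x"] ext_deriv_swap[of x "S x" "Y x"]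
    by (simp add: cov_deriv2_def \<Omega>_nab0[OF that] nab_def \<Omega>_simps)
  have tor: "torsion A nab Y X x = torsion A nab0 Y X x + (\<Omega> x (S x) (X x) *\<^sub>R hor Y x
      - \<Omega> x (S x) (Y x) *\<^sub>R hor X x + 2 *\<^sub>R (\<Omega> x (Y x) (X x) *\<^sub>R S x))" for X Y x
    using ext_deriv_swap[of x "X x" "Y x"] by (simp add: torsion_def nab_def flip: scaleR_add_left)
  have c3: "torsion A nab T X x = 0" if "X \<in> VF" for X x
    using torsion_nab0_T[OF that, of x] by (simp add: tor hor_T)
  have c4: "endo_trace (endo_at A (torsion A nab Y) x) = 0" if Y: "Y \<in> VF" for Y x
  proof -
    let ?L = "\<lambda>v. torsion A nab0 Y (extend x v) x"
    have id: "pr x = (\<lambda>v. v - \<theta> x v *\<^sub>R T x)" by (auto simp: pr_def)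
    have tr_pr: "endo_trace (pr x) = m - 1"
      unfolding id by (simp add: endo_trace_diff endo_trace_id endo_trace_rank_one[OF linear_form] m_def)
    have "endo_trace (endo_at A (torsion A nab Y) x)
      = endo_trace (\<lambda>v. ?L v + (\<Omega> x (S x) v *\<^sub>R hor Y x - \<Omega> x (S x) (Y x) *\<^sub>R pr x v + (\<Omega> x (Y x) v *\<^sub>R S x + \<Omega> x (Y x) v *\<^sub>R S x)))"
      by (simp add: endo_at_tensorial[OF tensorial_torsion[OF laws Y]] tor hor_def flip: scaleR_add_left)
    \<comment> \<open>With \<open>a = \<Omega> x (S x) (Y x)\<close> the added terms contribute
      \<open>a - (m - 1) * a - 2 * a = - m * a\<close>, against \<open>m * a\<close> from
      \<open>nab0\<close>.\<close>
    also have "\<dots> = endo_trace ?L + (\<Omega> x (S x) (hor Y x) - \<Omega> x (S x) (Y x) * (m - 1) + (\<Omega> x (Y x) (S x) + \<Omega> x (Y x) (S x)))"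
      by (simp only: endo_trace_add endo_trace_diff endo_trace_scale tr_pr endo_trace_rank_one[OF linear_ext_deriv(1)])
    also have "endo_trace ?L = m * \<Omega> x (S x) (Y x)"
      using tS[OF Y, of x] by (simp add: t_def endo_at_tensorial[OF tensorial_torsion[OF n0 Y]])
    finally show ?thesis using ext_deriv_swap[of x "S x" "Y x"] by (simp add: algebra_simps)
  qed
  have geo: "nab X X x \<in> span {X x}" if "X \<in> VF" "\<theta> x (X x) = 0" "vf_apply A X (\<lambda>x. \<theta> x (X x)) x = 0"
     "D X X x \<in> span {X x}" for X x
  proof -
    have "\<Omega> x (S x) (X x) *\<^sub>R X x \<in> span {X x}" by (intro span_scale span_base) simp
    with nab0_geodesic[OF that] have "nab0 X X x + \<Omega> x (S x) (X x) *\<^sub>R X x \<in> span {X x}" by (rule span_add)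
    then show ?thesis using that(2) by (simp add: nab_def hor_def pr_horizontal)
  qed
  show thesis by (rule that[OF laws geo c1 c2 c3 c4])
qed

end

section \<open>Curves with common geodesics\<close>

text \<open>Lets a statement modulo the tangent line be tested by scalar functions, one normal
  covector at a time.\<close>

lemma orthogonal_complement_criterion:
  fixes u z :: "'a::euclidean_space"
  assumes "\<And>w. w \<bullet> u = 0 \<Longrightarrow> w \<bullet> z = 0" shows "z \<in> span {u}"
proof -
  define w where "w = z - (z \<bullet> u / (u \<bullet> u)) *\<^sub>R u"
  have wu: "w \<bullet> u = 0" by (cases "u = 0") (simp_all add: w_def inner_diff_left)
  have "w \<bullet> w = w \<bullet> z - (z \<bullet> u / (u \<bullet> u)) * (w \<bullet> u)"
    unfolding w_def by (simp add: inner_diff_right inner_commute)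
  then have "w \<bullet> w = 0" using wu assms[OF wu] by simp
  then have "z = (z \<bullet> u / (u \<bullet> u)) *\<^sub>R u" by (simp add: w_def)
  then show ?thesis unfolding span_singleton by blast
qed

text \<open>The equality case of the Cauchy-Schwarz inequality. It expresses proportionality by the
  vanishing of a polynomial, so that transversality of smooth fields becomes an open
  condition.\<close>

lemma span_singleton_iff_Cauchy_Schwarz:
  fixes a b :: "'a::euclidean_space"
  assumes b: "b \<noteq> 0"
  shows "a \<in> span {b} \<longleftrightarrow> (a \<bullet> a) * (b \<bullet> b) - (a \<bullet> b) * (a \<bullet> b) = 0"
proof
  assume "a \<in> span {b}"
  then obtain k where "a = k *\<^sub>R b" by (auto simp: span_singleton)
  then show "(a \<bullet> a) * (b \<bullet> b) - (a \<bullet> b) * (a \<bullet> b) = 0" by simp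
next
  assume 0: "(a \<bullet> a) * (b \<bullet> b) - (a \<bullet> b) * (a \<bullet> b) = 0"
  define k where "k = a \<bullet> b / (b \<bullet> b)"
  have bb: "b \<bullet> b \<noteq> 0" using b by simp
  have "(a - k *\<^sub>R b) \<bullet> (a - k *\<^sub>R b) = a \<bullet> a - 2 * k * (a \<bullet> b) + k * k * (b \<bullet> b)"
    by (simp add: inner_diff_left inner_diff_right inner_commute algebra_simps)
  also have "\<dots> = 0" using 0 bb by (simp add: k_def field_simps)
  finally have "a = k *\<^sub>R b" by simp
  then show "a \<in> span {b}" unfolding span_singleton by blast
qed

text \<open>The first order expansions along \<open>x' t0\<close> give \<open>(\<tau> n - t0) / (\<sigma> n - s0) \<longlonglongrightarrow> c\<close>; with this
  ratio, proportionality of the velocities, divided by \<open>\<sigma> n - s0\<close>, compares the second derivatives.\<close>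

lemma second_order_contact:
  fixes x y x' y' :: "real \<Rightarrow> 'a::euclidean_space"
  assumes x: "(x has_vector_derivative x' t0) (at t0)" and y: "(y has_vector_derivative y' s0) (at s0)"
    and x': "(x' has_vector_derivative x'') (at t0)" and y': "(y' has_vector_derivative y'') (at s0)"
    and c: "y' s0 = c *\<^sub>R x' t0" and nz: "x' t0 \<noteq> 0" and xy: "x t0 = y s0"
    and \<tau>: "\<tau> \<longlonglongrightarrow> t0" and \<sigma>: "\<sigma> \<longlonglongrightarrow> s0" and ne: "\<And>n. (\<sigma> n, \<tau> n) \<noteq> (s0, t0)"
    and eq: "\<forall>\<^sub>F n in sequentially. x (\<tau> n) = y (\<sigma> n) \<and> (\<exists>k. y' (\<sigma> n) = k *\<^sub>R x' (\<tau> n))"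
  shows "y'' - (c * c) *\<^sub>R x'' \<in> span {x' t0}"
proof (rule orthogonal_complement_criterion)
  fix w assume w: "w \<bullet> x' t0 = 0"
  define u where "u = x' t0"
  define U where "U = u \<bullet> u"
  have U: "U \<noteq> 0" using nz by (simp add: U_def u_def)
  have carat: "\<exists>g. (\<forall>z. v \<bullet> f z - v \<bullet> f r = g z * (z - r)) \<and> isCont g r \<and> g r = v \<bullet> f'"
    if "(f has_vector_derivative f') (at r)" for f :: "real \<Rightarrow> 'a" and f' r v
  proof -
    have "((\<lambda>z. v \<bullet> f z) has_vector_derivative v \<bullet> f') (at r)"
      by (rule bounded_linear.has_vector_derivative[OF bounded_linear_inner_right that])
    then show ?thesis unfolding has_real_derivative_iff_has_vector_derivative[symmetric] CARAT_DERIV .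
  qed
  obtain \<xi> where \<xi>: "\<And>z. u \<bullet> x z - u \<bullet> x t0 = \<xi> z * (z - t0)" "isCont \<xi> t0" "\<xi> t0 = U"
    using carat[OF x, of u] by (auto simp: U_def u_def)
  obtain \<eta> where \<eta>: "\<And>z. u \<bullet> y z - u \<bullet> y s0 = \<eta> z * (z - s0)" "isCont \<eta> s0" "\<eta> s0 = c * U"
    using carat[OF y, of u] c by (auto simp: U_def u_def)
  obtain \<pi> where \<pi>: "\<And>z. w \<bullet> x' z = \<pi> z * (z - t0)" "isCont \<pi> t0" "\<pi> t0 = w \<bullet> x''"
    using carat[OF x', of w] w by auto
  obtain \<kappa> where \<kappa>: "\<And>z. w \<bullet> y' z = \<kappa> z * (z - s0)" "isCont \<kappa> s0" "\<kappa> s0 = w \<bullet> y''"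
    using carat[OF y', of w] w c by auto
  have lim: "(\<lambda>n. f (\<tau> n)) \<longlonglongrightarrow> f t0" if "isCont f t0" for f :: "real \<Rightarrow> real"
    using isCont_tendsto_compose[OF that \<tau>] .
  have lim': "(\<lambda>n. f (\<sigma> n)) \<longlonglongrightarrow> f s0" if "isCont f s0" for f :: "real \<Rightarrow> real"
    using isCont_tendsto_compose[OF that \<sigma>] .
  have cx: "isCont (\<lambda>t. u \<bullet> x' t) t0" and cy: "isCont (\<lambda>s. u \<bullet> y' s) s0"
    using has_vector_derivative_continuous[OF x'] has_vector_derivative_continuous[OF y']
    by (auto intro!: continuous_intros)
  have "\<forall>\<^sub>F n in sequentially. \<xi> (\<tau> n) \<noteq> 0"
    using tendsto_imp_eventually_ne[OF lim[OF \<xi>(2)]] \<xi>(3) U by simp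
  then have ev: "\<forall>\<^sub>F n in sequentially. \<kappa> (\<sigma> n) * (u \<bullet> x' (\<tau> n)) * \<xi> (\<tau> n) = \<pi> (\<tau> n) * (u \<bullet> y' (\<sigma> n)) * \<eta> (\<sigma> n)"
    using eq
  proof eventually_elim
    case (elim n)
    then obtain k where k: "y' (\<sigma> n) = k *\<^sub>R x' (\<tau> n)" and xn: "x (\<tau> n) = y (\<sigma> n)" by blast
    have 1: "\<xi> (\<tau> n) * (\<tau> n - t0) = \<eta> (\<sigma> n) * (\<sigma> n - s0)"
      using \<xi>(1)[of "\<tau> n"] \<eta>(1)[of "\<sigma> n"] xn xy by simp
    \<comment> \<open>If the first parameter had reached \<open>s0\<close>, then
      \<open>\<xi> (\<tau> n) \<noteq> 0\<close> would force the second to equal \<open>t0\<close>,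
      which \<open>ne\<close> excludes.\<close>
    have s: "\<sigma> n - s0 \<noteq> 0"
    proof
      assume "\<sigma> n - s0 = 0"
      then have "\<sigma> n = s0" "\<tau> n = t0" using 1 elim(1) by auto
      then show False using ne[of n] by simp
    qed
    \<comment> \<open>A vanishing 2 by 2 minor of the proportional velocities, paired with
      \<open>w\<close> and \<open>u\<close>; it eliminates the unknown factor
      \<open>k\<close>.\<close>
    have "(w \<bullet> y' (\<sigma> n)) * (u \<bullet> x' (\<tau> n)) = (w \<bullet> x' (\<tau> n)) * (u \<bullet> y' (\<sigma> n))"
      by (simp add: k)
    then have 2: "\<kappa> (\<sigma> n) * (\<sigma> n - s0) * (u \<bullet> x' (\<tau> n)) = \<pi> (\<tau> n) * (\<tau> n - t0) * (u \<bullet> y' (\<sigma> n))"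
      by (simp add: \<kappa>(1) \<pi>(1))
    have "(\<sigma> n - s0) * (\<kappa> (\<sigma> n) * (u \<bullet> x' (\<tau> n)) * \<xi> (\<tau> n))
        = \<pi> (\<tau> n) * (u \<bullet> y' (\<sigma> n)) * (\<xi> (\<tau> n) * (\<tau> n - t0))"
      using arg_cong[OF 2, of "\<lambda>r. r * \<xi> (\<tau> n)"] by (simp only: mult_ac)
    also have "\<dots> = (\<sigma> n - s0) * (\<pi> (\<tau> n) * (u \<bullet> y' (\<sigma> n)) * \<eta> (\<sigma> n))"
      unfolding 1 by (simp only: mult_ac)
    finally show ?case using s by simp
  qed
  have "(\<lambda>n. \<kappa> (\<sigma> n) * (u \<bullet> x' (\<tau> n)) * \<xi> (\<tau> n)) \<longlonglongrightarrow> (w \<bullet> y'') * U * U"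
    using tendsto_mult[OF tendsto_mult[OF lim'[OF \<kappa>(2)] lim[OF cx]] lim[OF \<xi>(2)]]
    by (simp add: \<kappa>(3) \<xi>(3) U_def u_def)
  from Lim_transform_eventually[OF this ev]
  have "(\<lambda>n. \<pi> (\<tau> n) * (u \<bullet> y' (\<sigma> n)) * \<eta> (\<sigma> n)) \<longlonglongrightarrow> (w \<bullet> y'') * U * U" .
  moreover have "(\<lambda>n. \<pi> (\<tau> n) * (u \<bullet> y' (\<sigma> n)) * \<eta> (\<sigma> n)) \<longlonglongrightarrow> (w \<bullet> x'') * (c * U) * (c * U)"
    using tendsto_mult[OF tendsto_mult[OF lim[OF \<pi>(2)] lim'[OF cy]] lim'[OF \<eta>(2)]]
    by (simp add: \<pi>(3) \<eta>(3) U_def u_def c)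
  ultimately have "(w \<bullet> y'') * U * U = (w \<bullet> x'') * (c * U) * (c * U)"
    by (rule LIMSEQ_unique)
  then have "U * U * (w \<bullet> y'') = U * U * (c * c * (w \<bullet> x''))" by (simp only: mult_ac)
  then have "w \<bullet> y'' = c * c * (w \<bullet> x'')" using U by simp
  then show "w \<bullet> (y'' - (c * c) *\<^sub>R x'') = 0" by (simp add: inner_diff_right)
qed

text \<open>A set of isolated points injects into a countable basis: assign to each point a basic
  open set that meets the set in this point alone.\<close>

lemma uncountable_imp_limit_point:
  fixes Z :: "'a::second_countable_topology set"
  assumes "uncountable Z" shows "\<exists>z\<in>Z. z islimpt Z"
proof (rule ccontr)
  assume no: "\<not> ?thesis"
  obtain \<B> :: "'a set set" where \<B>: "countable \<B>" "topological_basis \<B>"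
    using ex_countable_basis by blast
  have "\<exists>b\<in>\<B>. b \<inter> Z = {z}" if z: "z \<in> Z" for z
  proof -
    obtain W where W: "z \<in> W" "open W" "\<forall>y\<in>Z. y \<in> W \<longrightarrow> y = z"
      using no z unfolding islimpt_def by meson
    obtain b where "b \<in> \<B>" "z \<in> b" "b \<subseteq> W" using topological_basisE[OF \<B>(2) W(2,1)] by blast
    then show ?thesis using W(3) z by blast
  qed
  then have ch: "\<forall>z\<in>Z. \<exists>b. b \<in> \<B> \<and> b \<inter> Z = {z}" by blast
  from bchoice[OF ch] obtain b where "\<forall>z\<in>Z. b z \<in> \<B> \<and> b z \<inter> Z = {z}" ..
  then have b: "\<And>z. z \<in> Z \<Longrightarrow> b z \<in> \<B>" "\<And>z. z \<in> Z \<Longrightarrow> b z \<inter> Z = {z}" by simp_all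
  have "inj_on b Z" 
  proof (rule inj_onI)
    fix y z assume yz: "y \<in> Z" "z \<in> Z" "b y = b z"
    have "{y} = b y \<inter> Z" using b(2)[OF yz(1)] by (rule sym)
    also have "\<dots> = {z}" unfolding yz(3) by (rule b(2)[OF yz(2)])
    finally show "y = z" by blast
  qed
  moreover have "countable (b ` Z)" using b(1) by (intro countable_subset[OF _ \<B>(1)]) auto
  ultimately show False using assms countable_image_inj_on by blast
qed

text \<open>With the Gram map \<beta> of \<open>B\<close>, skewness says that \<phi> is minus the
  conjugate by \<beta> of its adjoint, and the trace is invariant under conjugation and
  adjunction.\<close>

lemma skew_endo_trace_zero:
  fixes \<phi> :: "'a::euclidean_space \<Rightarrow> 'a" and B :: "'a \<Rightarrow> 'a \<Rightarrow> real"
  assumes \<phi>: "linear \<phi>" and B: "\<And>v. linear (\<lambda>u. B u v)" "\<And>u. linear (B u)"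
    and nondeg: "\<And>u. (\<And>v. B u v = 0) \<Longrightarrow> u = 0"
    and skew: "\<And>u v. B (\<phi> u) v = - B u (\<phi> v)"
  shows "endo_trace \<phi> = 0"
proof -
  define \<beta> where "\<beta> u = (\<Sum>b\<in>Basis. B u b *\<^sub>R b)" for u
  have l\<beta>: "linear \<beta>"
    by (rule linearI) (simp_all add: \<beta>_def linear_add[OF B(1)] linear_cmul[OF B(1)] algebra_simps sum.distrib scaleR_sum_right)
  have \<beta>: "\<beta> u \<bullet> v = B u v" for u v
  proof -
    have "B u v = (\<Sum>b\<in>Basis. (v \<bullet> b) *\<^sub>R B u b)" by (rule linear_euclidean_sum[OF B(2)])
    also have "\<dots> = (\<Sum>b\<in>Basis. B u b * (b \<bullet> v))" by (simp add: inner_commute mult.commute)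
    finally show ?thesis by (simp add: \<beta>_def inner_sum_left)
  qed
  have "u = 0" if "\<beta> u = 0" for u
    by (rule nondeg) (simp add: \<beta>[symmetric] that)
  then have "inj \<beta>" unfolding linear_injective_0[OF l\<beta>] by blast
  then obtain \<gamma> where \<gamma>: "linear \<gamma>" "\<And>v. \<gamma> (\<beta> v) = v"
    using linear_injective_left_inverse[OF l\<beta>] by (metis comp_apply id_apply)
  have \<beta>\<gamma>: "\<beta> (\<gamma> v) = v" for v
    using linear_inj_imp_surj[OF l\<beta> \<open>inj \<beta>\<close>] \<gamma>(2) by (metis surjD)
  have "\<beta> (\<phi> u) = - adjoint \<phi> (\<beta> u)" for u
  proof (rule euclidean_eqI)
    fix b :: 'a assume "b \<in> Basis"
    have "adjoint \<phi> (\<beta> u) \<bullet> b = \<beta> u \<bullet> \<phi> b"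
      using adjoint_works[OF \<phi>, of b "\<beta> u"] by (simp add: inner_commute)
    then show "\<beta> (\<phi> u) \<bullet> b = - adjoint \<phi> (\<beta> u) \<bullet> b" using skew by (simp add: \<beta>)
  qed
  then have *: "\<phi> u = - \<gamma> (adjoint \<phi> (\<beta> u))" for u
    using \<gamma>(2)[of "\<phi> u"] linear_neg[OF \<gamma>(1)] by simp
  have "endo_trace \<phi> = endo_trace (\<lambda>u. (- 1) *\<^sub>R \<gamma> (adjoint \<phi> (\<beta> u)))"
    using * by (simp add: endo_trace_def inner_minus_left)
  also have "\<dots> = - endo_trace (\<lambda>u. \<gamma> (adjoint \<phi> (\<beta> u)))" by (simp only: endo_trace_scale mult_minus1)
  also have "endo_trace (\<lambda>u. \<gamma> (adjoint \<phi> (\<beta> u))) = endo_trace (adjoint \<phi>)"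
    by (rule endo_trace_conjugate[OF \<gamma>(1) l\<beta> adjoint_linear[OF \<phi>] \<beta>\<gamma>])
  also have "endo_trace (adjoint \<phi>) = endo_trace \<phi>"
    using adjoint_works[OF \<phi>] by (simp add: endo_trace_def inner_commute)
  finally show ?thesis by simp
qed

section \<open>Immersed curves and covariant derivatives along them\<close>

context smooth_manifold
begin

lemma immersed_curve_chart_open:
  assumes \<gamma>: "immersed_curve A I \<gamma>" and c: "c \<in> A" shows "open {s \<in> I. \<gamma> s \<in> cdom c}"
proof -
  have "continuous_on I \<gamma>" "open I" using \<gamma> by (auto simp: immersed_curve_def smooth_into_def)
  from continuous_open_preimage[OF this open_cdom[OF c]] show ?thesis by (simp add: vimage_def Int_def)
qed

lemma immersed_curve_derivative:
  assumes \<gamma>: "immersed_curve A I \<gamma>" and t: "t \<in> I" and c: "c \<in> A" "\<gamma> t \<in> cdom c"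
  shows "((\<lambda>s. cmap c (\<gamma> s)) has_vector_derivative to_coords A c (\<gamma> t) (velocity A \<gamma> t)) (at t)"
proof -
  let ?d = "chart_at A (\<gamma> t)"
  let ?J = "{s \<in> I. \<gamma> s \<in> cdom ?d}"
  have J: "open ?J" "t \<in> ?J" using immersed_curve_chart_open[OF \<gamma> chart_at(1)] t chart_at(2) by auto
  have "smooth_on ?J (cmap ?d \<circ> \<gamma>)"
    using \<gamma> chart_at(1) unfolding immersed_curve_def smooth_into_def by blast
  then have "(cmap ?d \<circ> \<gamma>) differentiable (at t)" using J(2) by (rule smooth_on_differentiable)
  then have v: "((cmap ?d \<circ> \<gamma>) has_vector_derivative velocity A \<gamma> t) (at t)"
    unfolding velocity_def using vector_derivative_works by blast
  have "((cmap c \<circ> cinv ?d) has_derivative jac ?d c (pt A (\<gamma> t))) (at ((cmap ?d \<circ> \<gamma>) t))"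
    using transition_has_derivative[OF chart_at(1) c(1) pt_overlap[OF c]] by simp
  from has_derivative_compose[OF v[unfolded has_vector_derivative_def] this]
  have "((\<lambda>s. (cmap c \<circ> cinv ?d) ((cmap ?d \<circ> \<gamma>) s)) has_derivative
      (\<lambda>h. h *\<^sub>R to_coords A c (\<gamma> t) (velocity A \<gamma> t))) (at t)"
    using linear_cmul[OF linear_to_coords[OF c]] by (simp add: to_coords_def)
  then have "((\<lambda>s. cmap c (\<gamma> s)) has_derivative (\<lambda>h. h *\<^sub>R to_coords A c (\<gamma> t) (velocity A \<gamma> t))) (at t)"
    by (rule has_derivative_transform_within_open[OF _ J]) (simp add: chart_at(1))
  then show ?thesis by (simp add: has_vector_derivative_def)
qed

lemma eventually_immersed_curve_chart:
  assumes \<gamma>: "immersed_curve A I \<gamma>" and t: "t \<in> I" and c: "c \<in> A" "\<gamma> t \<in> cdom c"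
  shows "\<forall>\<^sub>F s in nhds t. s \<in> I \<and> \<gamma> s \<in> cdom c"
  using eventually_nhds_in_open[OF immersed_curve_chart_open[OF \<gamma> c(1)], of t] t c(2) by simp

text \<open>As \<open>X\<close> agrees with the velocity along the curve, this is the acceleration
  in coordinates; it supplies the second derivatives for
  \<open>second_order_contact\<close>.\<close>

lemma velocity_extension_derivative:
  assumes \<gamma>: "immersed_curve A I \<gamma>" and t: "t \<in> I" and c: "c \<in> A" "\<gamma> t \<in> cdom c"
    and X: "X \<in> VF" "\<forall>\<^sub>F s in nhds t. X (\<gamma> s) = velocity A \<gamma> s"
  shows "((\<lambda>s. vf_rep A c X (cmap c (\<gamma> s))) has_vector_derivative
      fderiv (vf_rep A c X) (cmap c (\<gamma> t)) (to_coords A c (\<gamma> t) (velocity A \<gamma> t))) (at t)"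
proof -
  have "(vf_rep A c X has_derivative fderiv (vf_rep A c X) (cmap c (\<gamma> t))) (at (cmap c (\<gamma> t)))"
    by (rule has_fderiv[OF VF_differentiable[OF X(1) c(1) cmap_ccod[OF c(2)]]])
  from has_derivative_compose[OF immersed_curve_derivative[OF \<gamma> t c, unfolded has_vector_derivative_def] this]
    linear_cmul[OF has_derivative_linear[OF this]]
  show ?thesis by (simp add: has_vector_derivative_def)
qed

text \<open>The derivative of \<open>f\<close> at the point depends only on the value of
  \<open>X\<close> there, the velocity of a curve along which \<open>f\<close> stays zero.\<close>

lemma vf_apply_along_curve:
  assumes \<gamma>: "immersed_curve A I \<gamma>" and t: "t \<in> I" and f: "SF f" and X: "X (\<gamma> t) = velocity A \<gamma> t"
    and 0: "\<forall>\<^sub>F s in nhds t. f (\<gamma> s) = 0"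
  shows "vf_apply A X f (\<gamma> t) = 0"
proof -
  let ?c = "chart_at A (\<gamma> t)"
  have c: "?c \<in> A" "\<gamma> t \<in> cdom ?c" by (rule chart_at)+
  have "((\<lambda>p. f (cinv ?c p)) has_derivative fderiv (\<lambda>p. f (cinv ?c p)) (cmap ?c (\<gamma> t))) (at (cmap ?c (\<gamma> t)))"
    by (rule has_fderiv[OF SF_differentiable[OF f c(1) cmap_ccod[OF c(2)]]])
  from has_derivative_compose[OF immersed_curve_derivative[OF \<gamma> t c, unfolded has_vector_derivative_def] this]
  have 1: "((\<lambda>s. f (cinv ?c (cmap ?c (\<gamma> s)))) has_derivative
      (\<lambda>h. fderiv (\<lambda>p. f (cinv ?c p)) (cmap ?c (\<gamma> t)) (h *\<^sub>R velocity A \<gamma> t))) (at t)" by simp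
  obtain W where W: "open W" "t \<in> W" "\<forall>s\<in>W. (s \<in> I \<and> \<gamma> s \<in> cdom ?c) \<and> f (\<gamma> s) = 0"
    using eventually_conj[OF eventually_immersed_curve_chart[OF \<gamma> t c] 0] unfolding eventually_nhds by blast
  have "((\<lambda>s. 0) has_derivative (\<lambda>h. fderiv (\<lambda>p. f (cinv ?c p)) (cmap ?c (\<gamma> t)) (h *\<^sub>R velocity A \<gamma> t))) (at t)"
    by (rule has_derivative_transform_within_open[OF 1 W(1,2)]) (use W(3) c(1) in simp)
  from has_derivative_unique[OF this has_derivative_const]
  have "fderiv (\<lambda>p. f (cinv ?c p)) (cmap ?c (\<gamma> t)) (1 *\<^sub>R velocity A \<gamma> t) = 0" by metis
  then show ?thesis using X by (simp add: vf_apply_pt)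
qed

text \<open>Where \<open>W\<close> vanishes the Christoffel terms drop out, and the result is the
  same for every connection. In the Leibniz rule for the expansion of \<open>W\<close> only
  derivatives of the coefficients survive.\<close>

lemma connection_vanishing_field:
  assumes D: "connection_laws D" and X: "X \<in> VF" and W: "W \<in> VF" "W x = 0"
  shows "D X W x = fderiv (vf_rep A (chart_at A x) W) (pt A x) (X x)"
proof -
  let ?c = "chart_at A x" let ?p = "pt A x"
  have c: "?c \<in> A" "x \<in> cdom ?c" by (rule chart_at)+
  obtain f E where f: "SF f" "f x = 1" and E: "\<And>v. E v \<in> VF"
    and Ev: "\<And>v y. y \<in> cdom ?c \<Longrightarrow> E v y = f y *\<^sub>R from_coords A ?c (cmap ?c y) v"
    and dec: "\<And>X. X \<in> VF \<Longrightarrow> \<exists>g. (\<forall>b. SF (g b)) \<and>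
        (\<forall>b. \<forall>y\<in>cdom ?c. g b y = f y * (vf_rep A ?c X (cmap ?c y) \<bullet> b)) \<and>
        X = (\<lambda>y. (1 - f y * f y) *\<^sub>R X y + (\<Sum>b\<in>Basis. g b y *\<^sub>R E b y))"
    by (rule frame[OF chart_at, of x]) blast
  obtain g where gS: "\<forall>b. SF (g b)" and g: "\<forall>b. \<forall>y\<in>cdom ?c. g b y = f y * (vf_rep A ?c W (cmap ?c y) \<bullet> b)"
    and W': "W = (\<lambda>y. (1 - f y * f y) *\<^sub>R W y + (\<Sum>b\<in>Basis. g b y *\<^sub>R E b y))"
    using dec[OF W(1)] by blast
  have g0: "g b x = 0" for b using g[rule_format, OF c(2), of b] W(2) by simp
  have s: "SF (\<lambda>y. 1 - f y * f y)" by (intro SF_diff SF_mult SF_const f)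
  have gE: "(\<lambda>y. g b y *\<^sub>R E b y) \<in> VF" for b using VF_scale gS E by blast
  have sum: "D X (\<lambda>y. \<Sum>b\<in>I. g b y *\<^sub>R E b y) x = (\<Sum>b\<in>I. D X (\<lambda>y. g b y *\<^sub>R E b y) x)" if "finite I" for I
    using that
  proof (induction I)
    case empty
    show ?case using connection_0(1)[OF D X] by simp
  next
    case (insert b I)
    have "(\<lambda>y. \<Sum>b\<in>I. g b y *\<^sub>R E b y) \<in> VF" by (rule VF_sum[OF gE])
    from connection_add2[OF D X gE this, where x = x] insert show ?case by simp
  qed
  have "D X W x = D X (\<lambda>y. (1 - f y * f y) *\<^sub>R W y + (\<Sum>b\<in>Basis. g b y *\<^sub>R E b y)) x" using W' by simp
  also have "\<dots> = D X (\<lambda>y. (1 - f y * f y) *\<^sub>R W y) x + (\<Sum>b\<in>Basis. D X (\<lambda>y. g b y *\<^sub>R E b y) x)"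
    by (subst connection_add2[OF D X VF_scale[OF s W(1)] VF_sum[OF gE]]) (simp add: sum)
  also have "D X (\<lambda>y. (1 - f y * f y) *\<^sub>R W y) x = 0"
    using connection_scale2[OF D X W(1) s, where x = x] W(2) f(2) by simp
  also have "(\<Sum>b\<in>Basis. D X (\<lambda>y. g b y *\<^sub>R E b y) x) = (\<Sum>b\<in>Basis. vf_apply A X (g b) x *\<^sub>R b)"
  proof (rule sum.cong[OF refl])
    fix b
    have "E b x = b" using Ev[OF c(2), of b] f(2) by simp
    then show "D X (\<lambda>y. g b y *\<^sub>R E b y) x = vf_apply A X (g b) x *\<^sub>R b"
      using connection_scale2[OF D X E, where f = "g b" and x = x] gS g0 by simp
  qed
  also have "\<dots> = (\<Sum>b\<in>Basis. (fderiv (vf_rep A ?c W) ?p (X x) \<bullet> b) *\<^sub>R b)"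
  proof (rule sum.cong[OF refl])
    fix b
    have p: "open (ccod ?c)" "?p \<in> ccod ?c" "cinv ?c ?p = x" using open_ccod c by auto
    have df: "((\<lambda>p. f (cinv ?c p)) has_derivative fderiv (\<lambda>p. f (cinv ?c p)) ?p) (at ?p)"
      by (rule has_fderiv[OF SF_differentiable[OF f(1) c(1) p(2)]])
    have dW: "((\<lambda>p. vf_rep A ?c W p \<bullet> b) has_derivative (\<lambda>h. fderiv (vf_rep A ?c W) ?p h \<bullet> b)) (at ?p)"
      by (rule has_derivative_inner_left[OF has_fderiv[OF VF_differentiable[OF W(1) c(1) p(2)]]])
    have "fderiv (\<lambda>p. g b (cinv ?c p)) ?p = fderiv (\<lambda>p. f (cinv ?c p) * (vf_rep A ?c W p \<bullet> b)) ?p"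
      by (rule fderiv_cong[OF p(1,2)]) (use g c(1) in simp)
    also have "\<dots> = (\<lambda>h. fderiv (vf_rep A ?c W) ?p h \<bullet> b)"
      using fderiv_eqI[OF has_derivative_mult[OF df dW]] W(2) f(2) p(3) by simp
    finally show "vf_apply A X (g b) x *\<^sub>R b = (fderiv (vf_rep A ?c W) ?p (X x) \<bullet> b) *\<^sub>R b"
      by (simp add: vf_apply_pt)
  qed
  also have "\<dots> = fderiv (vf_rep A ?c W) ?p (X x)" by (rule euclidean_representation)
  finally show ?thesis by simp
qed

text \<open>At a limit of coincidences the accelerations satisfy \<open>y'' = k^2 x''\<close> modulo
  the tangent, where \<open>k\<close> is the ratio of the velocities. By this amount
  \<open>D1 Y Y\<close> and \<open>k^2 D1 X X\<close> differ, so \<open>Y\<close> is geodesic at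
  \<open>x\<close> for \<open>D1\<close> as well as for \<open>D2\<close>.\<close>

lemma geodesic_contact:
  assumes D1: "connection_laws D1" and D2: "connection_laws D2"
    and \<gamma>: "immersed_curve A I \<gamma>" "t0 \<in> I" and \<delta>: "immersed_curve A J \<delta>" "s0 \<in> J"
    and X: "X \<in> VF" "\<forall>\<^sub>F t in nhds t0. X (\<gamma> t) = velocity A \<gamma> t" "D1 X X (\<gamma> t0) \<in> span {velocity A \<gamma> t0}"
    and Y: "Y \<in> VF" "\<forall>\<^sub>F s in nhds s0. Y (\<delta> s) = velocity A \<delta> s" "D2 Y Y (\<delta> s0) \<in> span {velocity A \<delta> s0}"
    and x: "\<gamma> t0 = x" "\<delta> s0 = x" and lines: "span {velocity A \<gamma> t0} = span {velocity A \<delta> s0}"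
    and Z: "(s0, t0) islimpt {(s, t). s \<in> J \<and> t \<in> I \<and> \<delta> s = \<gamma> t \<and> span {velocity A \<gamma> t} = span {velocity A \<delta> s}}"
  shows "D2 Y Y x - D1 Y Y x \<in> span {Y x}"
proof -
  let ?c = "chart_at A x"
  have c: "?c \<in> A" "x \<in> cdom ?c" by (rule chart_at)+
  have Xx: "X x = velocity A \<gamma> t0" and Yx: "Y x = velocity A \<delta> s0"
    using eventually_nhds_x_imp_x[OF X(2)] eventually_nhds_x_imp_x[OF Y(2)] x by simp_all
  have nz: "X x \<noteq> 0" using \<gamma> Xx by (simp add: immersed_curve_def)
  have "Y x \<in> span {X x}" using lines span_base[of "Y x" "{Y x}"] by (simp add: Xx Yx)
  then obtain k where k: "Y x = k *\<^sub>R X x" by (auto simp: span_singleton)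
  define x' where "x' t = vf_rep A ?c X (cmap ?c (\<gamma> t))" for t
  define y' where "y' s = vf_rep A ?c Y (cmap ?c (\<delta> s))" for s
  let ?x'' = "fderiv (vf_rep A ?c X) (pt A x) (X x)" let ?y'' = "fderiv (vf_rep A ?c Y) (pt A x) (Y x)"
  have x't: "x' t0 = X x" and y's: "y' s0 = Y x" by (simp_all add: x'_def y'_def x)
  obtain z where zZ: "\<And>n. z n \<in> {(s, t). s \<in> J \<and> t \<in> I \<and> \<delta> s = \<gamma> t \<and> span {velocity A \<gamma> t} = span {velocity A \<delta> s}} - {(s0, t0)}"
    and zl: "z \<longlonglongrightarrow> (s0, t0)"
    using Z unfolding islimpt_sequential by blast
  define \<sigma> where "\<sigma> n = fst (z n)" for n
  define \<tau> where "\<tau> n = snd (z n)" for n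
  have \<sigma>: "\<sigma> \<longlonglongrightarrow> s0" and \<tau>: "\<tau> \<longlonglongrightarrow> t0"
    using tendsto_fst[OF zl] tendsto_snd[OF zl] by (simp_all add: \<sigma>_def[abs_def] \<tau>_def[abs_def])
  have st: "\<sigma> n \<in> J" "\<tau> n \<in> I" "\<delta> (\<sigma> n) = \<gamma> (\<tau> n)" "span {velocity A \<gamma> (\<tau> n)} = span {velocity A \<delta> (\<sigma> n)}"
    "(\<sigma> n, \<tau> n) \<noteq> (s0, t0)" for n
    using zZ[of n] by (auto simp: \<sigma>_def \<tau>_def)
  have "?y'' - (k * k) *\<^sub>R ?x'' \<in> span {x' t0}"
  proof (rule second_order_contact[where x = "\<lambda>t. cmap ?c (\<gamma> t)" and y = "\<lambda>s. cmap ?c (\<delta> s)" and \<sigma> = \<sigma> and \<tau> = \<tau>])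
    show "((\<lambda>t. cmap ?c (\<gamma> t)) has_vector_derivative x' t0) (at t0)"
      using immersed_curve_derivative[OF \<gamma>, of ?c] c x by (simp add: x't Xx)
    show "((\<lambda>s. cmap ?c (\<delta> s)) has_vector_derivative y' s0) (at s0)"
      using immersed_curve_derivative[OF \<delta>, of ?c] c x by (simp add: y's Yx)
    show "(x' has_vector_derivative ?x'') (at t0)"
      using velocity_extension_derivative[OF \<gamma>, of ?c X] c x X(1,2) by (simp add: x'_def[abs_def] Xx)
    show "(y' has_vector_derivative ?y'') (at s0)"
      using velocity_extension_derivative[OF \<delta>, of ?c Y] c x Y(1,2) by (simp add: y'_def[abs_def] Yx)
    show "\<forall>\<^sub>F n in sequentially. cmap ?c (\<gamma> (\<tau> n)) = cmap ?c (\<delta> (\<sigma> n)) \<and> (\<exists>k. y' (\<sigma> n) = k *\<^sub>R x' (\<tau> n))"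
    proof -
      have e1: "\<forall>\<^sub>F n in sequentially. X (\<gamma> (\<tau> n)) = velocity A \<gamma> (\<tau> n)"
        by (rule eventually_compose_filterlim[OF X(2) \<tau>])
      have e2: "\<forall>\<^sub>F n in sequentially. Y (\<delta> (\<sigma> n)) = velocity A \<delta> (\<sigma> n)"
        by (rule eventually_compose_filterlim[OF Y(2) \<sigma>])
      have "\<forall>\<^sub>F t in nhds t0. t \<in> I \<and> \<gamma> t \<in> cdom ?c"
        by (rule eventually_immersed_curve_chart[OF \<gamma> c(1)]) (simp add: x c)
      from eventually_compose_filterlim[OF this \<tau>]
      have e3: "\<forall>\<^sub>F n in sequentially. \<tau> n \<in> I \<and> \<gamma> (\<tau> n) \<in> cdom ?c" .
      show ?thesis using e1 e2 e3
      proof eventually_elim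
        case (elim n)
        have "Y (\<delta> (\<sigma> n)) \<in> span {X (\<gamma> (\<tau> n))}"
          using st(4)[of n] span_base[of "velocity A \<delta> (\<sigma> n)" "{velocity A \<delta> (\<sigma> n)}"] elim by simp
        then obtain r where r: "Y (\<delta> (\<sigma> n)) = r *\<^sub>R X (\<gamma> (\<tau> n))" by (auto simp: span_singleton)
        have "y' (\<sigma> n) = r *\<^sub>R x' (\<tau> n)"
          using r elim(3) st(3)[of n] c(1) linear_cmul[OF linear_to_coords[OF c(1)]]
          by (simp add: x'_def y'_def vf_rep_cmap)
        then show ?case using st(3)[of n] by auto
      qed
    qed
  qed (use x't y's k nz x \<sigma> \<tau> st(5) in auto)
  then have main: "?y'' - (k * k) *\<^sub>R ?x'' \<in> span {X x}" by (simp add: x't)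
  \<comment> \<open>\<open>Y\<close> and \<open>k X\<close> agree at \<open>x\<close> but extend
    different curves; their difference enters only through its coordinate derivative.\<close>
  define W where "W = (\<lambda>y. Y y - k *\<^sub>R X y)"
  have kX: "(\<lambda>y. k *\<^sub>R X y) \<in> VF" by (rule VF_scale[OF SF_const X(1)])
  have W: "W \<in> VF" "W x = 0" using VF_diff[OF Y(1) kX] by (simp_all add: W_def k)
  have "D1 Y Y x = k *\<^sub>R D1 X Y x"
    using tensorial_cong[OF tensorial_connection[OF D1 Y(1)] Y(1) kX, where x = x] k
      connection_scale1[OF D1 X(1) Y(1) SF_const[of k], where x = x] by simp
  also have "D1 X Y x = k *\<^sub>R D1 X X x + D1 X W x"
    using connection_add2[OF D1 X(1) kX W(1), where x = x] connection_scale2[OF D1 X(1) X(1) SF_const[of k], where x = x]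
    by (simp add: W_def)
  also have "D1 X W x = fderiv (vf_rep A ?c W) (pt A x) (X x)"
    by (rule connection_vanishing_field[OF D1 X(1) W])
  also have "\<dots> = fderiv (vf_rep A ?c Y) (pt A x) (X x) - k *\<^sub>R ?x''"
  proof -
    have d: "(vf_rep A ?c V has_derivative fderiv (vf_rep A ?c V) (pt A x)) (at (pt A x))" if "V \<in> VF" for V
      by (rule has_fderiv[OF VF_differentiable[OF that c(1) cmap_ccod[OF c(2)]]])
    have "fderiv (vf_rep A ?c W) (pt A x) = fderiv (\<lambda>p. vf_rep A ?c Y p - k *\<^sub>R vf_rep A ?c X p) (pt A x)"
    proof (rule fderiv_cong[OF open_ccod[OF c(1)] cmap_ccod[OF c(2)]])
      fix p assume "p \<in> ccod ?c"
      then have "linear (to_coords A ?c (cinv ?c p))" by (intro linear_to_coords c cinv_cdom)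
      then show "vf_rep A ?c W p = vf_rep A ?c Y p - k *\<^sub>R vf_rep A ?c X p"
        by (simp add: vf_rep_def W_def linear_diff linear_cmul)
    qed
    then show ?thesis
      using fderiv_eqI[OF has_derivative_diff[OF d[OF Y(1)] has_derivative_scaleR_right[OF d[OF X(1)]]]] by simp
  qed
  finally have "D1 Y Y x = (k * k) *\<^sub>R D1 X X x + (k *\<^sub>R fderiv (vf_rep A ?c Y) (pt A x) (X x) - (k * k) *\<^sub>R ?x'')"
    by (simp add: algebra_simps)
  also have "k *\<^sub>R fderiv (vf_rep A ?c Y) (pt A x) (X x) = ?y''"
    unfolding k by (rule linear_cmul[symmetric, OF has_derivative_linear[OF has_fderiv[OF VF_differentiable[OF Y(1) c(1) cmap_ccod[OF c(2)]]]]])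
  finally have D1Y: "D1 Y Y x \<in> span {X x}"
    using main X(3) x by (simp add: Xx span_add span_scale)
  have "D2 Y Y x \<in> span {X x}" using Y(3) lines x by (simp add: Xx)
  then have "D2 Y Y x - D1 Y Y x \<in> span {X x}" using D1Y by (rule span_diff)
  then show ?thesis using lines by (simp add: Xx Yx)
qed

text \<open>If the difference of the two connections were transversal to the path at one point, then
  it would be so along a whole arc, and by the previous lemma the arc would be
  covered by the countably many isolated coincidences of the two parametrisations.\<close>

lemma common_geodesic_difference:
  assumes D1: "connection_laws D1" and D2: "connection_laws D2"
    and P: "unparam_geodesic A D1 P" "unparam_geodesic A D2 P" "(x, L) \<in> P"
  shows "\<exists>Y\<in>VF. Y x \<noteq> 0 \<and> L = span {Y x} \<and> D2 Y Y x - D1 Y Y x \<in> span {Y x}"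
proof -
  obtain I \<gamma> where \<gamma>: "immersed_curve A I \<gamma>" "P = tangent_lines A I \<gamma>"
    and X: "\<And>t. t \<in> I \<Longrightarrow> \<exists>X\<in>VF. (\<forall>\<^sub>F s in nhds t. X (\<gamma> s) = velocity A \<gamma> s) \<and> D1 X X (\<gamma> t) \<in> span {velocity A \<gamma> t}"
    using P(1) unfolding unparam_geodesic_def by blast
  obtain J \<delta> where \<delta>: "immersed_curve A J \<delta>" "P = tangent_lines A J \<delta>"
    and Y: "\<And>t. t \<in> J \<Longrightarrow> \<exists>X\<in>VF. (\<forall>\<^sub>F s in nhds t. X (\<delta> s) = velocity A \<delta> s) \<and> D2 X X (\<delta> t) \<in> span {velocity A \<delta> t}"
    using P(2) unfolding unparam_geodesic_def by blast
  obtain s0 where s0: "s0 \<in> J" "x = \<delta> s0" "L = span {velocity A \<delta> s0}"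
    using P(3) \<delta>(2) unfolding tangent_lines_def by blast
  obtain Y0 where Y0: "Y0 \<in> VF" "\<forall>\<^sub>F s in nhds s0. Y0 (\<delta> s) = velocity A \<delta> s" using Y[OF s0(1)] by blast
  have Y0x: "Y0 x = velocity A \<delta> s0" using eventually_nhds_x_imp_x[OF Y0(2)] s0 by simp
  have nz: "velocity A \<delta> s \<noteq> 0" if "s \<in> J" for s using \<delta>(1) that by (simp add: immersed_curve_def)
  define Q where "Q X = (\<lambda>x. D2 X X x - D1 X X x)" for X
  \<comment> \<open>Changing the extension adds the same coordinate derivative for both connections,
    which cancels. This allows a return from an extension at a nearby parameter to the fixed field
    \<open>Y0\<close>.\<close>
  have Q: "Q X y = Q X' y" if V: "X \<in> VF" "X' \<in> VF" and e: "X y = X' y" for X X' y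
  proof -
    define W where "W = (\<lambda>y. X' y - X y)"
    have W: "W \<in> VF" "W y = 0" using VF_diff[OF V(2,1)] e by (simp_all add: W_def)
    have "D X' X' y = D X X y + fderiv (vf_rep A (chart_at A y) W) (pt A y) (X y)" if D: "connection_laws D" for D
    proof -
      have "D X' X' y = D X X' y" using tensorial_cong[OF tensorial_connection[OF D V(2)] V, where x = y] e by simp
      also have "\<dots> = D X X y + D X W y" using connection_add2[OF D V(1) V(1) W(1), where x = y] by (simp add: W_def)
      finally show ?thesis using connection_vanishing_field[OF D V(1) W] by simp
    qed
    from this[OF D1] this[OF D2] show ?thesis by (simp add: Q_def)
  qed
  have QY: "Q Y0 \<in> VF" unfolding Q_def by (intro VF_diff VF_connection[OF D1] VF_connection[OF D2] Y0)
  have "Q Y0 x \<in> span {Y0 x}"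
  proof (rule ccontr)
    assume not: "Q Y0 x \<notin> span {Y0 x}"
    let ?c = "chart_at A x"
    have c: "?c \<in> A" "x \<in> cdom ?c" by (rule chart_at)+
    \<comment> \<open>The Cauchy-Schwarz defect of \<open>Q Y0\<close> against \<open>Y0\<close>; it
      is nonzero at \<open>x\<close>, hence along an arc.\<close>
    define h where "h p = (vf_rep A ?c (Q Y0) p \<bullet> vf_rep A ?c (Q Y0) p) * (vf_rep A ?c Y0 p \<bullet> vf_rep A ?c Y0 p)
       - (vf_rep A ?c (Q Y0) p \<bullet> vf_rep A ?c Y0 p) * (vf_rep A ?c (Q Y0) p \<bullet> vf_rep A ?c Y0 p)" for p
    have "smooth_on (ccod ?c) h"
      unfolding h_def[abs_def] by (intro smooth_on_diff smooth_on_mult smooth_on_inner open_ccod c VF_smooth QY Y0)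
    then have "isCont h (cmap ?c (\<delta> s0))"
      using smooth_on_differentiable differentiable_imp_continuous_within cmap_ccod[OF c(2)] s0(2) by blast
    moreover have "isCont (\<lambda>s. cmap ?c (\<delta> s)) s0"
      using has_vector_derivative_continuous[OF immersed_curve_derivative[OF \<delta>(1) s0(1) c(1)]] c(2) s0(2) by simp
    ultimately have "isCont (\<lambda>s. h (cmap ?c (\<delta> s))) s0" by (rule isCont_o2[rotated])
    moreover have "h (cmap ?c (\<delta> s0)) \<noteq> 0"
    proof -
      have "Y0 x \<noteq> 0" using nz[OF s0(1)] Y0x by simp
      from span_singleton_iff_Cauchy_Schwarz[OF this, of "Q Y0 x"] show ?thesis using not by (simp add: h_def s0(2)[symmetric])
    qed
    ultimately have h: "\<forall>\<^sub>F s in nhds s0. h (cmap ?c (\<delta> s)) \<noteq> 0"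
      using tendsto_imp_eventually_ne[of "\<lambda>s. h (cmap ?c (\<delta> s))" _ "at s0" 0]
      by (simp add: isCont_def eventually_nhds_conv_at)
    have "\<forall>\<^sub>F s in nhds s0. s \<in> J \<and> \<delta> s \<in> cdom ?c"
      by (rule eventually_immersed_curve_chart[OF \<delta>(1) s0(1) c(1)]) (use c s0 in simp)
    with h Y0(2) have "\<forall>\<^sub>F s in nhds s0. s \<in> J \<and> Y0 (\<delta> s) = velocity A \<delta> s \<and> Q Y0 (\<delta> s) \<notin> span {Y0 (\<delta> s)}"
    proof eventually_elim
      case (elim s)
      have l: "linear (to_coords A ?c (\<delta> s))" by (intro linear_to_coords c) (use elim in blast)
      have "Q Y0 (\<delta> s) \<notin> span {Y0 (\<delta> s)}"
      proof
        assume "Q Y0 (\<delta> s) \<in> span {Y0 (\<delta> s)}"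
        then obtain k where k: "Q Y0 (\<delta> s) = k *\<^sub>R Y0 (\<delta> s)" by (auto simp: span_singleton)
        have "vf_rep A ?c (Q Y0) (cmap ?c (\<delta> s)) = k *\<^sub>R vf_rep A ?c Y0 (cmap ?c (\<delta> s))"
          using elim c(1) k linear_cmul[OF l] by (simp add: vf_rep_cmap)
        then show False using elim(1) by (simp add: h_def)
      qed
      then show ?case using elim by blast
    qed
    then obtain N where N: "open N" "s0 \<in> N"
      and Ns: "\<And>s. s \<in> N \<Longrightarrow> s \<in> J \<and> Y0 (\<delta> s) = velocity A \<delta> s \<and> Q Y0 (\<delta> s) \<notin> span {Y0 (\<delta> s)}"
      unfolding eventually_nhds by blast
    define Z where "Z = {(s, t). s \<in> J \<and> t \<in> I \<and> \<delta> s = \<gamma> t \<and> span {velocity A \<gamma> t} = span {velocity A \<delta> s}}"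
    \<comment> \<open>Both parameterisations have the same set of tangent lines, so each parameter
      in \<open>N\<close> has a partner \<open>t\<close>. There may be several, whence a set of
      pairs instead of a function.\<close>
    have "N \<subseteq> fst ` (Z \<inter> N \<times> UNIV)"
    proof
      fix s assume s: "s \<in> N"
      then have "(\<delta> s, span {velocity A \<delta> s}) \<in> tangent_lines A I \<gamma>"
        using \<gamma>(2) \<delta>(2) Ns unfolding tangent_lines_def by blast
      then obtain t where "t \<in> I" "\<delta> s = \<gamma> t" "span {velocity A \<delta> s} = span {velocity A \<gamma> t}"
        unfolding tangent_lines_def by blast
      then have "(s, t) \<in> Z \<inter> N \<times> UNIV" using s Ns by (simp add: Z_def)
      then show "s \<in> fst ` (Z \<inter> N \<times> UNIV)" by force
    qed
    moreover have "uncountable N"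
    proof -
      obtain e where "e > 0" "ball s0 e \<subseteq> N" using N openE by blast
      then have "{s0 - e<..<s0 + e} \<subseteq> N" by (simp add: ball_eq_greaterThanLessThan)
      then show ?thesis using uncountable_open_interval[of "s0 - e" "s0 + e"] \<open>e > 0\<close> countable_subset by auto
    qed
    ultimately have "uncountable (Z \<inter> N \<times> UNIV)" using countable_image countable_subset by blast
    then obtain s t where st: "(s, t) \<in> Z \<inter> N \<times> UNIV" "(s, t) islimpt Z \<inter> N \<times> UNIV"
      using uncountable_imp_limit_point by (metis surj_pair)
    then have s: "s \<in> N" "s \<in> J" "t \<in> I" "\<delta> s = \<gamma> t" "span {velocity A \<gamma> t} = span {velocity A \<delta> s}"
      by (auto simp: Z_def)
    have lim: "(s, t) islimpt Z" by (rule islimpt_subset[OF st(2)]) blast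
    obtain X1 where X1: "X1 \<in> VF" "\<forall>\<^sub>F t in nhds t. X1 (\<gamma> t) = velocity A \<gamma> t" "D1 X1 X1 (\<gamma> t) \<in> span {velocity A \<gamma> t}"
      using X[OF s(3)] by blast
    obtain Y1 where Y1: "Y1 \<in> VF" "\<forall>\<^sub>F s in nhds s. Y1 (\<delta> s) = velocity A \<delta> s" "D2 Y1 Y1 (\<delta> s) \<in> span {velocity A \<delta> s}"
      using Y[OF s(2)] by blast
    have "D2 Y1 Y1 (\<gamma> t) - D1 Y1 Y1 (\<gamma> t) \<in> span {Y1 (\<gamma> t)}"
      by (rule geodesic_contact[OF D1 D2 \<gamma>(1) s(3) \<delta>(1) s(2) X1 Y1 refl s(4) s(5) lim[unfolded Z_def]])
    moreover have "Y1 (\<gamma> t) = Y0 (\<gamma> t)"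
      using eventually_nhds_x_imp_x[OF Y1(2)] Ns[OF s(1)] s(4) by simp
    ultimately have "Q Y0 (\<delta> s) \<in> span {Y0 (\<delta> s)}"
      using Q[OF Y1(1) Y0(1), of "\<gamma> t"] s(4) by (simp add: Q_def)
    then show False using Ns[OF s(1)] by blast
  qed
  then show ?thesis using Y0 Y0x s0 nz[OF s0(1)] by (intro bexI[of _ Y0]) (simp_all add: Q_def)
qed

end

section \<open>Uniqueness of the connection\<close>

text \<open>Write \<open>q u u = l u *\<^sub>R u\<close>. For independent \<open>u\<close> and
  \<open>v\<close>, the parallelogram identity gives \<open>l (u + v) + l (u - v) = 2 * l u\<close>
  and \<open>l (u + v) - l (u - v) = 2 * l v\<close>, hence additivity; dependent pairs follow from
  homogeneity, and the mixed values by polarisation.\<close>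

lemma radial_quadratic:
  fixes q :: "'a::real_vector \<Rightarrow> 'a \<Rightarrow> 'a"
  assumes q: "\<And>v. linear (\<lambda>u. q u v)" "\<And>u. linear (q u)" and S: "subspace S"
    and radial: "\<And>u. u \<in> S \<Longrightarrow> q u u \<in> span {u}"
  obtains l where "\<And>u v. u \<in> S \<Longrightarrow> v \<in> S \<Longrightarrow> l (u + v) = l u + l v"
    "\<And>r u. u \<in> S \<Longrightarrow> l (r *\<^sub>R u) = r * l u"
    "\<And>u v. u \<in> S \<Longrightarrow> v \<in> S \<Longrightarrow> q u v + q v u = l u *\<^sub>R v + l v *\<^sub>R u"
proof -
  note lin = linear_add[OF q(1)] linear_add[OF q(2)] linear_cmul[OF q(1)] linear_cmul[OF q(2)]
    linear_diff[OF q(1)] linear_diff[OF q(2)]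
  \<comment> \<open>The equation leaves the factor at \<open>u = 0\<close> free; linearity of
    \<open>l\<close> forces the value 0.\<close>
  have "\<exists>k. u \<in> S \<longrightarrow> q u u = k *\<^sub>R u \<and> (u = 0 \<longrightarrow> k = 0)" for u
  proof (cases "u \<in> S \<and> u \<noteq> 0")
    case True
    then show ?thesis using radial[of u] by (auto simp: span_singleton)
  next
    case False
    then show ?thesis using linear_0[OF q(2)] by (intro exI[of _ 0]) auto
  qed
  then have "\<forall>u. \<exists>k. u \<in> S \<longrightarrow> q u u = k *\<^sub>R u \<and> (u = 0 \<longrightarrow> k = 0)" by blast
  from choice[OF this] obtain l where l0: "\<forall>u. u \<in> S \<longrightarrow> q u u = l u *\<^sub>R u \<and> (u = 0 \<longrightarrow> l u = 0)" ..
  have l: "q u u = l u *\<^sub>R u" if "u \<in> S" for u using l0 that by blast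
  have z: "l 0 = 0" using l0 subspace_0[OF S] by blast
  have scale: "l (r *\<^sub>R u) = r * l u" if u: "u \<in> S" for r u
  proof (cases "r *\<^sub>R u = 0")
    case True
    then have "r = 0 \<or> u = 0" by simp
    then show ?thesis using z by auto
  next
    case False
    have "l (r *\<^sub>R u) *\<^sub>R (r *\<^sub>R u) = q (r *\<^sub>R u) (r *\<^sub>R u)" using l[OF subspace_scale[OF S u]] by simp
    also have "\<dots> = (r * l u) *\<^sub>R (r *\<^sub>R u)" by (simp add: lin l[OF u])
    finally show ?thesis using False by (metis scaleR_right_imp_eq)
  qed
  have add: "l (u + v) = l u + l v" if u: "u \<in> S" and v: "v \<in> S" for u v
  proof (cases "u = 0")
    case False
    show ?thesis
    proof (cases "v \<in> span {u}")
      case True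
      then obtain k where k: "v = k *\<^sub>R u" by (auto simp: span_singleton)
      have "u + v = (1 + k) *\<^sub>R u" by (simp add: k algebra_simps)
      then show ?thesis using scale[OF u, of "1 + k"] scale[OF u, of k] by (simp add: k algebra_simps)
    next
      case False
      have uv: "u + v \<in> S" "u - v \<in> S" using S u v by (auto intro: subspace_add subspace_diff)
      have "q (u + v) (u + v) + q (u - v) (u - v) = 2 *\<^sub>R q u u + 2 *\<^sub>R q v v"
        by (simp add: lin scaleR_2)
      then have "l (u + v) *\<^sub>R (u + v) + l (u - v) *\<^sub>R (u - v) = 2 *\<^sub>R l u *\<^sub>R u + 2 *\<^sub>R l v *\<^sub>R v"
        by (simp only: l uv u v)
      then have *: "(l (u + v) - l (u - v) - 2 * l v) *\<^sub>R v = (2 * l u - l (u + v) - l (u - v)) *\<^sub>R u"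
        by (simp add: algebra_simps)
      have 1: "l (u + v) - l (u - v) - 2 * l v = 0"
      proof (rule ccontr)
        assume n: "l (u + v) - l (u - v) - 2 * l v \<noteq> 0"
        define r where "r = l (u + v) - l (u - v) - 2 * l v"
        have "v = inverse r *\<^sub>R (r *\<^sub>R v)" using n by (simp add: r_def)
        then have "v = (inverse r * (2 * l u - l (u + v) - l (u - v))) *\<^sub>R u" unfolding r_def * by simp
        then have "v \<in> span {u}" unfolding span_singleton by blast
        then show False using False by blast
      qed
      then have "2 * l u - l (u + v) - l (u - v) = 0" using * \<open>u \<noteq> 0\<close> by simp
      with 1 show ?thesis by simp
    qed
  qed (simp add: z)
  have pol: "q u v + q v u = l u *\<^sub>R v + l v *\<^sub>R u" if u: "u \<in> S" and v: "v \<in> S" for u v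
  proof -
    have "q (u + v) (u + v) = l (u + v) *\<^sub>R (u + v)" by (rule l[OF subspace_add[OF S u v]])
    then have "q u u + q v v + (q u v + q v u) = (l u + l v) *\<^sub>R (u + v)"
      by (simp add: lin add u v algebra_simps)
    then show ?thesis by (simp add: l u v algebra_simps)
  qed
  show thesis by (rule that[OF add scale pol])
qed

section \<open>The difference tensor of two solutions\<close>

context contact_form
begin

lemma difference_tensor_zero:
  assumes q: "\<And>v. linear (\<lambda>u. q u v)" "\<And>u. linear (q u)"
    and \<theta>q: "\<And>u v. \<theta> x (q u v) = 0"
    and \<Omega>q: "\<And>u v w. \<Omega> x (q u v) w + \<Omega> x v (q u w) = 0"
    and qT: "\<And>v. q (T x) v = q v (T x)"
    and tr: "\<And>u. endo_trace (\<lambda>v. q u v - q v u) = 0"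
    and geo: "\<And>u. \<theta> x u = 0 \<Longrightarrow> q u u \<in> span {u}"
  shows "q u v = 0"
proof -
  have zero: "w = 0" if "\<theta> x w = 0" "\<And>v. \<Omega> x w v = 0" for w
    using nondegenerate[OF that(1)] that(2) by blast
  \<comment> \<open>With \<open>T\<close> as second argument the other term of the compatibility
    with \<Omega> disappears; together with \<open>qT\<close> this confines the tensor to
    \<open>H\<close>.\<close>
  have qT2: "q u (T x) = 0" for u
    by (rule zero) (use \<theta>q \<Omega>q[of u "T x"] in simp_all)
  have qT1: "q (T x) v = 0" for v using qT qT2 by simp
  have q_pr: "q (pr x u) v = q u v" "q u (pr x v) = q u v" for u v
    using qT1 qT2 by (simp_all add: pr_def linear_diff[OF q(1)] linear_diff[OF q(2)] linear_cmul[OF q(1)] linear_cmul[OF q(2)])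
  have S: "subspace {u. \<theta> x u = 0}" by (auto simp: subspace_def \<theta>_simps)
  obtain l where l: "\<And>u v. \<theta> x u = 0 \<Longrightarrow> \<theta> x v = 0 \<Longrightarrow> l (u + v) = l u + l v"
    "\<And>r u. \<theta> x u = 0 \<Longrightarrow> l (r *\<^sub>R u) = r * l u"
    "\<And>u v. \<theta> x u = 0 \<Longrightarrow> \<theta> x v = 0 \<Longrightarrow> q u v + q v u = l u *\<^sub>R v + l v *\<^sub>R u"
    by (rule radial_quadratic[OF q S]) (use geo in auto)
  define a where "a u = l (pr x u)" for u
  have la: "linear a"
    by (rule linearI) (simp_all add: a_def linear_add[OF linear_pr] linear_cmul[OF linear_pr] l)
  have sym: "q u v + q v u = a u *\<^sub>R pr x v + a v *\<^sub>R pr x u" for u v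
    using l(3)[of "pr x u" "pr x v"] by (simp add: q_pr a_def)
  \<comment> \<open>Because the values of \<open>q\<close> are horizontal, skewness for \<Omega> is
    skewness for \<open>B\<close>, which is nondegenerate on the whole tangent space where the trace
    is taken.\<close>
  have skew_tr: "endo_trace (q u) = 0" for u
  proof (rule skew_endo_trace_zero[OF q(2) linear_B])
    show "w = 0" if "\<And>v. B x w v = 0" for w using B_nondegenerate[OF that] .
    show "B x (q u v) w = - B x v (q u w)" for v w
      using \<Omega>q[of u v w] by (simp add: B_def \<theta>q)
  qed
  have "a u = 0" for u
  proof -
    have id: "pr x = (\<lambda>v. v - \<theta> x v *\<^sub>R T x)" by (auto simp: pr_def)
    have tr_pr: "endo_trace (pr x) = real DIM('a) - 1"
      unfolding id by (simp add: endo_trace_diff endo_trace_id endo_trace_rank_one[OF linear_form])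
    \<comment> \<open>Both terms on the right are trace-free, the second by the trace condition. The
      left-hand side has trace \<open>(m - 1) * a u + a u\<close>, with \<open>m\<close> the
      dimension.\<close>
    have "(\<lambda>v. a u *\<^sub>R pr x v + a v *\<^sub>R pr x u) = (\<lambda>v. (2::real) *\<^sub>R q u v - (q u v - q v u))"
      using sym[of u] by (auto simp: scaleR_2)
    then have "endo_trace (\<lambda>v. a u *\<^sub>R pr x v + a v *\<^sub>R pr x u) = 2 * endo_trace (q u) - endo_trace (\<lambda>v. q u v - q v u)"
      by (simp only: endo_trace_diff endo_trace_scale)
    then have "a u * (real DIM('a) - 1) + a (pr x u) = 0"
      using skew_tr tr by (simp only: endo_trace_add endo_trace_scale tr_pr endo_trace_rank_one[OF la] mult_zero_right diff_0_right)
    moreover have "a (pr x u) = a u" by (simp add: a_def pr_horizontal)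
    ultimately have "a u * real DIM('a) = 0" by (simp add: algebra_simps)
    then show ?thesis by simp
  qed
  then have anti: "q u v = - q v u" for u v using sym[of u v] by (simp add: eq_neg_iff_add_eq_0)
  have f2: "\<Omega> x (q u v) w = \<Omega> x (q u w) v" for u v w
    using \<Omega>q[of u v w] ext_deriv_swap[of x v "q u w"] by simp
  have f1: "\<Omega> x (q u v) w = - \<Omega> x (q v u) w" for u v w
    using anti[of u v] by (simp add: \<Omega>_simps)
  show ?thesis
  proof (rule zero[OF \<theta>q])
    \<comment> \<open>The product of the two transpositions of arguments has order three: applying
      them alternately, three times each, restores the arguments and leaves three minus
      signs.\<close>
    fix w
    have "\<Omega> x (q u v) w = \<Omega> x (q u w) v" by (rule f2)
    also have "\<dots> = - \<Omega> x (q w u) v" by (rule f1)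
    also have "\<dots> = - \<Omega> x (q w v) u" by (simp only: f2[of w u v])
    also have "\<dots> = \<Omega> x (q v w) u" by (simp only: f1[of w v u])
    also have "\<dots> = \<Omega> x (q v u) w" by (rule f2)
    also have "\<dots> = - \<Omega> x (q u v) w" by (rule f1)
    finally show "\<Omega> x (q u v) w = 0" by simp
  qed
qed

text \<open>The paths enter only through \<open>geo\<close>, which provides for each horizontal line
  one field on which the difference is radial; tensoriality and homogeneity carry this to all
  vectors of the line.\<close>

lemma connection_unique:
  assumes D: "connection_laws D1" "connection_laws D2"
    and c1: "\<And>D X Y x. D \<in> {D1, D2} \<Longrightarrow> X \<in> VF \<Longrightarrow> Y \<in> VF \<Longrightarrow> cov_deriv1 A D \<theta> X Y x = 0"
    and c2: "\<And>D X Y Z x. D \<in> {D1, D2} \<Longrightarrow> X \<in> VF \<Longrightarrow> Y \<in> VF \<Longrightarrow> Z \<in> VF \<Longrightarrow> cov_deriv2 A D \<Omega> X Y Z x = 0"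
    and c3: "\<And>D X x. D \<in> {D1, D2} \<Longrightarrow> X \<in> VF \<Longrightarrow> torsion A D T X x = 0"
    and c4: "\<And>D X x. D \<in> {D1, D2} \<Longrightarrow> X \<in> VF \<Longrightarrow> endo_trace (endo_at A (torsion A D X) x) = 0"
    and geo: "\<And>x L. subspace L \<Longrightarrow> dim L = 1 \<Longrightarrow> L \<subseteq> {v. \<theta> x v = 0} \<Longrightarrow>
       \<exists>Y\<in>VF. Y x \<noteq> 0 \<and> L = span {Y x} \<and> D2 Y Y x - D1 Y Y x \<in> span {Y x}"
    and X: "X \<in> VF" and Y: "Y \<in> VF"
  shows "D1 X Y x = D2 X Y x"
proof -
  define Q where "Q X Y x = D2 X Y x - D1 X Y x" for X Y x
  have t1: "tensorial (\<lambda>X. Q X Y)" if "Y \<in> VF" for Y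
    by (rule tensorialI) (simp_all add: Q_def that connection_add1[OF D(1)] connection_add1[OF D(2)]
      connection_scale1[OF D(1)] connection_scale1[OF D(2)] algebra_simps)
  have t2: "tensorial (Q X)" if "X \<in> VF" for X
    by (rule tensorialI) (simp_all add: Q_def that connection_add2[OF D(1)] connection_add2[OF D(2)]
      connection_scale2[OF D(1)] connection_scale2[OF D(2)] algebra_simps)
  define q where "q u v = Q (extend x u) (extend x v) x" for u v
  have Qq: "Q U V x = q (U x) (V x)" if "U \<in> VF" "V \<in> VF" for U V
    using tensorial_extend[OF t1[OF that(2)] that(1), of x] tensorial_extend[OF t2[OF extend(1)] that(2), of x "U x" x]
    by (simp add: q_def)
  have ev: "q u v = Q (extend x u) (extend x v) x" for u v by (simp add: q_def)
  have "q (X x) (Y x) = 0"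
  proof (rule difference_tensor_zero[of q x])
    show "linear (\<lambda>u. q u v)" "linear (q v)" for v
      unfolding q_def[abs_def] using linear_tensorial[OF t1[OF extend(1)], of x] linear_tensorial[OF t2[OF extend(1)], of x]
      by simp_all
    show "\<theta> x (q u v) = 0" for u v
      using c1[of D1 "extend x u" "extend x v" x] c1[of D2 "extend x u" "extend x v" x]
      by (simp add: ev Q_def \<theta>_simps cov_deriv1_def)
    show "\<Omega> x (q u v) w + \<Omega> x v (q u w) = 0" for u v w
      using c2[of D1 "extend x u" "extend x v" "extend x w" x] c2[of D2 "extend x u" "extend x v" "extend x w" x]
      by (simp add: ev Q_def \<Omega>_simps cov_deriv2_def)
    have tor: "torsion A D2 U V x - torsion A D1 U V x = q (U x) (V x) - q (V x) (U x)" if "U \<in> VF" "V \<in> VF" for U V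
      using Qq[OF that] Qq[OF that(2,1)] by (simp add: torsion_def Q_def algebra_simps)
    show "q (T x) v = q v (T x)" for v
      using tor[OF reeb(1) extend(1), of x v] c3[of D1 "extend x v" x] c3[of D2 "extend x v" x] by simp
    show "endo_trace (\<lambda>v. q u v - q v u) = 0" for u
    proof -
      have "(\<lambda>v. q u v - q v u) = (\<lambda>v. torsion A D2 (extend x u) (extend x v) x - torsion A D1 (extend x u) (extend x v) x)"
        using tor[OF extend(1) extend(1), of x u x] by auto
      then show ?thesis
        using c4[of D1 "extend x u" x] c4[of D2 "extend x u" x]
        by (simp add: endo_trace_diff endo_at_tensorial tensorial_torsion D)
    qed
    show "q u u \<in> span {u}" if u: "\<theta> x u = 0" for u
    proof (cases "u = 0")
      case True
      have "linear (q u)" unfolding q_def[abs_def] by (rule linear_tensorial[OF t2[OF extend(1)]])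
      then show ?thesis using True linear_0 by (auto simp: span_zero)
    next
      case False
      have "span {u} \<subseteq> {v. \<theta> x v = 0}" by (auto simp: span_singleton \<theta>_simps u)
      then obtain V where V: "V \<in> VF" "V x \<noteq> 0" "span {u} = span {V x}" "Q V V x \<in> span {V x}"
        using geo[of "span {u}" x] False by (auto simp: Q_def)
      have "u \<in> span {V x}" using V(3) span_base[of u "{u}"] by simp
      then obtain k where k: "u = k *\<^sub>R V x" by (auto simp: span_singleton)
      have "linear (q u)" "linear (\<lambda>u. q u (V x))"
        unfolding q_def[abs_def] using linear_tensorial[OF t2[OF extend(1)]] linear_tensorial[OF t1[OF extend(1)], of x] by simp_all
      then have "q u u = (k * k) *\<^sub>R Q V V x"
        using Qq[OF V(1) V(1)] linear_cmul[of "q u" k "V x"] linear_cmul[of "\<lambda>u. q u (V x)" k "V x"] k by simp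
      then show ?thesis using V(3,4) by (simp add: span_scale)
    qed
  qed
  then show ?thesis using Qq[OF X Y] by (simp add: Q_def)
qed

end

text \<open>A contact form is only required to annihilate \<open>H\<close>; that its kernel is no
  larger is a dimension count.\<close>

lemma hyperplane_eq_kernel:
  fixes f :: "'a::euclidean_space \<Rightarrow> real"
  assumes f: "linear f" "f v \<noteq> 0" and S: "subspace S" "dim S = DIM('a) - 1" "\<And>u. u \<in> S \<Longrightarrow> f u = 0"
  shows "S = {u. f u = 0}"
proof (rule subspace_dim_equal[OF S(1)])
  show ker: "subspace {u. f u = 0}"
    by (auto simp: subspace_def linear_add[OF f(1)] linear_cmul[OF f(1)] linear_0[OF f(1)])
  show "S \<subseteq> {u. f u = 0}" using S(3) by blast
  have "{u. f u = 0} \<noteq> UNIV" using f(2) by blast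
  then have "dim {u. f u = 0} \<noteq> DIM('a)" using dim_eq_full[of "{u. f u = 0}"] span_eq_iff ker by metis
  then show "dim {u. f u = 0} \<le> dim S" using S(2) dim_subset_UNIV[of "{u. f u = 0}"] by simp
qed

theorem theoremA:
  fixes A :: "('m::{t2_space,second_countable_topology}, 'a::euclidean_space) chart set"
    and H :: "'m \<Rightarrow> 'a set"
    and \<omega> :: "'m \<Rightarrow> ('a \<Rightarrow> real) set"
    and F :: "('m \<times> 'a set) set set"
    and \<theta> :: "'m \<Rightarrow> 'a \<Rightarrow> real"
    and n :: nat
  assumes "n \<ge> 2" and "DIM('a) = 2 * n - 1" and "DIM('b::euclidean_space) = 4 * n - 5"
    and "contact_manifold A H \<omega>"
    and "contact_projective_structure TYPE('b) A H F"
    and "contact_form_on A H UNIV \<theta>"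
  shows "\<exists>!nabla. affine_connection A nabla \<and>
    (\<forall>P\<in>F. unparam_geodesic A nabla P) \<and>
    (\<forall>X\<in>vector_fields A. \<forall>Y\<in>vector_fields A. \<forall>x. cov_deriv1 A nabla \<theta> X Y x = 0) \<and>
    (\<forall>X\<in>vector_fields A. \<forall>Y\<in>vector_fields A. \<forall>Z\<in>vector_fields A. \<forall>x.
       cov_deriv2 A nabla (ext_deriv A \<theta>) X Y Z x = 0) \<and>
    (\<forall>X\<in>vector_fields A. \<forall>x. torsion A nabla (reeb A \<theta>) X x = 0) \<and>
    (\<forall>Y\<in>vector_fields A. \<forall>x. endo_trace (endo_at A (torsion A nabla Y) x) = 0)"
proof -
  have one_form: "one_form_on A UNIV \<theta>" and nz: "\<And>x. \<exists>v. \<theta> x v \<noteq> 0" and van: "\<And>x v. v \<in> H x \<Longrightarrow> \<theta> x v = 0"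
    using assms(6) unfolding contact_form_on_def by blast+
  have cm: "smooth_atlas A" "hyperplane_distribution A H" "maximally_nonintegrable A H"
    using assms(4) unfolding contact_manifold_def by blast+
  have H: "H x = {v. \<theta> x v = 0}" for x
  proof -
    obtain v where "\<theta> x v \<noteq> 0" using nz by blast
    moreover have "linear (\<theta> x)" using one_form by (simp add: one_form_on_def)
    moreover have "subspace (H x)" "dim (H x) = DIM('a) - 1" using cm(2) by (simp_all add: hyperplane_distribution_def)
    ultimately show ?thesis by (intro hyperplane_eq_kernel van) 
  qed
  interpret contact_form A \<theta>
  proof unfold_locales
    fix x u assume "\<theta> x u = 0" "\<And>v. \<theta> x v = 0 \<Longrightarrow> ext_deriv A \<theta> x u v = 0"
    moreover have "\<forall>x\<in>UNIV. \<forall>u\<in>H x. (\<forall>v\<in>H x. ext_deriv A \<theta> x u v = 0) \<longrightarrow> u = 0"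
      using cm(3) assms(6) open_UNIV unfolding maximally_nonintegrable_def by blast
    ultimately show "u = 0" by (simp add: H)
  qed (use cm(1) one_form nz in simp_all)
  have paths: "\<And>x L. subspace L \<Longrightarrow> dim L = 1 \<Longrightarrow> L \<subseteq> H x \<Longrightarrow> \<exists>P\<in>F. (x, L) \<in> P"
    and horizontal: "\<And>P x L. P \<in> F \<Longrightarrow> (x, L) \<in> P \<Longrightarrow> L \<subseteq> H x"
    using assms(5) unfolding contact_projective_structure_def contact_path_geometry_def by blast+
  let ?conds = "\<lambda>nabla. affine_connection A nabla \<and>
    (\<forall>P\<in>F. unparam_geodesic A nabla P) \<and>
    (\<forall>X\<in>VF. \<forall>Y\<in>VF. \<forall>x. cov_deriv1 A nabla \<theta> X Y x = 0) \<and>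
    (\<forall>X\<in>VF. \<forall>Y\<in>VF. \<forall>Z\<in>VF. \<forall>x. cov_deriv2 A nabla (ext_deriv A \<theta>) X Y Z x = 0) \<and>
    (\<forall>X\<in>VF. \<forall>x. torsion A nabla (reeb A \<theta>) X x = 0) \<and>
    (\<forall>Y\<in>VF. \<forall>x. endo_trace (endo_at A (torsion A nabla Y) x) = 0)"
  have "\<exists>nabla. ?conds nabla"
  proof -
    obtain D where D_geo: "affine_connection A D" "\<And>P. P \<in> F \<Longrightarrow> unparam_geodesic A D P"
      using assms(5) unfolding contact_projective_structure_def by blast
    interpret contact_connection A \<theta> D
      by unfold_locales (rule affine_connection_laws[OF D_geo(1)])
    obtain nab where laws: "connection_laws nab"
      and geo: "\<And>X x. X \<in> VF \<Longrightarrow> \<theta> x (X x) = 0 \<Longrightarrow> vf_apply A X (\<lambda>x. \<theta> x (X x)) x = 0 \<Longrightarrow>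
       D X X x \<in> span {X x} \<Longrightarrow> nab X X x \<in> span {X x}"
      and c1: "\<And>X Y x. X \<in> VF \<Longrightarrow> Y \<in> VF \<Longrightarrow> cov_deriv1 A nab \<theta> X Y x = 0"
      and c2: "\<And>X Y Z x. X \<in> VF \<Longrightarrow> Y \<in> VF \<Longrightarrow> Z \<in> VF \<Longrightarrow> cov_deriv2 A nab \<Omega> X Y Z x = 0"
      and c3: "\<And>X x. X \<in> VF \<Longrightarrow> torsion A nab T X x = 0"
      and c4: "\<And>Y x. Y \<in> VF \<Longrightarrow> endo_trace (endo_at A (torsion A nab Y) x) = 0"
      by (rule connection_exists, erule that) simp_all
    \<comment> \<open>Uniqueness is claimed among extensional maps, so the formula is restricted to
      smooth fields; all conditions evaluate it on such fields only.\<close>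
    define nabla where "nabla = (\<lambda>X\<in>VF. \<lambda>Y\<in>VF. nab X Y)"
    have nabla: "nabla X Y = nab X Y" if "X \<in> VF" "Y \<in> VF" for X Y using that by (simp add: nabla_def)
    have tor: "torsion A nabla X Y = torsion A nab X Y" if "X \<in> VF" "Y \<in> VF" for X Y
      using that by (simp add: torsion_def[abs_def] nabla)
    have aff: "affine_connection A nabla" unfolding nabla_def by (rule affine_connection_restrict[OF laws])
    have "unparam_geodesic A nabla P" if P: "P \<in> F" for P
    proof -
      \<comment> \<open>The parameterisation and the extensions that witness geodesicity for
        \<open>D\<close> are reused unchanged for the new connection.\<close>
      obtain I \<gamma> where \<gamma>: "immersed_curve A I \<gamma>" "P = tangent_lines A I \<gamma>"
        and ex: "\<And>t. t \<in> I \<Longrightarrow> \<exists>X\<in>VF. (\<forall>\<^sub>F s in nhds t. X (\<gamma> s) = velocity A \<gamma> s) \<and> D X X (\<gamma> t) \<in> span {velocity A \<gamma> t}"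
        using D_geo(2)[OF P] unfolding unparam_geodesic_def by blast
      have hv: "\<theta> (\<gamma> s) (velocity A \<gamma> s) = 0" if "s \<in> I" for s
      proof -
        have "(\<gamma> s, span {velocity A \<gamma> s}) \<in> P" using \<gamma>(2) that by (simp add: tangent_lines_def)
        from horizontal[OF P this] show ?thesis using span_base[of "velocity A \<gamma> s" "{velocity A \<gamma> s}"] by (auto simp: H)
      qed
      have "\<exists>X\<in>VF. (\<forall>\<^sub>F s in nhds t. X (\<gamma> s) = velocity A \<gamma> s) \<and> nabla X X (\<gamma> t) \<in> span {velocity A \<gamma> t}"
        if t: "t \<in> I" for t
      proof -
        obtain X where X: "X \<in> VF" "\<forall>\<^sub>F s in nhds t. X (\<gamma> s) = velocity A \<gamma> s" "D X X (\<gamma> t) \<in> span {velocity A \<gamma> t}"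
          using ex[OF t] by blast
        have Xt: "X (\<gamma> t) = velocity A \<gamma> t" by (rule eventually_nhds_x_imp_x[OF X(2)])
        have "open I" using \<gamma>(1) by (simp add: immersed_curve_def)
        then have "\<forall>\<^sub>F s in nhds t. s \<in> I" using t by (rule eventually_nhds_in_open)
        with X(2) have "\<forall>\<^sub>F s in nhds t. \<theta> (\<gamma> s) (X (\<gamma> s)) = 0"
          by eventually_elim (simp add: hv)
        then have "vf_apply A X (\<lambda>x. \<theta> x (X x)) (\<gamma> t) = 0"
          by (rule vf_apply_along_curve[where X = X, OF \<gamma>(1) t SF_form[OF X(1)] Xt])
        then have "nab X X (\<gamma> t) \<in> span {X (\<gamma> t)}"
          using geo[OF X(1), of "\<gamma> t"] X(3) hv[OF t] Xt by simp
        then show ?thesis using X(1,2) Xt nabla[OF X(1) X(1)] by (intro bexI[of _ X]) simp_all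
      qed
      then show ?thesis using \<gamma> unfolding unparam_geodesic_def by blast
    qed
    moreover have "cov_deriv1 A nabla \<theta> X Y x = 0" if "X \<in> VF" "Y \<in> VF" for X Y x
      using c1[OF that, of x] that by (simp add: cov_deriv1_def nabla)
    moreover have "cov_deriv2 A nabla (ext_deriv A \<theta>) X Y Z x = 0" if "X \<in> VF" "Y \<in> VF" "Z \<in> VF" for X Y Z x
      using c2[OF that, of x] that by (simp add: cov_deriv2_def nabla)
    moreover have "torsion A nabla T X x = 0" if "X \<in> VF" for X x
      using c3[OF that] tor[OF reeb(1) that] by simp
    moreover have "endo_trace (endo_at A (torsion A nabla Y) x) = 0" if Y: "Y \<in> VF" for Y x
    proof -
      have "endo_at A (torsion A nabla Y) x = endo_at A (torsion A nab Y) x"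
        using tor[OF Y] by (simp add: endo_at_def)
      then show ?thesis using c4[OF Y] by simp
    qed
    ultimately show ?thesis using aff by blast
  qed
  moreover have "D1 = D2" if D: "?conds D1" "?conds D2" for D1 D2
  proof -
    have laws: "connection_laws D1" "connection_laws D2"
      by (rule affine_connection_laws[OF conjunct1[OF D(1)]], rule affine_connection_laws[OF conjunct1[OF D(2)]])
    have geo: "\<forall>P\<in>F. unparam_geodesic A D1 P" "\<forall>P\<in>F. unparam_geodesic A D2 P"
      by (rule conjunct1[OF conjunct2[OF D(1)]], rule conjunct1[OF conjunct2[OF D(2)]])
    have conds: "?conds D'" if "D' \<in> {D1, D2}" for D'
      using that
    proof (elim insertE emptyE)
      assume e: "D' = D1"
      show ?thesis unfolding e by (rule D(1))
    next
      assume e: "D' = D2"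
      show ?thesis unfolding e by (rule D(2))
    qed
    have c1: "cov_deriv1 A D' \<theta> X Y x = 0" if "D' \<in> {D1, D2}" "X \<in> VF" "Y \<in> VF" for D' X Y x
      using conjunct1[OF conjunct2[OF conjunct2[OF conds[OF that(1)]]]] that(2,3) by blast
    have c2: "cov_deriv2 A D' \<Omega> X Y Z x = 0" if "D' \<in> {D1, D2}" "X \<in> VF" "Y \<in> VF" "Z \<in> VF" for D' X Y Z x
      using conjunct1[OF conjunct2[OF conjunct2[OF conjunct2[OF conds[OF that(1)]]]]] that(2-4) by blast
    have c3: "torsion A D' T X x = 0" if "D' \<in> {D1, D2}" "X \<in> VF" for D' X x
      using conjunct1[OF conjunct2[OF conjunct2[OF conjunct2[OF conjunct2[OF conds[OF that(1)]]]]]] that(2) by blast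
    have c4: "endo_trace (endo_at A (torsion A D' X) x) = 0" if "D' \<in> {D1, D2}" "X \<in> VF" for D' X x
      using conjunct2[OF conjunct2[OF conjunct2[OF conjunct2[OF conjunct2[OF conds[OF that(1)]]]]]] that(2) by blast
    have eq: "D1 X Y x = D2 X Y x" if "X \<in> VF" "Y \<in> VF" for X Y x
    proof (rule connection_unique[of D1 D2 X Y x])
      show "connection_laws D1" "connection_laws D2" by (fact laws)+
      show "X \<in> VF" "Y \<in> VF" by (fact that)+
      fix x L assume L: "subspace L" "dim L = 1" "L \<subseteq> {v. \<theta> x v = 0}"
      have "L \<subseteq> H x" using L(3) by (simp only: H)
      from paths[OF L(1,2) this] obtain P where P: "P \<in> F" "(x, L) \<in> P" by blast
      show "\<exists>Y\<in>VF. Y x \<noteq> 0 \<and> L = span {Y x} \<and> D2 Y Y x - D1 Y Y x \<in> span {Y x}"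
        by (rule common_geodesic_difference[OF laws bspec[OF geo(1) P(1)] bspec[OF geo(2) P(1)] P(2)])
    qed (rule c1 c2 c3 c4; assumption)+
    have PiE: "D1 \<in> VF \<rightarrow>\<^sub>E (VF \<rightarrow>\<^sub>E VF)" "D2 \<in> VF \<rightarrow>\<^sub>E (VF \<rightarrow>\<^sub>E VF)"
      by (rule conjunct1[OF conjunct1[OF D(1), unfolded affine_connection_def]],
          rule conjunct1[OF conjunct1[OF D(2), unfolded affine_connection_def]])
    show ?thesis
    proof (rule PiE_ext[OF PiE])
      fix X assume X: "X \<in> VF"
      show "D1 X = D2 X"
        by (rule PiE_ext[OF PiE_mem[OF PiE(1) X] PiE_mem[OF PiE(2) X]]) (use eq X in blast)
    qed
  qed
  ultimately show ?thesis by (rule ex_ex1I)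
qed

end
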